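(* Let $k$ be an algebraically closed field of characteristic zero and let $A=k[x_1,x_2,\dots,x_n]/\langle x_1^{d_1},x_2^{d_2},\dots,x_n^{d_n}\rangle$ be a monomial complete intersection. The possible Jordan types of nonzero linear forms $\ell=a_1x_1+\dots+a_nx_n$ (acting on $A$ by multiplication) are exactly the partitions $P_{d_{i_1},d_{i_2},\dots,d_{i_k}}^{m}$, where $m=\prod_{j=1}^n d_j\big/\prod_{j=1}^k d_{i_j}$, for all non-empty subsequences $d_{i_1},d_{i_2},\dots,d_{i_k}$ of $d_1,d_2,\dots,d_n$.
   Context: Multiplication by a linear form $\ell$ is a nilpotent linear operator on the finite-dimensional $k$-vector space $A$; its Jordan type is the partition of $\dim_k A$ given by the sizes of its Jordan blocks. For a degree sequence $d_1,\dots,d_n$, $P_{d_1,\dots,d_n}$ denotes the dual (conjugate) partition of the partition whose parts are the nonzero values of the Hilbert function of an artinian complete intersection of type $(d_1,\dots,d_n)$, i.e. of a quotient of a polynomial ring in $n$ variables by a regular sequence of $n$ forms of degrees $d_1,\dots,d_n$. For a partition $P$, $P^m$ denotes the partition obtained by repeating every part of $P$ $m$ times. (In the subsequence notation, $k$ also denotes the length of the subsequence.) *)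

theory Defs
  imports
    "HOL-Algebra.QuotRing"
    "HOL-Algebra.Embedded_Algebras"
    "HOL-Library.Poly_Mapping"
    "HOL-Library.Multiset"
    "HOL-Library.Sublist"
    "HOL-Computational_Algebra.Polynomial"
    "Jordan_Normal_Form.Jordan_Normal_Form"
begin

text \<open>Partitions are finite multisets of positive integers.\<close>

text \<open>The \<open>j\<close>-th part of the conjugate is the number of parts of \<open>P\<close> that are at least \<open>j\<close>,
  for \<open>j\<close> running from \<open>1\<close> to the largest part of \<open>P\<close>.\<close>

definition conjugate_partition :: "nat multiset \<Rightarrow> nat multiset" where
  "conjugate_partition P =
     {#size {#p \<in># P. j \<le> p#}. j \<in># mset_set {j. 1 \<le> j \<and> (\<exists>p\<in>#P. j \<le> p)}#}"


text \<open>Polynomials over \<open>'k\<close> in the variables indexed by \<open>nat\<close>. A monomial is its exponent vector.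
  The ring in \<open>n\<close> variables consists of the polynomials involving only the variables with index
  below \<open>n\<close>.\<close>

type_synonym 'k polynomial = "(nat \<Rightarrow>\<^sub>0 nat) \<Rightarrow>\<^sub>0 'k"

definition poly_ring :: "nat \<Rightarrow> ('k::comm_ring_1) polynomial ring" where
  "poly_ring n = \<lparr>carrier = {f. \<forall>m\<in>Poly_Mapping.keys f. Poly_Mapping.keys m \<subseteq> {..<n}},
     monoid.mult = (*), one = 1, zero = 0, add = (+)\<rparr>"

definition poly_const :: "'k::comm_ring_1 \<Rightarrow> 'k polynomial" where
  "poly_const c = Poly_Mapping.single 0 c"

definition poly_var :: "nat \<Rightarrow> ('k::comm_ring_1) polynomial" where
  "poly_var i = Poly_Mapping.single (Poly_Mapping.single i 1) 1"

text \<open>The zero polynomial is homogeneous of every degree.\<close>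

definition homogeneous :: "nat \<Rightarrow> ('k::comm_ring_1) polynomial \<Rightarrow> bool" where
  "homogeneous d f \<longleftrightarrow>
     (\<forall>m\<in>Poly_Mapping.keys f. (\<Sum>i\<in>Poly_Mapping.keys m. Poly_Mapping.lookup m i) = d)"

lemma cring_poly_ring: "cring (poly_ring n :: ('k::comm_ring_1) polynomial ring)"
proof -
  let ?S = "{f :: 'k polynomial. \<forall>m\<in>Poly_Mapping.keys f. Poly_Mapping.keys m \<subseteq> {..<n}}"
  have add: "f + g \<in> ?S" if "f \<in> ?S" "g \<in> ?S" for f g
    using that Poly_Mapping.keys_add[of f g] by blast
  have mult: "f * g \<in> ?S" if fg: "f \<in> ?S" "g \<in> ?S" for f g
  proof -
    have "Poly_Mapping.keys m \<subseteq> {..<n}" if m: "m \<in> Poly_Mapping.keys (f * g)" for m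
    proof -
      obtain a b where ab: "m = a + b" "a \<in> Poly_Mapping.keys f" "b \<in> Poly_Mapping.keys g"
        using m Poly_Mapping.keys_mult[of f g] by blast
      have "Poly_Mapping.keys a \<subseteq> {..<n}" "Poly_Mapping.keys b \<subseteq> {..<n}"
        using fg ab by blast+
      then show ?thesis
        using Poly_Mapping.keys_add[of a b] ab(1) by blast
    qed
    then show ?thesis by blast
  qed
  have neg: "- f \<in> ?S" if "f \<in> ?S" for f
    using that by simp
  have zero: "0 \<in> ?S" and one: "1 \<in> ?S"
    by simp_all
  have R: "carrier (poly_ring n) = ?S" "x \<oplus>\<^bsub>poly_ring n\<^esub> y = x + y"
    "x \<otimes>\<^bsub>poly_ring n\<^esub> y = x * y" "\<zero>\<^bsub>poly_ring n\<^esub> = 0" "\<one>\<^bsub>poly_ring n\<^esub> = 1"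
    for x y :: "'k polynomial"
    by (simp_all add: poly_ring_def)
  show ?thesis
  proof (rule cringI)
    show "abelian_group (poly_ring n :: 'k polynomial ring)"
    proof (rule abelian_groupI, unfold R)
      show "x + y \<in> ?S" if "x \<in> ?S" "y \<in> ?S" for x y using that by (rule add)
      show "\<exists>y\<in>?S. y + x = 0" if "x \<in> ?S" for x
        by (rule bexI[OF _ neg[OF that]]) (rule left_minus)
    qed (rule zero add.assoc add.commute add_0_left)+
    show "comm_monoid (poly_ring n :: 'k polynomial ring)"
    proof (rule comm_monoidI, unfold R)
      show "x * y \<in> ?S" if "x \<in> ?S" "y \<in> ?S" for x y using that by (rule mult)
    qed (rule one mult.assoc mult.commute mult_1_left)+
  qed (unfold R, rule distrib_right)
qed


text \<open>\<open>poly_ring n Quot I\<close> is an algebra over the image \<open>quot_scalars\<close> of the constants; its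
  linear algebra is that of the theory \<open>Embedded_Algebras\<close> with this set as field of scalars.\<close>

definition quot_const :: "nat \<Rightarrow> ('k::comm_ring_1) polynomial set \<Rightarrow> 'k \<Rightarrow> 'k polynomial set" where
  "quot_const n I c = I +>\<^bsub>poly_ring n\<^esub> poly_const c"

definition quot_degree_component ::
    "nat \<Rightarrow> ('k::comm_ring_1) polynomial set \<Rightarrow> nat \<Rightarrow> 'k polynomial set set" where
  "quot_degree_component n I d =
     {I +>\<^bsub>poly_ring n\<^esub> f | f. f \<in> carrier (poly_ring n) \<and> homogeneous d f}"

definition hilbert_function :: "nat \<Rightarrow> ('k::comm_ring_1) polynomial set \<Rightarrow> nat \<Rightarrow> nat" where
  "hilbert_function n I d =
     ring.dim (poly_ring n Quot I) (range (quot_const n I)) (quot_degree_component n I d)"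

text \<open>Used only for quotients of finite dimension, so that \<open>mset_set\<close> is applied to a finite
  set.\<close>

definition hilbert_partition :: "nat \<Rightarrow> ('k::comm_ring_1) polynomial set \<Rightarrow> nat multiset" where
  "hilbert_partition n I =
     image_mset (hilbert_function n I) (mset_set {d. hilbert_function n I d \<noteq> 0})"

definition regular_sequence :: "('a, 'b) ring_scheme \<Rightarrow> 'a list \<Rightarrow> bool" where
  "regular_sequence R fs \<longleftrightarrow>
     set fs \<subseteq> carrier R \<and> Idl\<^bsub>R\<^esub> (set fs) \<noteq> carrier R \<and>
     (\<forall>i<length fs. let I = Idl\<^bsub>R\<^esub> (set (take i fs)) in
        \<forall>a\<in>carrier (R Quot I).
          (I +>\<^bsub>R\<^esub> (fs ! i)) \<otimes>\<^bsub>R Quot I\<^esub> a = \<zero>\<^bsub>R Quot I\<^esub> \<longrightarrow> a = \<zero>\<^bsub>R Quot I\<^esub>)"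

text \<open>The number of variables is the number of forms, so the quotient by \<open>fs\<close> is artinian.\<close>

definition complete_intersection :: "nat list \<Rightarrow> ('k::comm_ring_1) polynomial list \<Rightarrow> bool" where
  "complete_intersection ds fs \<longleftrightarrow>
     length fs = length ds \<and> (\<forall>i<length ds. homogeneous (ds ! i) (fs ! i)) \<and>
     regular_sequence (poly_ring (length ds)) fs"

text \<open>\<open>is_CI_partition TYPE('k) ds P\<close> says that \<open>P\<close> is the partition usually denoted by \<open>P\<close> with
  subscript \<open>d\<^sub>1, \<dots>, d\<^sub>n\<close>. It is a relation because the Hilbert function is read off from some
  complete intersection of the given type; that it depends only on the type is a theorem.\<close>

definition is_CI_partition :: "('k::comm_ring_1) itself \<Rightarrow> nat list \<Rightarrow> nat multiset \<Rightarrow> bool" where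
  "is_CI_partition _ ds P \<longleftrightarrow>
     (\<exists>fs :: 'k polynomial list. complete_intersection ds fs \<and>
        P = conjugate_partition
              (hilbert_partition (length ds) (Idl\<^bsub>poly_ring (length ds)\<^esub> (set fs))))"


text \<open>Let \<open>\<kappa>\<close> map the field \<open>'k\<close> isomorphically onto a subfield of the ring \<open>A\<close>. Then
  \<open>represents A \<kappa> us T M\<close> says that \<open>us\<close> is a basis of \<open>A\<close> over this subfield and that \<open>M\<close> is the
  matrix of \<open>T\<close> in this basis: column \<open>j\<close> holds the coordinates of \<open>T (us ! j)\<close>.\<close>

definition represents ::
    "('a, 'b) ring_scheme \<Rightarrow> ('k \<Rightarrow> 'a) \<Rightarrow> 'a list \<Rightarrow> ('a \<Rightarrow> 'a) \<Rightarrow> 'k mat \<Rightarrow> bool" where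
  "represents A \<kappa> us T M \<longleftrightarrow>
     ring.independent A (range \<kappa>) us \<and> ring.Span A (range \<kappa>) us = carrier A \<and>
     M \<in> carrier_mat (length us) (length us) \<and>
     (\<forall>j<length us.
        T (us ! j) = ring.combine A (map (\<lambda>i. \<kappa> (M $$ (i, j))) [0..<length us]) us)"

definition has_jordan_type ::
    "('a, 'b) ring_scheme \<Rightarrow> ('k::field \<Rightarrow> 'a) \<Rightarrow> ('a \<Rightarrow> 'a) \<Rightarrow> nat multiset \<Rightarrow> bool" where
  "has_jordan_type A \<kappa> T P \<longleftrightarrow>
     (\<exists>us M blocks. represents A \<kappa> us T M \<and> jordan_nf M blocks \<and> P = mset (map fst blocks))"


definition monomial_ideal :: "nat list \<Rightarrow> ('k::comm_ring_1) polynomial set" where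
  "monomial_ideal ds = Idl\<^bsub>poly_ring (length ds)\<^esub> {poly_var i ^ (ds ! i) | i. i < length ds}"

definition monomial_CI :: "nat list \<Rightarrow> ('k::comm_ring_1) polynomial set ring" where
  "monomial_CI ds = poly_ring (length ds) Quot monomial_ideal ds"

definition linear_form :: "nat \<Rightarrow> (nat \<Rightarrow> 'k::comm_ring_1) \<Rightarrow> 'k polynomial" where
  "linear_form n a = (\<Sum>i<n. poly_const (a i) * poly_var i)"

definition form_has_jordan_type ::
    "nat list \<Rightarrow> ('k::field) polynomial \<Rightarrow> nat multiset \<Rightarrow> bool" where
  "form_has_jordan_type ds l P \<longleftrightarrow>
     has_jordan_type (monomial_CI ds) (quot_const (length ds) (monomial_ideal ds))
       (\<lambda>x. (monomial_ideal ds +>\<^bsub>poly_ring (length ds)\<^esub> l) \<otimes>\<^bsub>monomial_CI ds\<^esub> x) P"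

end

theory Submission
  imports
    Defs
    "Jordan_Normal_Form.Jordan_Normal_Form_Existence"
    "Jordan_Normal_Form.Jordan_Normal_Form_Uniqueness"
    "HOL-Library.Function_Algebras"
begin

text \<open>Let \<open>A\<close> be the quotient of the polynomial ring by the powers \<open>x\<^sub>i\<close>
to the \<open>d\<^sub>i\<close>, and let \<open>l = \<Sum>a\<^sub>i x\<^sub>i\<close> have the
support \<open>s = {i. a\<^sub>i \<noteq> 0}\<close>. Multiplication by \<open>l\<close> is
nilpotent, so its Jordan type is determined by the dimensions of the kernels of its powers: a
block of size \<open>p\<close> contributes \<open>min k p\<close> to the kernel of the
\<open>k\<close>-th power. The proof computes these dimensions and finds that they depend on
\<open>s\<close> only, in such a way that the Jordan type is the one that belongs to the
subsequence of the \<open>d\<^sub>i\<close> with \<open>i \<in> s\<close>. Every non-empty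
subsequence occurs, because every set of indices is the support of a linear form.

The kernel dimensions come from a representation of the Lie algebra of traceless matrices of size
two. Give a monomial the degree \<open>j\<close> in the variables of the support only. There is an
operator \<open>F\<close> that lowers this degree by one, the sum over \<open>i \<in> s\<close>
of the maps sending the exponent \<open>e\<close> of \<open>x\<^sub>i\<close> to
\<open>e - 1\<close> with the coefficient \<open>e (d\<^sub>i - e) / a\<^sub>i\<close>,
whose commutator with multiplication by \<open>l\<close> is the scalar
\<open>\<sigma> - 2 j\<close> in degree \<open>j\<close>, where
\<open>\<sigma> = \<Sum>(d\<^sub>i - 1)\<close> is the top degree. In characteristic zero this
forces the \<open>k\<close>-th power of \<open>l\<close> to be injective from degree
\<open>j\<close> to degree \<open>j + k\<close> if \<open>2 j + k \<le> \<sigma>\<close>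
(\<open>E_pow_injective\<close>); since the dimensions in the degrees \<open>j\<close> and
\<open>\<sigma> - j\<close> agree, it is surjective otherwise. So the kernel has the dimension
\<open>h j - h (j + k)\<close> in degree \<open>j\<close>, cut off at \<open>0\<close>
(\<open>dim_kernel_E_pow\<close>), and \<open>h\<close> is unimodal. Working with the degree in
the support avoids splitting \<open>A\<close> as a tensor product: the variables outside the
support only multiply every dimension by \<open>m = \<Prod>d\<^sub>i\<close>, the product over
\<open>i \<notin> s\<close> (\<open>card_box_nths\<close>).

For a unimodal function \<open>h\<close> the set \<open>{j. h j \<ge> t}\<close> is an
interval, whose length is the \<open>t\<close>-th part of the conjugate partition. An interval of
length \<open>p\<close> has \<open>min k p\<close> elements that leave it under the shift by
\<open>k\<close>. Summing over \<open>t\<close> shows that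
\<open>\<Sum>(h j - h (j + k))\<close> equals \<open>\<Sum>min k p\<close>, summed over
the parts \<open>p\<close> of the conjugate partition
(\<open>sum_min_conjugate_partition\<close>).

It remains to identify \<open>h\<close> with the Hilbert function of an arbitrary complete
intersection of the given type. Adding a regular form of degree \<open>e\<close> to a homogeneous
ideal changes the Hilbert function \<open>H\<close> into \<open>H j - H (j - e)\<close>
(\<open>graded_dim_regular\<close>), so that the Hilbert function of a complete intersection is
determined by the degrees of the forms. The powers of the variables form a complete intersection,
and for these the Hilbert function counts the monomials below the given exponents
(\<open>hilbert_function_complete_intersection\<close>).\<close>

section \<open>Dimensions of subspaces and quotient spaces\<close>

text \<open>The dimension is the cardinality of a basis, which is \<open>0\<close> for an infinite basis;
statements about dimensions therefore carry finiteness as a separate hypothesis.\<close>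

definition (in vector_space) finite_dim :: "'b set \<Rightarrow> bool" where
  "finite_dim W \<longleftrightarrow> (\<exists>T. finite T \<and> W \<subseteq> span T)"

context vector_space
begin

lemma finite_dim_subset: "finite_dim W \<Longrightarrow> U \<subseteq> W \<Longrightarrow> finite_dim U"
  unfolding finite_dim_def by blast

lemma independent_finite_dim:
  assumes "finite_dim W" "independent B" "B \<subseteq> W"
  shows "finite B"
  using assms independent_span_bound unfolding finite_dim_def by blast

lemma independent_Un_disjoint_spans:
  assumes B: "independent B" "finite B" and C: "independent C" "finite C"
    and disj: "span B \<inter> span C \<subseteq> {0}"
  shows "B \<inter> C = {}" "independent (B \<union> C)"
proof -
  have "0 \<notin> B" using B(1) dependent_zero by blast
  then show BC: "B \<inter> C = {}"
    using disj span_base[of _ B] span_base[of _ C] by blast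
  show "independent (B \<union> C)"
  proof (rule independent_if_scalars_zero)
    show "finite (B \<union> C)" using B C by simp
    fix f x assume s: "(\<Sum>x\<in>B \<union> C. f x *s x) = 0" and x: "x \<in> B \<union> C"
    let ?b = "\<Sum>x\<in>B. f x *s x" and ?c = "\<Sum>x\<in>C. f x *s x"
    have eq: "?b + ?c = 0"
      using s sum.union_disjoint[OF B(2) C(2) BC, of "\<lambda>x. f x *s x"] by simp
    have b: "?b \<in> span B" and c: "?c \<in> span C"
      by (rule span_sum, rule span_scale, erule span_base)+
    have "?b = - ?c" using eq by (simp add: eq_neg_iff_add_eq_0)
    then have "?b \<in> span C" using span_neg[OF c] by simp
    then have b0: "?b = 0" using b disj by blast
    then have c0: "?c = 0" using eq by simp
    show "f x = 0"
      using x independentD[OF B(1) B(2) subset_refl b0] independentD[OF C(1) C(2) subset_refl c0]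
      by blast
  qed
qed

text \<open>The span of \<open>C\<close> is a copy of the quotient \<open>W / U\<close> inside
\<open>W\<close>, so that dimensions and bases of quotient spaces can be handled without forming
quotients.\<close>

lemma subspace_complement:
  assumes U: "subspace U" and W: "subspace W" and UW: "U \<subseteq> W" and fin: "finite_dim W"
  obtains C where "finite C" "independent C" "C \<subseteq> W" "U \<inter> span C = {0}"
    "W = {u + c | u c. u \<in> U \<and> c \<in> span C}" "dim W = dim U + card C"
proof -
  obtain B where B: "B \<subseteq> U" "independent B" "U \<subseteq> span B" "card B = dim U"
    by (rule basis_exists)
  obtain D where D: "B \<subseteq> D" "D \<subseteq> W" "independent D" "W \<subseteq> span D"
    using maximal_independent_subset_extend[of B W] B UW by blast
  define C where "C = D - B"
  have finD: "finite D" using independent_finite_dim[OF fin D(3) D(2)] .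
  have spB: "span B = U" using span_subspace[OF B(1) B(3) U] .
  have spD: "span D = W" using span_subspace[OF D(2) D(4) W] .
  have D_eq: "D = B \<union> C" "B \<inter> C = {}" using D(1) C_def by auto
  show ?thesis
  proof
    show "finite C" "C \<subseteq> W" using finD D C_def by auto
    show "independent C" using D(3) C_def independent_mono by blast
    show "W = {u + c | u c. u \<in> U \<and> c \<in> span C}"
      using span_Un[of B C] spB spD D_eq by simp
    show "dim W = dim U + card C"
      using basis_card_eq_dim[OF D(2) D(4) D(3)] B(4) finD D_eq card_Un_disjoint[of B C]
      by (metis finite_Un)
    have "x = 0" if x: "x \<in> U" "x \<in> span C" for x
    proof -
      have "x \<in> span B" using x spB by simp
      then obtain r where r: "x = (\<Sum>a\<in>B. r a *s a)"
        using span_finite[of B] finD D_eq by (auto simp: finite_Un)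
      obtain q where q: "x = (\<Sum>a\<in>C. q a *s a)"
        using span_finite[of C] finD D_eq x(2) by (auto simp: finite_Un)
      let ?h = "\<lambda>a. if a \<in> B then r a else - q a"
      have "(\<Sum>a\<in>D. ?h a *s a) = (\<Sum>a\<in>B. ?h a *s a) + (\<Sum>a\<in>C. ?h a *s a)"
        using sum.union_disjoint[of B C "\<lambda>a. ?h a *s a"] finD D_eq by (simp add: finite_Un)
      also have "(\<Sum>a\<in>B. ?h a *s a) = x" using r by simp
      also have "(\<Sum>a\<in>C. ?h a *s a) = (\<Sum>a\<in>C. - (q a *s a))"
        using D_eq(2) by (intro sum.cong) auto
      also have "\<dots> = - x" using q by (simp add: sum_negf)
      finally have 0: "(\<Sum>a\<in>D. ?h a *s a) = 0" by simp
      have "r a = 0" if "a \<in> B" for a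
        using independentD[OF D(3) finD subset_refl 0, of a] that D(1) by auto
      then show ?thesis using r by simp
    qed
    then show "U \<inter> span C = {0}" using subspace_0[OF U] span_zero by auto
  qed
qed

end

text \<open>The map \<open>g\<close> induces an isomorphism from \<open>W / U\<close> to
\<open>W' / U'\<close>; the conclusion equates the dimensions of the two quotients. For
\<open>U' = {0}\<close> this is the rank-nullity theorem, and for multiplication by a regular
element it is the recursion for Hilbert functions.\<close>

lemma (in vector_space_pair) dim_quotient_iso:
  assumes g: "Vector_Spaces.linear s1 s2 g"
    and U: "vs1.subspace U" and W: "vs1.subspace W" "U \<subseteq> W" "vs1.finite_dim W"
    and U': "vs2.subspace U'" and W': "vs2.finite_dim W'"
    and im: "W' = {u + g w | u w. u \<in> U' \<and> w \<in> W}"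
    and ker: "\<And>w. w \<in> W \<Longrightarrow> g w \<in> U' \<longleftrightarrow> w \<in> U"
  shows "vs2.dim W' + vs1.dim U = vs1.dim W + vs2.dim U'"
proof -
  interpret g: Vector_Spaces.linear s1 s2 g by (rule g)
  obtain C where C: "finite C" "vs1.independent C" "C \<subseteq> W" "U \<inter> vs1.span C = {0}"
    "W = {u + c | u c. u \<in> U \<and> c \<in> vs1.span C}" "vs1.dim W = vs1.dim U + card C"
    using vs1.subspace_complement[OF U W] by blast
  have spC: "vs1.span C \<subseteq> W" using vs1.span_minimal[OF C(3) W(1)] .
  have inj: "inj_on g (vs1.span C)"
  proof (subst linear_inj_on_iff_eq_0[OF g vs1.subspace_span], safe)
    fix x assume x: "x \<in> vs1.span C" "g x = 0"
    then have "x \<in> U" using ker[of x] spC vs2.subspace_0[OF U'] by auto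
    then show "x = 0" using x C(4) by auto
  qed
  have gC: "vs2.independent (g ` C)"
    using linear_independent_injective_image[OF g C(2) inj] .
  have U'W': "U' \<subseteq> W'"
  proof
    fix u assume "u \<in> U'"
    moreover have "u = u + g 0" by (simp add: g.zero)
    ultimately show "u \<in> W'" unfolding im using vs1.subspace_0[OF W(1)] by blast
  qed
  obtain B where B: "B \<subseteq> U'" "vs2.independent B" "U' \<subseteq> vs2.span B" "card B = vs2.dim U'"
    by (rule vs2.basis_exists)
  have spB: "vs2.span B = U'" using vs2.span_subspace[OF B(1) B(3) U'] .
  have finB: "finite B" using vs2.independent_finite_dim[OF W' B(2)] B(1) U'W' by blast
  have spgC: "vs2.span (g ` C) = g ` vs1.span C" using linear_span_image[OF g] .
  have disj: "vs2.span B \<inter> vs2.span (g ` C) \<subseteq> {0}"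
  proof
    fix y assume "y \<in> vs2.span B \<inter> vs2.span (g ` C)"
    then obtain x where x: "x \<in> vs1.span C" "y = g x" "y \<in> U'" using spB spgC by auto
    then have "x \<in> U" using ker spC by auto
    then have "x = 0" using x(1) C(4) by blast
    then show "y \<in> {0}" using x(2) g.zero by simp
  qed
  note BC = vs2.independent_Un_disjoint_spans[OF B(2) finB gC finite_imageI[OF C(1)] disj]
  have "vs2.span (B \<union> g ` C) = W'"
  proof
    show "vs2.span (B \<union> g ` C) \<subseteq> W'"
      unfolding vs2.span_Un spB spgC im using spC by blast
    show "W' \<subseteq> vs2.span (B \<union> g ` C)"
    proof
      fix y assume "y \<in> W'"
      then obtain u w where y: "y = u + g w" "u \<in> U'" "w \<in> W" using im by auto
      then obtain v c where w: "w = v + c" "v \<in> U" "c \<in> vs1.span C" using C(5) by auto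
      have "g v \<in> U'" using ker[of v] w W by auto
      then have "u + g v \<in> vs2.span B" using y spB vs2.subspace_add[OF U'] by auto
      moreover have "y = (u + g v) + g c" using y w g.add by (simp add: add.assoc)
      ultimately show "y \<in> vs2.span (B \<union> g ` C)"
        unfolding vs2.span_Un spgC using w(3) by blast
    qed
  qed
  then have "vs2.dim W' = card (B \<union> g ` C)"
    using BC(2) vs2.dim_span_eq_card_independent by metis
  also have "\<dots> = card B + card C"
    using BC(1) finB C(1) card_image[OF inj_on_subset[OF inj vs1.span_superset]]
    by (simp add: card_Un_disjoint)
  finally show ?thesis using B(4) C(6) by simp
qed

corollary (in vector_space_pair) dim_image_plus_dim_kernel:
  assumes g: "Vector_Spaces.linear s1 s2 g" and W: "vs1.subspace W" "vs1.finite_dim W"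
  shows "vs2.dim (g ` W) + vs1.dim {w \<in> W. g w = 0} = vs1.dim W"
proof -
  interpret g: Vector_Spaces.linear s1 s2 g by (rule g)
  obtain T where T: "finite T" "W \<subseteq> vs1.span T" using W(2) vs1.finite_dim_def by auto
  have "vs2.finite_dim (g ` W)"
    unfolding vs2.finite_dim_def
    using T linear_span_image[OF g, of T] by (intro exI[of _ "g ` T"]) auto
  moreover have "vs1.subspace {w \<in> W. g w = 0}"
    using W(1) by (auto simp: vs1.subspace_def g.add g.scale g.zero)
  ultimately have "vs2.dim (g ` W) + vs1.dim {w \<in> W. g w = 0} = vs1.dim W + vs2.dim {0}"
    using g W vs2.subspace_single_0 by (intro dim_quotient_iso[of g]) auto
  moreover have "vs2.dim {0} = 0"
    using vs2.dim_unique[of "{}" "{0}" 0] vs2.independent_empty by simp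
  ultimately show ?thesis by simp
qed

context vector_space
begin

lemma dim_mono_finite_dim:
  assumes "subspace U" "subspace W" "U \<subseteq> W" "finite_dim W"
  shows "dim U \<le> dim W"
proof -
  show ?thesis by (rule subspace_complement[OF assms]) simp
qed

lemma subspace_eq_if_dim_eq:
  assumes U: "subspace U" and W: "subspace W" "U \<subseteq> W" "finite_dim W" and "dim U = dim W"
  shows "U = W"
proof -
  obtain C where C: "finite C" "W = {u + c | u c. u \<in> U \<and> c \<in> span C}" "dim W = dim U + card C"
    by (rule subspace_complement[OF U W], rule that, assumption+)
  then have "C = {}" using assms(5) by simp
  then show ?thesis using C(2) by simp
qed

lemma dim_zero_space: "dim {0} = 0"
  using dim_unique[of "{}" "{0}" 0] independent_empty by simp

end

section \<open>Raising and lowering operators on graded spaces\<close>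

text \<open>The operators \<open>E\<close> and \<open>F\<close>, together with their commutator, form a
representation of the Lie algebra of traceless matrices of size two, and \<open>V j\<close> is
its weight space of the weight \<open>s - 2 j\<close>.\<close>

locale graded_sl2 = vector_space scale
  for scale :: "'a::field_char_0 \<Rightarrow> 'b::ab_group_add \<Rightarrow> 'b" (infixr \<open>*s\<close> 75) +
  fixes E F :: "'b \<Rightarrow> 'b" and V :: "nat \<Rightarrow> 'b set" and s :: nat
  assumes linear_E: "Vector_Spaces.linear scale scale E"
    and linear_F: "Vector_Spaces.linear scale scale F"
    and subspace_V: "subspace (V j)"
    and E_raises: "v \<in> V j \<Longrightarrow> E v \<in> V (Suc j)"
    and F_lowers: "v \<in> V (Suc j) \<Longrightarrow> F v \<in> V j"
    and F_lowest: "v \<in> V 0 \<Longrightarrow> F v = 0"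
    and commutator: "v \<in> V j \<Longrightarrow> F (E v) - E (F v) = of_int (int s - 2 * int j) *s v"
begin

sublocale pair: vector_space_pair scale scale ..

interpretation E: Vector_Spaces.linear scale scale E by (rule linear_E)
interpretation F: Vector_Spaces.linear scale scale F by (rule linear_F)

lemma linear_E_pow: "Vector_Spaces.linear scale scale (E ^^ i)"
proof (induction i)
  case 0
  then show ?case using linear_id by (simp add: id_def)
next
  case (Suc i)
  then show ?case using Vector_Spaces.linear_compose[OF Suc linear_E] by (simp add: o_def)
qed

lemma E_pow_raises: "v \<in> V j \<Longrightarrow> (E ^^ i) v \<in> V (j + i)"
  by (induction i) (auto intro: E_raises)

text \<open>Moving \<open>F\<close> past the factors \<open>E\<close> one after the other collects the weights
\<open>s - 2 j\<close>, \<open>s - 2 (j + 1)\<close>, \<open>\<dots>\<close>,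
\<open>s - 2 (j + i)\<close>, whose sum is \<open>(i + 1) (s - 2 j - i)\<close>.\<close>

lemma F_E_pow:
  assumes v: "v \<in> V j"
  shows "F ((E ^^ Suc i) v) =
    (E ^^ Suc i) (F v) + of_int ((int i + 1) * (int s - 2 * int j - int i)) *s (E ^^ i) v"
proof (induction i)
  case 0
  then show ?case using commutator[OF v] by (simp add: algebra_simps)
next
  case (Suc i)
  let ?w = "(E ^^ Suc i) v" and ?c = "(int i + 1) * (int s - 2 * int j - int i)"
  have "F (E ?w) = E (F ?w) + of_int (int s - 2 * int (j + Suc i)) *s ?w"
    using commutator[OF E_pow_raises[OF v, of "Suc i"]] by (simp add: algebra_simps)
  also have "E (F ?w) = E ((E ^^ Suc i) (F v)) + of_int ?c *s ?w"
    unfolding Suc.IH E.add E.scale by simp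
  finally have "F (E ?w) = E ((E ^^ Suc i) (F v))
      + (of_int ?c + of_int (int s - 2 * int (j + Suc i))) *s ?w"
    by (simp only: scale_left_distrib add.assoc)
  also have "(of_int ?c + of_int (int s - 2 * int (j + Suc i)) :: 'a) =
      of_int ((int (Suc i) + 1) * (int s - 2 * int j - int (Suc i)))"
    unfolding of_int_add[symmetric] by (rule arg_cong[where f = of_int]) (simp add: algebra_simps)
  finally show ?case by simp
qed

text \<open>By induction on \<open>j\<close>. If the \<open>i\<close>-th power of \<open>E\<close> kills
\<open>v\<close>, then by \<open>F_E_pow\<close> the power with the exponent
\<open>i + 2\<close> kills \<open>F v\<close>, and so \<open>F v = 0\<close> by the
induction hypothesis in degree \<open>j - 1\<close>. Now \<open>F_E_pow\<close> says that a
nonzero multiple of the power with the exponent \<open>i - 1\<close> applied to \<open>v\<close>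
vanishes; descending to the exponent \<open>0\<close> gives \<open>v = 0\<close>. Characteristic
zero enters through the coefficient in \<open>F_E_pow\<close>, which is a positive integer as long
as \<open>2 j + i \<le> s\<close>.\<close>

lemma E_pow_injective:
  assumes "v \<in> V j" "2 * j + i \<le> s" "(E ^^ i) v = 0"
  shows "v = 0"
  using assms
proof (induction j arbitrary: v i)
  have descend: "v = 0" if v: "v \<in> V j" "2 * j + i \<le> s" "(E ^^ i) v = 0"
    and F0: "\<And>v i. v \<in> V j \<Longrightarrow> 2 * j + i \<le> s \<Longrightarrow> (E ^^ i) v = 0 \<Longrightarrow> F v = 0" for v i j
    using v
  proof (induction i)
    case (Suc i)
    \<comment> \<open>both other terms of \<open>F_E_pow\<close> vanish: \<open>F v = 0\<close>, and \<open>F\<close> is applied to \<open>0\<close>\<close>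
    have "of_int ((int i + 1) * (int s - 2 * int j - int i)) *s (E ^^ i) v = 0"
      using F_E_pow[OF Suc.prems(1), of i] F0[OF Suc.prems] Suc.prems(3)
        pair.linear_0[OF linear_E_pow] F.zero by simp
    moreover have "(int i + 1) * (int s - 2 * int j - int i) \<noteq> 0" using Suc.prems(2) by auto
    ultimately have "(E ^^ i) v = 0" using of_int_eq_0_iff[where 'a = 'a] scale_eq_0_iff by blast
    then show ?case using Suc by simp
  qed simp
  {
    case 0
    then show ?case using descend[of v 0 i] F_lowest by blast
  next
    case (Suc j)
    have "F v = 0" if v: "v \<in> V (Suc j)" "2 * Suc j + i \<le> s" "(E ^^ i) v = 0" for v i
    proof -
      have "E ((E ^^ i) v) = 0" using v(3) E.zero by simp
      then have "(E ^^ Suc i) (F v) = 0"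
        using F_E_pow[OF v(1), of i] v(3) F.zero by simp
      then show ?thesis using Suc.IH[OF F_lowers[OF v(1)], of "Suc i"] v(2) by simp
    qed
    then show ?case using descend Suc.prems by blast
  }
qed

end

text \<open>The symmetry of the dimensions turns the injective maps from degree \<open>j\<close> to the
complementary degree \<open>s - j\<close> into bijections, as in the hard Lefschetz theorem.\<close>

locale lefschetz = graded_sl2 +
  assumes finite_dim_V: "finite_dim (V j)"
    and dim_symmetric: "j \<le> s \<Longrightarrow> dim (V (s - j)) = dim (V j)"
    and V_top: "s < j \<Longrightarrow> V j = {0}"
begin

lemma E_pow_image_subset: "(E ^^ i) ` V j \<subseteq> V (j + i)"
  using E_pow_raises by blast

lemma kernel_E_pow:
  assumes "2 * j + i \<le> s"
  shows "{v \<in> V j. (E ^^ i) v = 0} = {0}"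
  using E_pow_injective[OF _ assms] subspace_0[OF subspace_V] pair.linear_0[OF linear_E_pow]
  by blast

lemma dim_image_E_pow:
  assumes "2 * j + i \<le> s"
  shows "dim ((E ^^ i) ` V j) = dim (V j)"
  using pair.dim_image_plus_dim_kernel[OF linear_E_pow subspace_V finite_dim_V, of i j]
    kernel_E_pow[OF assms] dim_zero_space by simp

text \<open>The power of \<open>E\<close> that ends in degree \<open>j + i\<close> and starts in the
complementary degree \<open>r = s - (j + i)\<close> is injective between spaces of equal
dimension, hence onto. It factors through degree \<open>j\<close>, because
\<open>r \<le> j\<close>, so its last factor is onto as well.\<close>

lemma E_pow_surjective:
  assumes "s \<le> 2 * j + i"
  shows "(E ^^ i) ` V j = V (j + i)"
proof (cases "j + i \<le> s")
  case False
  then have "V (j + i) = {0}" using V_top by simp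
  moreover have "0 \<in> (E ^^ i) ` V j"
    using subspace_0[OF subspace_V, of j] pair.linear_0[OF linear_E_pow, of i] by force
  ultimately show ?thesis using E_pow_image_subset[of i j] by auto
next
  case True
  define r where "r = s - (j + i)"
  have r: "r \<le> j" "2 * r + (i + (j - r)) = s" "r + (i + (j - r)) = j + i"
    using True assms by (auto simp: r_def)
  have "dim ((E ^^ (i + (j - r))) ` V r) = dim (V (j + i))"
    using dim_image_E_pow[of r "i + (j - r)"] r(2) dim_symmetric[OF True] r_def by simp
  then have "(E ^^ (i + (j - r))) ` V r = V (j + i)"
    using E_pow_image_subset[of "i + (j - r)" r] unfolding r(3)
    by (intro subspace_eq_if_dim_eq pair.linear_subspace_image[OF linear_E_pow]
        subspace_V finite_dim_V)
  moreover have "(E ^^ (i + (j - r))) ` V r \<subseteq> (E ^^ i) ` V j"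
    using E_pow_image_subset[of "j - r" r] r(1)
    by (simp only: funpow_add image_comp[symmetric] le_add_diff_inverse image_mono)
  ultimately show ?thesis using E_pow_image_subset[of i j] by blast
qed

lemma dim_V_le:
  assumes "2 * j + i \<le> s"
  shows "dim (V j) \<le> dim (V (j + i))"
  using dim_mono_finite_dim[OF pair.linear_subspace_image[OF linear_E_pow subspace_V] subspace_V
      E_pow_image_subset finite_dim_V, of i j] dim_image_E_pow[OF assms] by simp

lemma dim_V_ge:
  assumes "s \<le> 2 * j + i"
  shows "dim (V (j + i)) \<le> dim (V j)"
  using E_pow_surjective[OF assms]
    pair.dim_image_plus_dim_kernel[OF linear_E_pow subspace_V finite_dim_V, of i j] by simp

text \<open>The subtraction of natural numbers is cut off at \<open>0\<close>, so that the formula covers the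
injective and the surjective case at once.\<close>

theorem dim_kernel_E_pow: "dim {v \<in> V j. (E ^^ i) v = 0} = dim (V j) - dim (V (j + i))"
proof (cases "2 * j + i \<le> s")
  case True
  then show ?thesis using kernel_E_pow dim_V_le dim_zero_space by simp
next
  case False
  then show ?thesis
    using E_pow_surjective[of j i]
      pair.dim_image_plus_dim_kernel[OF linear_E_pow subspace_V finite_dim_V, of i j] by simp
qed

lemma dim_V_unimodal:
  assumes "i \<le> j" "j \<le> k"
  shows "min (dim (V i)) (dim (V k)) \<le> dim (V j)"
proof (cases "i + j \<le> s")
  case True
  then show ?thesis using dim_V_le[of i "j - i"] assms by simp
next
  case False
  then show ?thesis using dim_V_ge[of j "k - j"] assms by simp
qed

end

section \<open>Polynomials as a vector space\<close>

interpretation poly_vs: vector_space "\<lambda>c (f :: 'k::field polynomial). poly_const c * f"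
proof
  fix a b :: 'k and x y :: "'k polynomial"
  show "poly_const a * (x + y) = poly_const a * x + poly_const a * y"
    by (rule distrib_left)
  show "poly_const (a + b) * x = poly_const a * x + poly_const b * x"
    by (simp add: poly_const_def single_add distrib_right)
  show "poly_const a * (poly_const b * x) = poly_const (a * b) * x"
    by (simp add: poly_const_def mult.assoc[symmetric] mult_single)
  show "poly_const 1 * x = x"
    by (simp add: poly_const_def)
qed

lemma lookup_single_mult:
  fixes f :: "'k::comm_ring_1 polynomial"
  shows "Poly_Mapping.lookup (Poly_Mapping.single a c * f) (a + b) = c * Poly_Mapping.lookup f b"
  by (simp add: lookup_mult lookup_single when_mult)

lemma lookup_single_mult_eq_0:
  fixes f :: "'k::comm_ring_1 polynomial"
  assumes "\<And>b. m \<noteq> a + b"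
  shows "Poly_Mapping.lookup (Poly_Mapping.single a c * f) m = 0"
  using assms by (simp add: lookup_mult lookup_single when_mult)

lemma lookup_poly_const_mult [simp]:
  "Poly_Mapping.lookup (poly_const c * f) m = c * Poly_Mapping.lookup (f :: 'k::comm_ring_1 polynomial) m"
  using lookup_single_mult[of 0 c f m] by (simp add: poly_const_def)

lemma sum_single_lookup:
  fixes f :: "'a \<Rightarrow>\<^sub>0 'b::comm_monoid_add"
  shows "(\<Sum>m\<in>Poly_Mapping.keys f. Poly_Mapping.single m (Poly_Mapping.lookup f m)) = f"
  by (rule poly_mapping_eqI)
    (auto simp: lookup_sum lookup_single when_def in_keys_iff)

definition supported_on :: "(nat \<Rightarrow>\<^sub>0 nat) set \<Rightarrow> 'k::comm_ring_1 polynomial set" where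
  "supported_on X = {f. Poly_Mapping.keys f \<subseteq> X}"

lemma subspace_supported_on: "poly_vs.subspace (supported_on X :: 'k::field polynomial set)"
proof (rule poly_vs.subspaceI)
  fix c :: 'k and x y :: "'k polynomial"
  show "0 \<in> supported_on X" by (simp add: supported_on_def)
  assume x: "x \<in> supported_on X"
  then show "poly_const c * x \<in> supported_on X"
    by (auto simp: supported_on_def in_keys_iff)
  assume "y \<in> supported_on X"
  then show "x + y \<in> supported_on X"
    using x Poly_Mapping.keys_add[of x y] by (auto simp: supported_on_def)
qed

lemma single_basis_supported_on:
  assumes "finite X"
  defines "B \<equiv> (\<lambda>m. Poly_Mapping.single m (1 :: 'k::field)) ` X"
  shows "poly_vs.independent B" "poly_vs.span B = supported_on X" "card B = card X"
proof -
  have inj: "inj_on (\<lambda>m. Poly_Mapping.single m (1 :: 'k)) X"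
    by (rule inj_onI) (metis keys_single zero_neq_one the_elem_eq)
  then show "card B = card X" unfolding B_def by (rule card_image)
  have comb: "(\<Sum>b\<in>B. poly_const (u b) * b) =
      (\<Sum>m\<in>X. Poly_Mapping.single m (u (Poly_Mapping.single m 1)))" for u
    unfolding B_def sum.reindex[OF inj] by (simp add: poly_const_def mult_single)
  show "poly_vs.independent B"
  proof (rule poly_vs.independent_if_scalars_zero)
    show "finite B" using assms(1) B_def by simp
    fix u b assume 0: "(\<Sum>b\<in>B. poly_const (u b) * b) = 0" and b: "b \<in> B"
    then obtain m where m: "m \<in> X" "b = Poly_Mapping.single m 1" unfolding B_def by auto
    have "Poly_Mapping.lookup (\<Sum>m\<in>X. Poly_Mapping.single m (u (Poly_Mapping.single m 1))) m = 0"
      using 0 unfolding comb by simp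
    then show "u b = 0"
      using m assms(1) by (simp add: lookup_sum lookup_single when_def)
  qed
  show "poly_vs.span B = supported_on X"
  proof
    have "B \<subseteq> supported_on X" by (auto simp: B_def supported_on_def)
    then show "poly_vs.span B \<subseteq> supported_on X"
      using subspace_supported_on by (rule poly_vs.span_minimal)
    show "supported_on X \<subseteq> poly_vs.span B"
    proof
      fix f :: "'k polynomial" assume f: "f \<in> supported_on X"
      have "(\<Sum>m\<in>Poly_Mapping.keys f. poly_const (Poly_Mapping.lookup f m) * Poly_Mapping.single m 1)
          \<in> poly_vs.span B"
        using f by (intro poly_vs.span_sum poly_vs.span_scale poly_vs.span_base)
          (auto simp: B_def supported_on_def)
      then show "f \<in> poly_vs.span B"
        using sum_single_lookup[of f] by (simp add: poly_const_def mult_single)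
    qed
  qed
qed

lemma dim_supported_on:
  assumes "finite X"
  shows "poly_vs.dim (supported_on X :: 'k::field polynomial set) = card X"
  using single_basis_supported_on[OF assms, where 'k = 'k] poly_vs.dim_span_eq_card_independent
  by metis

lemma finite_dim_supported_on:
  assumes "finite X"
  shows "poly_vs.finite_dim (supported_on X :: 'k::field polynomial set)"
  using single_basis_supported_on(2)[OF assms, where 'k = 'k] assms
  unfolding poly_vs.finite_dim_def by blast

lemma (in vector_space) span_set_nth:
  assumes "distinct us"
  shows "span (set us) = {\<Sum>i<length us. c i *s us ! i | c. True}"
proof -
  have bij: "bij_betw (\<lambda>i. us ! i) {..<length us} (set us)"
    using assms by (simp add: bij_betw_nth)
  have "(\<Sum>x\<in>set us. u x *s x) = (\<Sum>i<length us. u (us ! i) *s us ! i)" for u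
    using sum.reindex_bij_betw[OF bij, of "\<lambda>x. u x *s x"] by simp
  moreover have "\<exists>u. (\<Sum>i<length us. c i *s us ! i) = (\<Sum>i<length us. u (us ! i) *s us ! i)" for c
    using bij_betw_inv_into_left[OF bij]
    by (intro exI[of _ "c \<circ> inv_into {..<length us} (\<lambda>i. us ! i)"]) simp
  ultimately show ?thesis
    unfolding span_finite[OF finite_set] by (auto simp: image_def)
qed

lemma (in vector_space) independent_set_nth:
  assumes "distinct us" "independent (set us)" "(\<Sum>i<length us. c i *s us ! i) = 0" "i < length us"
  shows "c i = 0"
proof -
  have bij: "bij_betw (\<lambda>i. us ! i) {..<length us} (set us)"
    using assms by (simp add: bij_betw_nth)
  let ?u = "c \<circ> inv_into {..<length us} (\<lambda>i. us ! i)"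
  have u: "?u (us ! i) = c i" if "i < length us" for i
    using bij_betw_inv_into_left[OF bij] that by simp
  have "(\<Sum>x\<in>set us. ?u x *s x) = (\<Sum>i<length us. ?u (us ! i) *s us ! i)"
    using sum.reindex_bij_betw[OF bij, of "\<lambda>x. ?u x *s x"] by simp
  also have "\<dots> = (\<Sum>i<length us. c i *s us ! i)"
    using u by (intro sum.cong) auto
  finally have "(\<Sum>x\<in>set us. ?u x *s x) = 0" using assms(3) by simp
  from independentD[OF assms(2) finite_set subset_refl this, of "us ! i"] show ?thesis
    using u assms(4) by simp
qed

section \<open>Quotients of polynomial rings\<close>

lemma poly_carrier_iff:
  "x \<in> carrier (poly_ring n) \<longleftrightarrow> (\<forall>m\<in>Poly_Mapping.keys x. Poly_Mapping.keys m \<subseteq> {..<n})"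
  for x :: "'k::comm_ring_1 polynomial"
  by (simp add: poly_ring_def)

lemma poly_ring_simps:
  "x \<otimes>\<^bsub>poly_ring n\<^esub> y = x * y" "x \<oplus>\<^bsub>poly_ring n\<^esub> y = x + y"
  "\<zero>\<^bsub>poly_ring n\<^esub> = 0" "\<one>\<^bsub>poly_ring n\<^esub> = 1"
  for x y :: "'k::comm_ring_1 polynomial"
  by (simp_all add: poly_ring_def)

lemma carrier_poly_ring:
  "carrier (poly_ring n) = supported_on {m. Poly_Mapping.keys m \<subseteq> {..<n}}"
  by (auto simp: poly_ring_def supported_on_def)

lemma a_inv_poly_ring:
  assumes "(x :: 'k::comm_ring_1 polynomial) \<in> carrier (poly_ring n)"
  shows "\<ominus>\<^bsub>poly_ring n\<^esub> x = - x"
proof -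
  interpret cring "poly_ring n :: 'k polynomial ring" by (rule cring_poly_ring)
  show ?thesis
    by (rule minus_equality) (use assms in \<open>simp_all add: poly_ring_simps poly_carrier_iff\<close>)
qed

lemma poly_const_in_poly_ring [simp]: "poly_const c \<in> carrier (poly_ring n)"
  by (simp add: poly_carrier_iff poly_const_def split: if_splits)

lemma poly_ring_closed:
  fixes f g :: "'k::comm_ring_1 polynomial"
  shows "(0 :: 'k polynomial) \<in> carrier (poly_ring n)" "(1 :: 'k polynomial) \<in> carrier (poly_ring n)"
    "f \<in> carrier (poly_ring n) \<Longrightarrow> g \<in> carrier (poly_ring n) \<Longrightarrow> f + g \<in> carrier (poly_ring n)"
    "f \<in> carrier (poly_ring n) \<Longrightarrow> g \<in> carrier (poly_ring n) \<Longrightarrow> f * g \<in> carrier (poly_ring n)"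
    "f \<in> carrier (poly_ring n) \<Longrightarrow> - f \<in> carrier (poly_ring n)"
proof -
  interpret cring "poly_ring n :: 'k polynomial ring" by (rule cring_poly_ring)
  show "(0 :: 'k polynomial) \<in> carrier (poly_ring n)" using zero_closed by (simp only: poly_ring_simps)
  show "(1 :: 'k polynomial) \<in> carrier (poly_ring n)" using one_closed by (simp only: poly_ring_simps)
  show "f + g \<in> carrier (poly_ring n)" if "f \<in> carrier (poly_ring n)" "g \<in> carrier (poly_ring n)"
    using a_closed[OF that] by (simp only: poly_ring_simps)
  show "f * g \<in> carrier (poly_ring n)" if "f \<in> carrier (poly_ring n)" "g \<in> carrier (poly_ring n)"
    using m_closed[OF that] by (simp only: poly_ring_simps)
  show "- f \<in> carrier (poly_ring n)" if "f \<in> carrier (poly_ring n)"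
    using that by (simp add: poly_carrier_iff)
qed

lemma poly_idealD:
  fixes I :: "'k::comm_ring_1 polynomial set"
  assumes "ideal I (poly_ring n)"
  shows "I \<subseteq> carrier (poly_ring n)" "0 \<in> I"
    "f \<in> I \<Longrightarrow> g \<in> I \<Longrightarrow> f + g \<in> I" "f \<in> carrier (poly_ring n) \<Longrightarrow> g \<in> I \<Longrightarrow> f * g \<in> I"
    "f \<in> I \<Longrightarrow> g \<in> I \<Longrightarrow> f - g \<in> I"
proof -
  interpret ideal I "poly_ring n" by fact
  show sub: "I \<subseteq> carrier (poly_ring n)" using a_subset .
  note sg = additive_subgroup_axioms
  show "0 \<in> I" using additive_subgroup.zero_closed[OF sg] by (simp only: poly_ring_simps)
  show "f + g \<in> I" if "f \<in> I" "g \<in> I" for f g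
    using additive_subgroup.a_closed[OF sg that] by (simp only: poly_ring_simps)
  show "f * g \<in> I" if "f \<in> carrier (poly_ring n)" "g \<in> I" for f g
    using I_l_closed[OF that(2,1)] by (simp only: poly_ring_simps)
  assume f: "f \<in> I" and g: "g \<in> I"
  have "- g \<in> I" using additive_subgroup.a_inv_closed[OF sg g] a_inv_poly_ring[of g n] g sub by auto
  then show "f - g \<in> I" using additive_subgroup.a_closed[OF sg f, of "- g"] by (simp add: poly_ring_simps)
qed

lemma poly_idealI:
  fixes I :: "'k::comm_ring_1 polynomial set"
  assumes sub: "I \<subseteq> carrier (poly_ring n)" and 0: "0 \<in> I"
    and add: "\<And>f g. f \<in> I \<Longrightarrow> g \<in> I \<Longrightarrow> f + g \<in> I"
    and mult: "\<And>f g. f \<in> carrier (poly_ring n) \<Longrightarrow> g \<in> I \<Longrightarrow> f * g \<in> I"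
  shows "ideal I (poly_ring n)"
proof -
  interpret cring "poly_ring n :: 'k polynomial ring" by (rule cring_poly_ring)
  have neg: "- f \<in> I" if "f \<in> I" for f
    using mult[OF poly_ring_closed(5)[OF poly_ring_closed(2)] that] by simp
  show ?thesis
  proof (rule idealI[OF ring_axioms])
    show "subgroup I (add_monoid (poly_ring n))"
    proof (rule add.subgroupI)
      show "\<ominus>\<^bsub>poly_ring n\<^esub> a \<in> I" if "a \<in> I" for a
        using neg[OF that] a_inv_poly_ring[of a n] that sub by auto
    qed (use sub 0 add in \<open>auto simp: poly_ring_simps\<close>)
    show "x \<otimes>\<^bsub>poly_ring n\<^esub> a \<in> I" "a \<otimes>\<^bsub>poly_ring n\<^esub> x \<in> I"
      if "a \<in> I" "x \<in> carrier (poly_ring n)" for a x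
      using mult[OF that(2,1)] by (simp_all only: poly_ring_simps mult.commute[of a x])
  qed
qed

lemma subspace_poly_ideal:
  fixes I :: "'k::field polynomial set"
  assumes "ideal I (poly_ring n)"
  shows "poly_vs.subspace I"
proof (rule poly_vs.subspaceI)
  show "0 \<in> I" by (rule poly_idealD(2)[OF assms])
  show "x + y \<in> I" if "x \<in> I" "y \<in> I" for x y by (rule poly_idealD(3)[OF assms that])
  show "poly_const c * x \<in> I" if "x \<in> I" for c x
    by (rule poly_idealD(4)[OF assms poly_const_in_poly_ring that])
qed

locale poly_quotient =
  fixes n :: nat and I :: "'k::field polynomial set"
  assumes ideal: "ideal I (poly_ring n)" and one_notin: "1 \<notin> I"
begin

abbreviation S where "S \<equiv> carrier (poly_ring n :: 'k polynomial ring)"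
abbreviation Q where "Q \<equiv> poly_ring n Quot I"
abbreviation proj where "proj f \<equiv> I +>\<^bsub>poly_ring n\<^esub> f"
abbreviation const where "const \<equiv> quot_const n I"

sublocale I: ideal I "poly_ring n" by (rule ideal)

sublocale Q: cring Q by (rule I.quotient_is_cring[OF cring_poly_ring])

lemma proj_closed: "f \<in> S \<Longrightarrow> proj f \<in> carrier Q"
  by (rule ring_hom_memE(1)[OF I.rcos_ring_hom])

lemma proj_simps:
  assumes "f \<in> S" "g \<in> S"
  shows "proj (f + g) = proj f \<oplus>\<^bsub>Q\<^esub> proj g" "proj (f * g) = proj f \<otimes>\<^bsub>Q\<^esub> proj g"
  using ring_hom_memE(2,3)[OF I.rcos_ring_hom assms] by (simp_all only: poly_ring_simps)

lemma proj_one: "proj 1 = \<one>\<^bsub>Q\<^esub>"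
  using ring_hom_memE(4)[OF I.rcos_ring_hom] by (simp add: poly_ring_simps)

lemma carrier_Q: "carrier Q = proj ` S"
  by (auto simp: FactRing_def A_RCOSETS_defs a_r_coset_def)

lemma proj_eq_0_iff:
  assumes "f \<in> S"
  shows "proj f = \<zero>\<^bsub>Q\<^esub> \<longleftrightarrow> f \<in> I"
proof -
  have "\<zero>\<^bsub>Q\<^esub> = I" by (simp add: FactRing_def)
  then show ?thesis using I.a_rcos_const I.a_rcos_self[OF assms] by auto
qed

lemma proj_0: "proj 0 = \<zero>\<^bsub>Q\<^esub>"
  using proj_eq_0_iff[OF poly_ring_closed(1)] poly_idealD(2)[OF ideal] by simp

lemma proj_eq_iff:
  assumes "f \<in> S" "g \<in> S"
  shows "proj f = proj g \<longleftrightarrow> f - g \<in> I"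
proof -
  have "- g \<in> S" "f - g \<in> S"
    using poly_ring_closed(3)[OF assms(1) poly_ring_closed(5)[OF assms(2)]]
      poly_ring_closed(5)[OF assms(2)] by simp_all
  have "proj f = proj (f - g) \<oplus>\<^bsub>Q\<^esub> proj g"
    using proj_simps(1)[OF \<open>f - g \<in> S\<close> assms(2)] by simp
  then have "proj f = proj g \<longleftrightarrow> proj (f - g) = \<zero>\<^bsub>Q\<^esub>"
    using Q.add.r_cancel_one[OF proj_closed[OF assms(2)] proj_closed[OF \<open>f - g \<in> S\<close>]] by simp
  then show ?thesis using proj_eq_0_iff[OF \<open>f - g \<in> S\<close>] by simp
qed

lemma const_eq: "const c = proj (poly_const c)"
  by (simp add: quot_const_def)

lemma const_closed [simp]: "const c \<in> carrier Q"
  by (simp add: const_eq proj_closed)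

lemma const_simps:
  "const (a + b) = const a \<oplus>\<^bsub>Q\<^esub> const b" "const (a * b) = const a \<otimes>\<^bsub>Q\<^esub> const b"
  "const 0 = \<zero>\<^bsub>Q\<^esub>" "const 1 = \<one>\<^bsub>Q\<^esub>"
proof -
  have "poly_const (a + b) = poly_const a + poly_const b" "poly_const (a * b) = poly_const a * poly_const b"
    by (simp_all add: poly_const_def single_add mult_single)
  then show "const (a + b) = const a \<oplus>\<^bsub>Q\<^esub> const b" "const (a * b) = const a \<otimes>\<^bsub>Q\<^esub> const b"
    by (simp_all add: const_eq proj_simps)
  show "const 0 = \<zero>\<^bsub>Q\<^esub>" "const 1 = \<one>\<^bsub>Q\<^esub>"
    using proj_0 proj_one by (simp_all add: const_eq poly_const_def)
qed

lemma one_neq_zero: "\<one>\<^bsub>Q\<^esub> \<noteq> \<zero>\<^bsub>Q\<^esub>"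
  using proj_eq_0_iff[OF poly_ring_closed(2)] one_notin unfolding proj_one by simp

lemma const_eq_0_iff: "const c = \<zero>\<^bsub>Q\<^esub> \<longleftrightarrow> c = 0"
proof
  assume 0: "const c = \<zero>\<^bsub>Q\<^esub>"
  show "c = 0"
  proof (rule ccontr)
    assume "c \<noteq> 0"
    then have "const c \<otimes>\<^bsub>Q\<^esub> const (inverse c) = \<one>\<^bsub>Q\<^esub>"
      using const_simps(2)[of c "inverse c"] const_simps(4) by simp
    then show False using 0 one_neq_zero by simp
  qed
qed (simp add: const_simps)

lemma subfield_const: "subfield (range const) Q"
proof (rule Q.subfieldI)
  show "subcring (range const) Q"
  proof (rule Q.subcringI', rule Q.subringI)
    show "range const \<subseteq> carrier Q" by (rule image_subsetI) (rule const_closed)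
    show "\<one>\<^bsub>Q\<^esub> \<in> range const" unfolding const_simps(4)[symmetric] by (rule rangeI)
    fix h1 assume "h1 \<in> range const"
    then obtain c1 where c1: "h1 = const c1" by (rule rangeE)
    have "const (- c1) \<oplus>\<^bsub>Q\<^esub> const c1 = \<zero>\<^bsub>Q\<^esub>"
      using const_simps(1)[of "- c1" c1] const_simps(3) by simp
    then have "\<ominus>\<^bsub>Q\<^esub> const c1 = const (- c1)"
      by (rule Q.minus_equality) (rule const_closed)+
    then show "\<ominus>\<^bsub>Q\<^esub> h1 \<in> range const" unfolding c1 by simp
    fix h2 assume "h2 \<in> range const"
    then obtain c2 where c2: "h2 = const c2" by (rule rangeE)
    show "h1 \<otimes>\<^bsub>Q\<^esub> h2 \<in> range const" unfolding c1 c2 const_simps(2)[symmetric] by (rule rangeI)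
    show "h1 \<oplus>\<^bsub>Q\<^esub> h2 \<in> range const" unfolding c1 c2 const_simps(1)[symmetric] by (rule rangeI)
  qed
  show "Units (Q\<lparr>carrier := range const\<rparr>) = range const - {\<zero>\<^bsub>Q\<^esub>}"
  proof (rule Set.set_eqI)
    fix x
    have "x \<in> Units (Q\<lparr>carrier := range const\<rparr>) \<longleftrightarrow>
        x \<in> range const \<and> (\<exists>y\<in>range const. y \<otimes>\<^bsub>Q\<^esub> x = \<one>\<^bsub>Q\<^esub> \<and> x \<otimes>\<^bsub>Q\<^esub> y = \<one>\<^bsub>Q\<^esub>)"
      by (simp add: Units_def)
    also have "\<dots> \<longleftrightarrow> x \<in> range const \<and> x \<noteq> \<zero>\<^bsub>Q\<^esub>"
    proof (rule conj_cong[OF refl])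
      assume "x \<in> range const"
      then obtain c where c: "x = const c" by (rule rangeE)
      show "(\<exists>y\<in>range const. y \<otimes>\<^bsub>Q\<^esub> x = \<one>\<^bsub>Q\<^esub> \<and> x \<otimes>\<^bsub>Q\<^esub> y = \<one>\<^bsub>Q\<^esub>) \<longleftrightarrow> x \<noteq> \<zero>\<^bsub>Q\<^esub>"
      proof
        assume "\<exists>y\<in>range const. y \<otimes>\<^bsub>Q\<^esub> x = \<one>\<^bsub>Q\<^esub> \<and> x \<otimes>\<^bsub>Q\<^esub> y = \<one>\<^bsub>Q\<^esub>"
        then obtain y where "y \<in> range const" and y: "y \<otimes>\<^bsub>Q\<^esub> x = \<one>\<^bsub>Q\<^esub>" by (rule bexE) simp
        then have "y \<in> carrier Q" using const_closed by (elim rangeE) simp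
        then have "y \<otimes>\<^bsub>Q\<^esub> \<zero>\<^bsub>Q\<^esub> = \<zero>\<^bsub>Q\<^esub>" by (rule Q.r_null)
        then show "x \<noteq> \<zero>\<^bsub>Q\<^esub>" using y one_neq_zero by metis
      next
        assume "x \<noteq> \<zero>\<^bsub>Q\<^esub>"
        then have "inverse c * c = 1" "c * inverse c = 1" using c const_eq_0_iff by simp_all
        then have "const (inverse c) \<otimes>\<^bsub>Q\<^esub> x = \<one>\<^bsub>Q\<^esub>" "x \<otimes>\<^bsub>Q\<^esub> const (inverse c) = \<one>\<^bsub>Q\<^esub>"
          unfolding c const_simps(2)[symmetric] by (simp_all only: const_simps(4))
        then show "\<exists>y\<in>range const. y \<otimes>\<^bsub>Q\<^esub> x = \<one>\<^bsub>Q\<^esub> \<and> x \<otimes>\<^bsub>Q\<^esub> y = \<one>\<^bsub>Q\<^esub>" by blast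
      qed
    qed
    finally show "x \<in> Units (Q\<lparr>carrier := range const\<rparr>) \<longleftrightarrow> x \<in> range const - {\<zero>\<^bsub>Q\<^esub>}" by simp
  qed
qed

lemma lincomb_in_S: "set us \<subseteq> S \<Longrightarrow> (\<Sum>i<length us. poly_const (c i) * us ! i) \<in> S"
  unfolding carrier_poly_ring using subspace_supported_on
  by (intro poly_vs.subspace_sum poly_vs.subspace_scale) auto

text \<open>Linear algebra in the quotient is done with representatives: a linear combination of cosets, as
used in the definition of Jordan types and Hilbert functions, is the coset of a linear combination
of polynomials.\<close>

lemma combine_proj:
  assumes "set us \<subseteq> S"
  shows "Q.combine (map (\<lambda>i. const (c i)) [0..<length us]) (map proj us) =
    proj (\<Sum>i<length us. poly_const (c i) * us ! i)"
  using assms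
proof (induction us arbitrary: c)
  case Nil
  then show ?case by (simp add: proj_0)
next
  case (Cons u us)
  have "map (\<lambda>i. const (c i)) [0..<length (u # us)] =
      const (c 0) # map (\<lambda>i. const (c (Suc i))) [0..<length us]"
    by (simp add: upt_conv_Cons map_Suc_upt[symmetric] o_def del: upt_Suc)
  then have "Q.combine (map (\<lambda>i. const (c i)) [0..<length (u # us)]) (map proj (u # us)) =
      const (c 0) \<otimes>\<^bsub>Q\<^esub> proj u \<oplus>\<^bsub>Q\<^esub> proj (\<Sum>i<length us. poly_const (c (Suc i)) * us ! i)"
    using Cons by simp
  also have "\<dots> = proj (poly_const (c 0) * u + (\<Sum>i<length us. poly_const (c (Suc i)) * us ! i))"
    using Cons.prems lincomb_in_S[of us] by (simp add: proj_simps const_eq poly_ring_closed)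
  finally show ?case
    by (simp only: length_Cons sum.lessThan_Suc_shift nth_Cons_0 nth_Cons_Suc)
qed

lemma const_list:
  assumes "set Ks \<subseteq> range const"
  obtains c where "Ks = map (\<lambda>i. const (c i)) [0..<length Ks]"
proof -
  have "\<forall>i. \<exists>a. i < length Ks \<longrightarrow> Ks ! i = const a"
  proof
    fix i
    show "\<exists>a. i < length Ks \<longrightarrow> Ks ! i = const a"
    proof (cases "i < length Ks")
      case True
      then obtain a where "Ks ! i = const a" using subsetD[OF assms nth_mem[OF True]] by (elim rangeE)
      then show ?thesis by (intro exI impI)
    qed simp
  qed
  from choice[OF this] obtain c where "\<forall>i. i < length Ks \<longrightarrow> Ks ! i = const (c i)" by (rule exE)
  then have "Ks = map (\<lambda>i. const (c i)) [0..<length Ks]"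
    by (intro nth_equalityI) simp_all
  then show thesis by (rule that)
qed

lemma set_proj: "set us \<subseteq> S \<Longrightarrow> set (map proj us) \<subseteq> carrier Q"
  using proj_closed by auto

lemma Span_proj:
  assumes "set us \<subseteq> S"
  shows "Q.Span (range const) (map proj us) =
    {proj (\<Sum>i<length us. poly_const (c i) * us ! i) | c. True}"
proof -
  have "Q.Span (range const) (map proj us) =
      {Q.combine Ks (map proj us) | Ks. length Ks = length us \<and> set Ks \<subseteq> range const}"
    using Q.Span_eq_combine_set_length_version[OF subfield_const set_proj[OF assms]] by simp
  also have "\<dots> = {Q.combine (map (\<lambda>i. const (c i)) [0..<length us]) (map proj us) | c. True}"
  proof safe
    fix Ks :: "'k polynomial set list"
    assume len: "length Ks = length us" and Ks: "set Ks \<subseteq> range const"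
    obtain c where "Ks = map (\<lambda>i. const (c i)) [0..<length Ks]" by (rule const_list[OF Ks])
    then have "Ks = map (\<lambda>i. const (c i)) [0..<length us]" unfolding len .
    then show "\<exists>c. Q.combine Ks (map proj us) =
        Q.combine (map (\<lambda>i. const (c i)) [0..<length us]) (map proj us) \<and> True"
      by (intro exI[of _ c]) simp
  next
    fix c
    show "\<exists>Ks. Q.combine (map (\<lambda>i. const (c i)) [0..<length us]) (map proj us) =
      Q.combine Ks (map proj us) \<and> length Ks = length us \<and> set Ks \<subseteq> range const"
      by (rule exI[of _ "map (\<lambda>i. const (c i)) [0..<length us]"]) auto
  qed
  also have "\<dots> = {proj (\<Sum>i<length us. poly_const (c i) * us ! i) | c. True}"
    using combine_proj[OF assms] by simp
  finally show ?thesis .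
qed

lemma independent_proj_iff:
  assumes "set us \<subseteq> S"
  shows "Q.independent (range const) (map proj us) \<longleftrightarrow>
    (\<forall>c. (\<Sum>i<length us. poly_const (c i) * us ! i) \<in> I \<longrightarrow> (\<forall>i<length us. c i = 0))"
proof
  assume ind: "Q.independent (range const) (map proj us)"
  show "\<forall>c. (\<Sum>i<length us. poly_const (c i) * us ! i) \<in> I \<longrightarrow> (\<forall>i<length us. c i = 0)"
  proof (intro allI impI)
    fix c i assume "(\<Sum>i<length us. poly_const (c i) * us ! i) \<in> I" and i: "i < length us"
    then have "Q.combine (map (\<lambda>i. const (c i)) [0..<length us]) (map proj us) = \<zero>\<^bsub>Q\<^esub>"
      using combine_proj[OF assms] proj_eq_0_iff lincomb_in_S[OF assms] by simp
    then have "set (take (length (map proj us)) (map (\<lambda>i. const (c i)) [0..<length us])) \<subseteq> {\<zero>\<^bsub>Q\<^esub>}"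
      by (intro Q.independent_imp_trivial_combine[OF subfield_const ind]) auto
    moreover have "const (c i) \<in> set (take (length (map proj us)) (map (\<lambda>i. const (c i)) [0..<length us]))"
      using i by simp
    ultimately have "const (c i) \<in> {\<zero>\<^bsub>Q\<^esub>}" by (rule subsetD)
    then have "const (c i) = \<zero>\<^bsub>Q\<^esub>" by (rule singletonD)
    then show "c i = 0" using const_eq_0_iff by simp
  qed
next
  assume triv: "\<forall>c. (\<Sum>i<length us. poly_const (c i) * us ! i) \<in> I \<longrightarrow> (\<forall>i<length us. c i = 0)"
  show "Q.independent (range const) (map proj us)"
  proof (rule ccontr)
    assume dep: "\<not> Q.independent (range const) (map proj us)"
    then obtain Ks where Ks': "length Ks = length (map proj us)" "Q.combine Ks (map proj us) = \<zero>\<^bsub>Q\<^esub>"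
      "set Ks \<subseteq> range const" "set Ks \<noteq> {\<zero>\<^bsub>Q\<^esub>}"
      by (rule Q.dependent_imp_non_trivial_combine[OF subfield_const set_proj[OF assms]])
    note Ks = Ks'(1)[unfolded length_map] Ks'(2-4)
    obtain c where "Ks = map (\<lambda>i. const (c i)) [0..<length Ks]" by (rule const_list[OF Ks(3)])
    then have c: "Ks = map (\<lambda>i. const (c i)) [0..<length us]" unfolding Ks(1) .
    have "(\<Sum>i<length us. poly_const (c i) * us ! i) \<in> I"
      using Ks(2) combine_proj[OF assms] proj_eq_0_iff lincomb_in_S[OF assms] c by simp
    then have "set Ks \<subseteq> {\<zero>\<^bsub>Q\<^esub>}" using triv c const_simps(3) by auto
    then have "us = []" using Ks(1,4) by (cases Ks) auto
    then show False using dep by simp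
  qed
qed

text \<open>The image of \<open>W\<close> is the quotient of \<open>W\<close> by
\<open>I \<inter> W\<close>, and the cosets of a basis of a complement of
\<open>I \<inter> W\<close> in \<open>W\<close> form a basis of it.\<close>

lemma dim_proj_image:
  assumes W: "poly_vs.subspace W" "poly_vs.finite_dim W" "W \<subseteq> S"
  shows "Q.dim (range const) (proj ` W) + poly_vs.dim (I \<inter> W) = poly_vs.dim W"
proof -
  have IW: "poly_vs.subspace (I \<inter> W)"
    using poly_vs.subspace_inter[OF subspace_poly_ideal[OF ideal] W(1)] .
  obtain C where C: "finite C" "poly_vs.independent C" "C \<subseteq> W" "I \<inter> W \<inter> poly_vs.span C = {0}"
    "W = {u + c | u c. u \<in> I \<inter> W \<and> c \<in> poly_vs.span C}"
    "poly_vs.dim W = poly_vs.dim (I \<inter> W) + card C"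
    by (rule poly_vs.subspace_complement[OF IW W(1) Int_lower2 W(2)])
  obtain us where us: "set us = C" "distinct us" using finite_distinct_list[OF C(1)] by blast
  have spC: "poly_vs.span C \<subseteq> W" using poly_vs.span_minimal[OF C(3) W(1)] .
  have usS: "set us \<subseteq> S" using us C(3) W(3) by simp
  note span = poly_vs.span_set_nth[OF us(2), unfolded us(1)]
  have "Q.independent (range const) (map proj us)"
    unfolding independent_proj_iff[OF usS]
  proof (intro allI impI)
    fix c i assume I: "(\<Sum>i<length us. poly_const (c i) * us ! i) \<in> I" and i: "i < length us"
    have "(\<Sum>i<length us. poly_const (c i) * us ! i) \<in> poly_vs.span C" using span by blast
    then have "(\<Sum>i<length us. poly_const (c i) * us ! i) = 0" using I C(4) spC by blast
    then show "c i = 0" by (rule poly_vs.independent_set_nth[OF us(2) C(2)[folded us(1)] _ i])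
  qed
  from Q.dimensionI[OF subfield_const this] have dimI:
    "Q.dimension (card C) (range const) E" if "Q.Span (range const) (map proj us) = E" for E
    using that us(1) distinct_card[OF us(2)] by simp
  have "Q.Span (range const) (map proj us) = proj ` W"
  proof -
    have "Q.Span (range const) (map proj us) = proj ` poly_vs.span C"
      unfolding Span_proj[OF usS] span by auto
    also have "\<dots> = proj ` W"
    proof
      show "proj ` W \<subseteq> proj ` poly_vs.span C"
      proof
        fix y assume "y \<in> proj ` W"
        then obtain f where f: "f \<in> W" "y = proj f" by blast
        from f(1) C(5) obtain u c where "f = u + c" "u \<in> I" "c \<in> poly_vs.span C" by blast
        then have y: "y = proj (u + c)" "u \<in> I" "c \<in> poly_vs.span C" using f by auto
        have "c \<in> S" "u \<in> S" using y spC W(3) poly_idealD(1)[OF ideal] by auto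
        then have "y = proj c" using y proj_eq_iff[of "u + c" c] by (simp add: poly_ring_closed)
        then show "y \<in> proj ` poly_vs.span C" using y by simp
      qed
    qed (use spC in blast)
    finally show ?thesis .
  qed
  from Q.dimI[OF subfield_const dimI[OF this]]
  have "Q.dim (range const) (proj ` W) = card C"
    unfolding over_def .
  then show ?thesis using C(6) by simp
qed

end

section \<open>Hilbert functions of complete intersections\<close>

definition mdeg :: "(nat \<Rightarrow>\<^sub>0 nat) \<Rightarrow> nat" where
  "mdeg m = (\<Sum>i\<in>Poly_Mapping.keys m. Poly_Mapping.lookup m i)"

lemma mdeg_superset:
  assumes "finite X" "Poly_Mapping.keys m \<subseteq> X"
  shows "mdeg m = (\<Sum>i\<in>X. Poly_Mapping.lookup m i)"
  unfolding mdeg_def using assms by (intro sum.mono_neutral_left) (auto simp: in_keys_iff)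

lemma mdeg_add: "mdeg (a + b) = mdeg a + mdeg b"
proof -
  let ?X = "Poly_Mapping.keys a \<union> Poly_Mapping.keys b"
  have "mdeg (a + b) = (\<Sum>i\<in>?X. Poly_Mapping.lookup (a + b) i)"
    by (rule mdeg_superset) (simp_all add: Poly_Mapping.keys_add)
  then show ?thesis
    using mdeg_superset[of ?X a] mdeg_superset[of ?X b] by (simp add: lookup_add sum.distrib)
qed

definition monomials :: "nat \<Rightarrow> nat \<Rightarrow> (nat \<Rightarrow>\<^sub>0 nat) set" where
  "monomials n d = {m. Poly_Mapping.keys m \<subseteq> {..<n} \<and> mdeg m = d}"

lemma finite_bounded_monomials:
  "finite {m :: nat \<Rightarrow>\<^sub>0 nat. Poly_Mapping.keys m \<subseteq> {..<n} \<and> (\<forall>i<n. Poly_Mapping.lookup m i \<le> b)}"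
    (is "finite ?M")
proof (rule finite_imageD)
  let ?r = "\<lambda>m. restrict (Poly_Mapping.lookup m) {..<n}"
  show "finite (?r ` ?M)"
  proof (rule finite_subset)
    show "?r ` ?M \<subseteq> ({..<n} \<rightarrow>\<^sub>E {..b})" by (intro image_subsetI PiE_I) auto
  qed (simp add: finite_PiE)
  show "inj_on ?r ?M"
  proof (rule inj_onI, rule poly_mapping_eqI)
    fix x y i assume x: "x \<in> ?M" and y: "y \<in> ?M" and eq: "?r x = ?r y"
    show "Poly_Mapping.lookup x i = Poly_Mapping.lookup y i"
    proof (cases "i < n")
      case True
      then show ?thesis using fun_cong[OF eq, of i] by simp
    next
      case False
      then have "i \<notin> Poly_Mapping.keys x" "i \<notin> Poly_Mapping.keys y" using x y by auto
      then show ?thesis by (simp add: in_keys_iff)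
    qed
  qed
qed

lemma finite_monomials: "finite (monomials n d)"
proof (rule finite_subset[OF _ finite_bounded_monomials])
  show "monomials n d \<subseteq>
    {m. Poly_Mapping.keys m \<subseteq> {..<n} \<and> (\<forall>i<n. Poly_Mapping.lookup m i \<le> d)}"
  proof safe
    fix m i assume m: "m \<in> monomials n d" and i: "i < n"
    have "mdeg m = (\<Sum>i<n. Poly_Mapping.lookup m i)"
      by (rule mdeg_superset) (use m in \<open>auto simp: monomials_def\<close>)
    then show "Poly_Mapping.lookup m i \<le> d"
      using m member_le_sum[of i "{..<n}" "Poly_Mapping.lookup m"] i by (simp add: monomials_def)
  qed (auto simp: monomials_def)
qed

lemma homogeneous_iff: "homogeneous d f \<longleftrightarrow> (\<forall>m\<in>Poly_Mapping.keys f. mdeg m = d)"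
  by (simp add: homogeneous_def mdeg_def)

lemma homogeneous_polynomials_eq:
  "{f \<in> carrier (poly_ring n). homogeneous d f} = supported_on (monomials n d)"
  by (auto simp: poly_carrier_iff homogeneous_iff supported_on_def monomials_def)

definition homogeneous_component :: "nat \<Rightarrow> 'k::comm_ring_1 polynomial \<Rightarrow> 'k polynomial" where
  "homogeneous_component d f = Poly_Mapping.mapp (\<lambda>m c. if mdeg m = d then c else 0) f"

lemma lookup_homogeneous_component:
  "Poly_Mapping.lookup (homogeneous_component d f) m = (if mdeg m = d then Poly_Mapping.lookup f m else 0)"
  by (simp add: homogeneous_component_def lookup_mapp when_def in_keys_iff)

lemma homogeneous_component_add: "homogeneous_component d (f + g) = homogeneous_component d f + homogeneous_component d g"
  by (rule poly_mapping_eqI) (simp add: lookup_homogeneous_component lookup_add)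

lemma homogeneous_component_0: "homogeneous_component d 0 = 0"
  by (rule poly_mapping_eqI) (simp add: lookup_homogeneous_component)

lemma homogeneous_component_sum: "homogeneous_component d (\<Sum>x\<in>A. f x) = (\<Sum>x\<in>A. homogeneous_component d (f x))"
  by (induction A rule: infinite_finite_induct) (simp_all add: homogeneous_component_0 homogeneous_component_add)

lemma homogeneous_component_of_homogeneous: "homogeneous d f \<Longrightarrow> homogeneous_component d f = f"
  by (rule poly_mapping_eqI) (auto simp: lookup_homogeneous_component homogeneous_iff in_keys_iff)

lemma homogeneous_component_in_monomials: "f \<in> carrier (poly_ring n) \<Longrightarrow> homogeneous_component d f \<in> supported_on (monomials n d)"
  by (auto simp: supported_on_def monomials_def poly_carrier_iff in_keys_iff lookup_homogeneous_component split: if_splits)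

lemma supported_on_monomials_carrier: "supported_on (monomials n d) \<subseteq> carrier (poly_ring n)"
  by (force simp: supported_on_def monomials_def poly_carrier_iff)

lemma homogeneous_component_single_mult:
  fixes h :: "'k::comm_ring_1 polynomial"
  shows "homogeneous_component d (Poly_Mapping.single a c * h) =
    (if mdeg a \<le> d then Poly_Mapping.single a c * homogeneous_component (d - mdeg a) h else 0)"
proof (rule poly_mapping_eqI)
  fix m
  show "Poly_Mapping.lookup (homogeneous_component d (Poly_Mapping.single a c * h)) m =
    Poly_Mapping.lookup (if mdeg a \<le> d then Poly_Mapping.single a c * homogeneous_component (d - mdeg a) h else 0) m"
  proof (cases "\<exists>b. m = a + b")
    case True
    then obtain b where "m = a + b" by blast
    then show ?thesis by (auto simp: lookup_homogeneous_component lookup_single_mult mdeg_add)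
  next
    case False
    then show ?thesis by (simp add: lookup_homogeneous_component lookup_single_mult_eq_0)
  qed
qed

lemma homogeneous_component_mult:
  fixes f h :: "'k::comm_ring_1 polynomial"
  assumes "homogeneous e f"
  shows "homogeneous_component d (f * h) = (if e \<le> d then f * homogeneous_component (d - e) h else 0)"
proof -
  let ?t = "\<lambda>a. Poly_Mapping.single a (Poly_Mapping.lookup f a)"
  have f: "(\<Sum>a\<in>Poly_Mapping.keys f. ?t a) = f" by (rule sum_single_lookup)
  have "homogeneous_component d (f * h) = homogeneous_component d (\<Sum>a\<in>Poly_Mapping.keys f. ?t a * h)"
    by (subst (1) f[symmetric]) (simp only: sum_distrib_right)
  also have "\<dots> = (\<Sum>a\<in>Poly_Mapping.keys f. if e \<le> d then ?t a * homogeneous_component (d - e) h else 0)"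
    unfolding homogeneous_component_sum
  proof (rule sum.cong[OF refl])
    fix a assume "a \<in> Poly_Mapping.keys f"
    then have "mdeg a = e" using assms by (simp add: homogeneous_iff)
    then show "homogeneous_component d (?t a * h) = (if e \<le> d then ?t a * homogeneous_component (d - e) h else 0)"
      by (simp add: homogeneous_component_single_mult)
  qed
  also have "\<dots> = (if e \<le> d then f * homogeneous_component (d - e) h else 0)"
  proof (cases "e \<le> d")
    case True
    have "(\<Sum>a\<in>Poly_Mapping.keys f. ?t a * homogeneous_component (d - e) h) = f * homogeneous_component (d - e) h"
      unfolding sum_distrib_right[symmetric] f ..
    then show ?thesis using True by simp
  qed simp
  finally show ?thesis .
qed

lemma homogeneous_mult:
  fixes f h :: "'k::comm_ring_1 polynomial"
  assumes "homogeneous e f" "homogeneous d h"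
  shows "homogeneous (e + d) (f * h)"
proof -
  have "mdeg m = e + d" if "m \<in> Poly_Mapping.keys (f * h)" for m
    using that Poly_Mapping.keys_mult[of f h] assms by (auto simp: homogeneous_iff mdeg_add)
  then show ?thesis by (simp add: homogeneous_iff)
qed

interpretation poly_pair: vector_space_pair "\<lambda>c (f :: 'k::field polynomial). poly_const c * f"
  "\<lambda>c (f :: 'k polynomial). poly_const c * f" ..

lemma linear_poly_mult: "Vector_Spaces.linear (\<lambda>c (f :: 'k::field polynomial). poly_const c * f)
    (\<lambda>c (f :: 'k polynomial). poly_const c * f) ((*) g)"
  unfolding Vector_Spaces.linear_iff
  by (simp add: poly_vs.vector_space_axioms distrib_left mult.left_commute)

text \<open>The dimension of the degree \<open>d\<close> part of the ideal itself; its codimension among all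
forms of degree \<open>d\<close> is the Hilbert function of the quotient.\<close>

definition graded_dim :: "nat \<Rightarrow> 'k::field polynomial set \<Rightarrow> nat \<Rightarrow> nat" where
  "graded_dim n I d = poly_vs.dim (I \<inter> supported_on (monomials n d))"

lemma (in poly_quotient) hilbert_function_eq:
  "hilbert_function n I d = card (monomials n d) - graded_dim n I d"
proof -
  have "quot_degree_component n I d = (\<lambda>f. proj f) ` supported_on (monomials n d)"
    unfolding quot_degree_component_def homogeneous_polynomials_eq[symmetric] by auto
  then have "hilbert_function n I d = Q.dim (range const) (proj ` supported_on (monomials n d))"
    unfolding hilbert_function_def by simp
  then show ?thesis
    using dim_proj_image[OF subspace_supported_on finite_dim_supported_on[OF finite_monomials]
        supported_on_monomials_carrier, of d] dim_supported_on[OF finite_monomials, where 'k = 'k]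
    unfolding graded_dim_def by simp
qed

lemma Idl_insert:
  fixes A :: "'k::comm_ring_1 polynomial set"
  assumes A: "A \<subseteq> carrier (poly_ring n)" and f: "f \<in> carrier (poly_ring n)"
  shows "Idl\<^bsub>poly_ring n\<^esub> (insert f A) =
    {u + f * h | u h. u \<in> Idl\<^bsub>poly_ring n\<^esub> A \<and> h \<in> carrier (poly_ring n)}" (is "_ = ?J")
proof -
  interpret cring "poly_ring n :: 'k polynomial ring" by (rule cring_poly_ring)
  have I: "ideal (Idl\<^bsub>poly_ring n\<^esub> A) (poly_ring n)" using genideal_ideal[OF A] .
  have fA: "insert f A \<subseteq> carrier (poly_ring n)" using A f by simp
  have I': "ideal (Idl\<^bsub>poly_ring n\<^esub> (insert f A)) (poly_ring n)"
    using genideal_ideal[OF fA] .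
  have J: "u + f * h \<in> ?J" if "u \<in> Idl\<^bsub>poly_ring n\<^esub> A" "h \<in> carrier (poly_ring n)" for u h
    using that by auto
  have "ideal ?J (poly_ring n)"
  proof (rule poly_idealI)
    show "?J \<subseteq> carrier (poly_ring n)"
      using poly_idealD(1)[OF I] f poly_ring_closed(3,4) by (auto intro!: poly_ring_closed(3,4))
    show "0 \<in> ?J" using J[OF poly_idealD(2)[OF I] poly_ring_closed(1)] by simp
    show "a + b \<in> ?J" if ab: "a \<in> ?J" "b \<in> ?J" for a b
    proof -
      obtain u h where a: "a = u + f * h" "u \<in> Idl\<^bsub>poly_ring n\<^esub> A" "h \<in> carrier (poly_ring n)"
        using ab(1) by auto
      obtain v k where b: "b = v + f * k" "v \<in> Idl\<^bsub>poly_ring n\<^esub> A" "k \<in> carrier (poly_ring n)"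
        using ab(2) by auto
      have "a + b = (u + v) + f * (h + k)" unfolding a(1) b(1) by (simp add: algebra_simps)
      then show ?thesis using J[OF poly_idealD(3)[OF I a(2) b(2)] poly_ring_closed(3)[OF a(3) b(3)]] by simp
    qed
    show "g * a \<in> ?J" if g: "g \<in> carrier (poly_ring n)" and a': "a \<in> ?J" for g a
    proof -
      obtain u h where a: "a = u + f * h" "u \<in> Idl\<^bsub>poly_ring n\<^esub> A" "h \<in> carrier (poly_ring n)"
        using a' by auto
      have "g * a = g * u + f * (g * h)" unfolding a(1) by (simp add: algebra_simps)
      then show ?thesis using J[OF poly_idealD(4)[OF I g a(2)] poly_ring_closed(4)[OF g a(3)]] by simp
    qed
  qed
  moreover have "insert f A \<subseteq> ?J"
  proof -
    have "f \<in> ?J" using J[OF poly_idealD(2)[OF I] poly_ring_closed(2)] by simp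
    moreover have "a \<in> ?J" if "a \<in> A" for a
      using J[of a 0] poly_ring_closed(1) genideal_self[OF A] that by auto
    ultimately show ?thesis by blast
  qed
  ultimately have "Idl\<^bsub>poly_ring n\<^esub> (insert f A) \<subseteq> ?J" by (rule genideal_minimal)
  moreover have "?J \<subseteq> Idl\<^bsub>poly_ring n\<^esub> (insert f A)"
  proof
    fix x assume "x \<in> ?J"
    then obtain u h where x: "x = u + f * h" "u \<in> Idl\<^bsub>poly_ring n\<^esub> A" "h \<in> carrier (poly_ring n)"
      by auto
    have "A \<subseteq> Idl\<^bsub>poly_ring n\<^esub> (insert f A)" "f \<in> Idl\<^bsub>poly_ring n\<^esub> (insert f A)"
      using genideal_self[OF fA] by auto
    then have "u \<in> Idl\<^bsub>poly_ring n\<^esub> (insert f A)" "f * h \<in> Idl\<^bsub>poly_ring n\<^esub> (insert f A)"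
      using genideal_minimal[OF I'] x(2) poly_idealD(4)[OF I' x(3)] by (auto simp: mult.commute)
    then show "x \<in> Idl\<^bsub>poly_ring n\<^esub> (insert f A)" unfolding x(1) by (rule poly_idealD(3)[OF I'])
  qed
  ultimately show ?thesis by (rule subset_antisym)
qed

lemma Idl_empty: "Idl\<^bsub>poly_ring n\<^esub> {} = {0 :: 'k::comm_ring_1 polynomial}"
proof -
  interpret cring "poly_ring n :: 'k polynomial ring" by (rule cring_poly_ring)
  have "ideal {0 :: 'k polynomial} (poly_ring n)"
    by (rule poly_idealI) (simp_all add: poly_ring_closed)
  then have "Idl\<^bsub>poly_ring n\<^esub> {} \<subseteq> {0 :: 'k polynomial}" by (rule genideal_minimal) simp
  moreover have "0 \<in> Idl\<^bsub>poly_ring n\<^esub> ({} :: 'k polynomial set)"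
    using poly_idealD(2)[OF genideal_ideal] by blast
  ultimately show ?thesis by blast
qed

text \<open>Multiplication by \<open>f\<close> maps polynomials of degree \<open>d - e\<close> to
polynomials of degree \<open>d\<close>. By regularity it induces an isomorphism from the degree
\<open>d - e\<close> part of the quotient by \<open>I\<close> onto the degree \<open>d\<close>
part of \<open>J / I\<close>; homogeneity of \<open>I\<close> is what makes it onto.\<close>

lemma graded_dim_regular:
  fixes I :: "'k::field polynomial set"
  assumes I: "ideal I (poly_ring n)" and graded: "\<And>g d. g \<in> I \<Longrightarrow> homogeneous_component d g \<in> I"
    and f: "f \<in> carrier (poly_ring n)" "homogeneous e f"
    and regular: "\<And>h. h \<in> carrier (poly_ring n) \<Longrightarrow> f * h \<in> I \<Longrightarrow> h \<in> I"
  defines "J \<equiv> {u + f * h | u h. u \<in> I \<and> h \<in> carrier (poly_ring n)}"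
  shows "graded_dim n J d =
    graded_dim n I d + (if e \<le> d then card (monomials n (d - e)) - graded_dim n I (d - e) else 0)"
proof -
  let ?S = "\<lambda>d. supported_on (monomials n d) :: 'k polynomial set"
  have decomp: "\<exists>u\<in>I \<inter> ?S d. x = u + (if e \<le> d then f * homogeneous_component (d - e) h else 0)"
    if "x \<in> ?S d" "x = u + f * h" "u \<in> I" "h \<in> carrier (poly_ring n)" for x u h
  proof -
    have "homogeneous d x" using that(1) homogeneous_polynomials_eq[of n d, where 'a = 'k] by auto
    then have "x = homogeneous_component d u + (if e \<le> d then f * homogeneous_component (d - e) h else 0)"
      using homogeneous_component_of_homogeneous[of d x] homogeneous_component_mult[OF f(2), of d h] homogeneous_component_add[of d u "f * h"] that(2)
      by simp
    moreover have "homogeneous_component d u \<in> ?S d"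
      using homogeneous_component_in_monomials[of u n d] that(3) poly_idealD(1)[OF I] by blast
    ultimately show ?thesis using graded[OF that(3), of d] by blast
  qed
  have IJ: "I \<subseteq> J"
  proof
    fix u assume "u \<in> I"
    moreover have "u = u + f * 0" by simp
    ultimately show "u \<in> J" unfolding J_def using poly_ring_closed(1) by blast
  qed
  show ?thesis
  proof (cases "e \<le> d")
    case False
    have "J \<inter> ?S d \<subseteq> I \<inter> ?S d"
    proof
      fix x assume "x \<in> J \<inter> ?S d"
      then obtain u h where "x = u + f * h" "u \<in> I" "h \<in> carrier (poly_ring n)" "x \<in> ?S d"
        unfolding J_def by auto
      then show "x \<in> I \<inter> ?S d" using decomp[of x u h] False by auto
    qed
    then have "J \<inter> ?S d = I \<inter> ?S d" using IJ by blast
    then show ?thesis using False by (simp add: graded_dim_def)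
  next
    case True
    let ?W = "?S (d - e)"
    have fS: "f * w \<in> ?S d" if "w \<in> ?W" for w
    proof -
      have w: "w \<in> carrier (poly_ring n)" "homogeneous (d - e) w"
        using that homogeneous_polynomials_eq[of n "d - e", where 'a = 'k] by auto
      have "f * w \<in> carrier (poly_ring n)" using poly_ring_closed(4)[OF f(1) w(1)] .
      moreover have "homogeneous d (f * w)" using homogeneous_mult[OF f(2) w(2)] True by simp
      ultimately show ?thesis using homogeneous_polynomials_eq[of n d, where 'a = 'k] by auto
    qed
    have "poly_vs.dim (J \<inter> ?S d) + poly_vs.dim (I \<inter> ?W) = poly_vs.dim ?W + poly_vs.dim (I \<inter> ?S d)"
    proof (rule poly_pair.dim_quotient_iso[OF linear_poly_mult])
      show "poly_vs.subspace (I \<inter> ?W)" "poly_vs.subspace (I \<inter> ?S d)" "poly_vs.subspace ?W"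
        by (intro poly_vs.subspace_inter subspace_poly_ideal[OF I] subspace_supported_on)+
      show "I \<inter> ?W \<subseteq> ?W" by blast
      show "poly_vs.finite_dim ?W" by (rule finite_dim_supported_on[OF finite_monomials])
      show "poly_vs.finite_dim (J \<inter> ?S d)"
        by (rule poly_vs.finite_dim_subset[OF finite_dim_supported_on[OF finite_monomials] Int_lower2])
      show "f * w \<in> I \<inter> ?S d \<longleftrightarrow> w \<in> I \<inter> ?W" if w: "w \<in> ?W" for w
      proof -
        have "w \<in> carrier (poly_ring n)" using w supported_on_monomials_carrier by blast
        then have "f * w \<in> I \<longleftrightarrow> w \<in> I" using regular poly_idealD(4)[OF I f(1)] by blast
        then show ?thesis using fS[OF w] w by blast
      qed
      show "J \<inter> ?S d = {u + f * w | u w. u \<in> I \<inter> ?S d \<and> w \<in> ?W}"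
      proof
        show "J \<inter> ?S d \<subseteq> {u + f * w | u w. u \<in> I \<inter> ?S d \<and> w \<in> ?W}"
        proof
          fix x assume "x \<in> J \<inter> ?S d"
          then obtain u h where x: "x = u + f * h" "u \<in> I" "h \<in> carrier (poly_ring n)" "x \<in> ?S d"
            unfolding J_def by auto
          from decomp[OF x(4,1,2,3)] obtain v where "v \<in> I \<inter> ?S d" "x = v + f * homogeneous_component (d - e) h"
            using True by auto
          then show "x \<in> {u + f * w | u w. u \<in> I \<inter> ?S d \<and> w \<in> ?W}"
            using homogeneous_component_in_monomials[OF x(3), of "d - e"] by blast
        qed
        show "{u + f * w | u w. u \<in> I \<inter> ?S d \<and> w \<in> ?W} \<subseteq> J \<inter> ?S d"
        proof
          fix x assume "x \<in> {u + f * w | u w. u \<in> I \<inter> ?S d \<and> w \<in> ?W}"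
          then obtain u w where x: "x = u + f * w" "u \<in> I" "u \<in> ?S d" "w \<in> ?W" by auto
          have "x \<in> ?S d" unfolding x(1)
            using poly_vs.subspace_add[OF subspace_supported_on x(3) fS[OF x(4)]] .
          moreover have "x \<in> J" unfolding J_def x(1)
            using x(2,4) supported_on_monomials_carrier by blast
          ultimately show "x \<in> J \<inter> ?S d" by blast
        qed
      qed
    qed
    moreover have "poly_vs.dim ?W = card (monomials n (d - e))"
      by (rule dim_supported_on[OF finite_monomials])
    moreover have "poly_vs.dim (I \<inter> ?W) \<le> poly_vs.dim ?W"
      by (rule poly_vs.dim_mono_finite_dim[OF poly_vs.subspace_inter[OF subspace_poly_ideal[OF I]
            subspace_supported_on] subspace_supported_on Int_lower2
            finite_dim_supported_on[OF finite_monomials]])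
    ultimately show ?thesis using True by (simp add: graded_dim_def)
  qed
qed

lemma one_notin_proper_Idl:
  fixes A :: "'k::field polynomial set"
  assumes A: "A \<subseteq> carrier (poly_ring n)" and proper: "Idl\<^bsub>poly_ring n\<^esub> A \<noteq> carrier (poly_ring n)"
  shows "1 \<notin> Idl\<^bsub>poly_ring n\<^esub> A"
proof
  interpret cring "poly_ring n :: 'k polynomial ring" by (rule cring_poly_ring)
  assume "1 \<in> Idl\<^bsub>poly_ring n\<^esub> A"
  then have "\<one>\<^bsub>poly_ring n\<^esub> \<in> Idl\<^bsub>poly_ring n\<^esub> A" by (simp only: poly_ring_simps)
  then show False using proper ideal.one_imp_carrier[OF genideal_ideal[OF A]] by blast
qed

lemma complete_intersection_nth:
  fixes fs :: "'k::field polynomial list"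
  assumes CI: "complete_intersection ds fs" and i: "i < length ds"
  defines "I \<equiv> Idl\<^bsub>poly_ring (length ds)\<^esub> (set (take i fs))"
  shows "poly_quotient (length ds) I" "fs ! i \<in> carrier (poly_ring (length ds))"
    "homogeneous (ds ! i) (fs ! i)"
    "\<And>h. h \<in> carrier (poly_ring (length ds)) \<Longrightarrow> fs ! i * h \<in> I \<Longrightarrow> h \<in> I"
proof -
  let ?R = "poly_ring (length ds) :: 'k polynomial ring"
  interpret cring ?R by (rule cring_poly_ring)
  have len: "length fs = length ds" and sub: "set fs \<subseteq> carrier ?R"
    and proper: "Idl\<^bsub>?R\<^esub> (set fs) \<noteq> carrier ?R"
    and reg: "\<forall>a\<in>carrier (?R Quot I).
          (I +>\<^bsub>?R\<^esub> (fs ! i)) \<otimes>\<^bsub>?R Quot I\<^esub> a = \<zero>\<^bsub>?R Quot I\<^esub> \<longrightarrow> a = \<zero>\<^bsub>?R Quot I\<^esub>"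
    using CI i unfolding complete_intersection_def regular_sequence_def Let_def I_def by auto
  show fi: "fs ! i \<in> carrier ?R" using sub i len by auto
  show "homogeneous (ds ! i) (fs ! i)" using CI i by (simp add: complete_intersection_def)
  have takeS: "set (take i fs) \<subseteq> carrier ?R" using sub set_take_subset by fast
  have I: "ideal I ?R" unfolding I_def by (rule genideal_ideal[OF takeS])
  have "I \<subseteq> Idl\<^bsub>?R\<^esub> (set fs)"
    unfolding I_def by (rule subset_Idl_subset[OF sub set_take_subset])
  moreover have "1 \<notin> Idl\<^bsub>?R\<^esub> (set fs)" by (rule one_notin_proper_Idl[OF sub proper])
  ultimately show pq: "poly_quotient (length ds) I" using I by (intro poly_quotient.intro) auto
  interpret poly_quotient "length ds" I by (rule pq)
  show "h \<in> I" if h: "h \<in> carrier ?R" "fs ! i * h \<in> I" for h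
  proof -
    have "proj (fs ! i) \<otimes>\<^bsub>Q\<^esub> proj h = \<zero>\<^bsub>Q\<^esub>"
      using proj_simps(2)[OF fi h(1)] proj_eq_0_iff[OF poly_ring_closed(4)[OF fi h(1)]] h(2) by simp
    then have "proj h = \<zero>\<^bsub>Q\<^esub>" using reg proj_closed[OF h(1)] by blast
    then show "h \<in> I" using proj_eq_0_iff[OF h(1)] by simp
  qed
qed

lemma Idl_take_Suc:
  fixes fs :: "'k::field polynomial list"
  assumes CI: "complete_intersection ds fs" and i: "i < length ds"
  shows "Idl\<^bsub>poly_ring (length ds)\<^esub> (set (take (Suc i) fs)) =
    {u + fs ! i * h | u h. u \<in> Idl\<^bsub>poly_ring (length ds)\<^esub> (set (take i fs)) \<and>
       h \<in> carrier (poly_ring (length ds))}"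
proof -
  have "length fs = length ds" "set fs \<subseteq> carrier (poly_ring (length ds))"
    using CI unfolding complete_intersection_def regular_sequence_def by auto
  then have "set (take (Suc i) fs) = insert (fs ! i) (set (take i fs))"
    "set (take i fs) \<subseteq> carrier (poly_ring (length ds))"
    using i set_take_subset[of i fs] by (auto simp: take_Suc_conv_app_nth)
  then show ?thesis using Idl_insert[OF _ complete_intersection_nth(2)[OF CI i]] by simp
qed

text \<open>Homogeneity of an ideal is preserved when a homogeneous form is added, because the components of a
multiple of the form are the multiples of the form by the components of the cofactor.\<close>

lemma homogeneous_component_complete_intersection:
  fixes fs :: "'k::field polynomial list"
  assumes CI: "complete_intersection ds fs" and "i \<le> length ds"
    and "g \<in> Idl\<^bsub>poly_ring (length ds)\<^esub> (set (take i fs))"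
  shows "homogeneous_component d g \<in> Idl\<^bsub>poly_ring (length ds)\<^esub> (set (take i fs))"
  using assms(2,3)
proof (induction i arbitrary: g d)
  case 0
  then show ?case by (simp add: Idl_empty homogeneous_component_0)
next
  case (Suc i)
  let ?R = "poly_ring (length ds) :: 'k polynomial ring"
  let ?I = "Idl\<^bsub>?R\<^esub> (set (take i fs))"
  have i: "i < length ds" using Suc.prems by simp
  note CI_i = complete_intersection_nth[OF CI i]
  obtain u h where g: "g = u + fs ! i * h" "u \<in> ?I" "h \<in> carrier ?R"
    using Suc.prems(2) unfolding Idl_take_Suc[OF CI i] by auto
  have u: "homogeneous_component d u \<in> ?I" using Suc.IH[OF _ g(2)] i by simp
  have h: "homogeneous_component (d - ds ! i) h \<in> carrier ?R"
    using homogeneous_component_in_monomials[OF g(3)] supported_on_monomials_carrier by blast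
  have "homogeneous_component d g = homogeneous_component d u + fs ! i * (if ds ! i \<le> d then homogeneous_component (d - ds ! i) h else 0)"
    using homogeneous_component_mult[OF CI_i(3), of d h] unfolding g(1) homogeneous_component_add by simp
  moreover have "(if ds ! i \<le> d then homogeneous_component (d - ds ! i) h else 0) \<in> carrier ?R"
    using h by (simp add: poly_ring_closed(1))
  ultimately show ?case unfolding Idl_take_Suc[OF CI i] using u by blast
qed

text \<open>Both sequences start with the zero ideal and satisfy the recursion
\<open>graded_dim_regular\<close>, in which only the degrees of the forms occur. The dimensions
can thus be read off from a single example.\<close>

lemma graded_dim_complete_intersection_unique:
  fixes fs gs :: "'k::field polynomial list"
  assumes fs: "complete_intersection ds fs" and gs: "complete_intersection ds gs"
    and "i \<le> length ds"
  shows "graded_dim (length ds) (Idl\<^bsub>poly_ring (length ds)\<^esub> (set (take i fs))) d =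
    graded_dim (length ds) (Idl\<^bsub>poly_ring (length ds)\<^esub> (set (take i gs))) d"
  using assms(3)
proof (induction i arbitrary: d)
  case (Suc i)
  let ?I = "\<lambda>fs. Idl\<^bsub>poly_ring (length ds)\<^esub> (set (take i fs :: 'k polynomial list))"
  have i: "i < length ds" using Suc.prems by simp
  have step: "graded_dim (length ds) (Idl\<^bsub>poly_ring (length ds)\<^esub> (set (take (Suc i) fs))) d =
      graded_dim (length ds) (?I fs) d + (if ds ! i \<le> d then
        card (monomials (length ds) (d - ds ! i)) - graded_dim (length ds) (?I fs) (d - ds ! i) else 0)"
    if CI: "complete_intersection ds fs" for fs :: "'k polynomial list"
    unfolding Idl_take_Suc[OF CI i]
    by (rule graded_dim_regular)
      (use complete_intersection_nth[OF CI i] homogeneous_component_complete_intersection[OF CI less_imp_le[OF i]]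
        in \<open>auto simp: poly_quotient_def\<close>)
  show ?case unfolding step[OF fs] step[OF gs] using Suc.IH i by simp
qed simp

lemma hilbert_function_complete_intersection_unique:
  fixes fs gs :: "'k::field polynomial list"
  assumes fs: "complete_intersection ds fs" and gs: "complete_intersection ds gs"
  shows "hilbert_function (length ds) (Idl\<^bsub>poly_ring (length ds)\<^esub> (set fs)) d =
    hilbert_function (length ds) (Idl\<^bsub>poly_ring (length ds)\<^esub> (set gs)) d"
proof -
  interpret cring "poly_ring (length ds) :: 'k polynomial ring" by (rule cring_poly_ring)
  have pq: "poly_quotient (length ds) (Idl\<^bsub>poly_ring (length ds)\<^esub> (set fs))"
    if CI: "complete_intersection ds fs" for fs :: "'k polynomial list"
  proof -
    have sub: "set fs \<subseteq> carrier (poly_ring (length ds))"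
      and proper: "Idl\<^bsub>poly_ring (length ds)\<^esub> (set fs) \<noteq> carrier (poly_ring (length ds))"
      using CI unfolding complete_intersection_def regular_sequence_def by auto
    have "1 \<notin> Idl\<^bsub>poly_ring (length ds)\<^esub> (set fs)" by (rule one_notin_proper_Idl[OF sub proper])
    then show ?thesis using genideal_ideal[OF sub] by (intro poly_quotient.intro)
  qed
  have "length fs = length ds" "length gs = length ds"
    using fs gs by (simp_all add: complete_intersection_def)
  then show ?thesis
    using graded_dim_complete_intersection_unique[OF fs gs order_refl, of d]
    unfolding poly_quotient.hilbert_function_eq[OF pq[OF fs]]
      poly_quotient.hilbert_function_eq[OF pq[OF gs]] by simp
qed

section \<open>Monomial complete intersections\<close>

lemma poly_var_power: "poly_var i ^ d = Poly_Mapping.single (Poly_Mapping.single i d) 1"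
  by (induction d) (simp_all add: poly_var_def mult_single single_add[symmetric])

text \<open>A monomial that one of the powers divides is a multiple of it, and the polynomials whose monomials
are all divisible by some of the powers form an ideal.\<close>

lemma Idl_poly_var_powers:
  assumes X: "X \<subseteq> {..<n}"
  shows "Idl\<^bsub>poly_ring n\<^esub> ((\<lambda>j. poly_var j ^ (e j)) ` X) =
    (supported_on {m. Poly_Mapping.keys m \<subseteq> {..<n} \<and> (\<exists>j\<in>X. e j \<le> Poly_Mapping.lookup m j)}
      :: 'k::field polynomial set)" (is "_ = supported_on ?M")
proof -
  let ?R = "poly_ring n :: 'k polynomial ring"
  interpret cring ?R by (rule cring_poly_ring)
  let ?G = "(\<lambda>j. poly_var j ^ (e j) :: 'k polynomial) ` X"
  have G: "?G \<subseteq> carrier ?R"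
    using X by (auto simp: poly_var_power poly_carrier_iff split: if_splits)
  have "ideal (supported_on ?M) ?R"
  proof (rule poly_idealI)
    show "supported_on ?M \<subseteq> carrier ?R"
      by (force simp: supported_on_def poly_carrier_iff)
    show "f + g \<in> supported_on ?M" if "f \<in> supported_on ?M" "g \<in> supported_on ?M" for f g :: "'k polynomial"
      by (rule poly_vs.subspace_add[OF subspace_supported_on that])
    show "f * g \<in> supported_on ?M" if f: "f \<in> carrier ?R" and g: "g \<in> supported_on ?M" for f g
    proof -
      have "m \<in> ?M" if mk: "m \<in> Poly_Mapping.keys (f * g)" for m
      proof -
        obtain a b where m: "m = a + b" "a \<in> Poly_Mapping.keys f" "b \<in> Poly_Mapping.keys g"
          using mk Poly_Mapping.keys_mult[of f g] by blast
        obtain j where "j \<in> X" "e j \<le> Poly_Mapping.lookup b j"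
          using g m(3) by (auto simp: supported_on_def)
        then have "\<exists>j\<in>X. e j \<le> Poly_Mapping.lookup m j"
          unfolding m(1) by (auto simp: lookup_add intro!: bexI[of _ j])
        moreover have "Poly_Mapping.keys a \<subseteq> {..<n}" "Poly_Mapping.keys b \<subseteq> {..<n}"
          using f g m by (auto simp: supported_on_def poly_carrier_iff)
        ultimately show ?thesis using Poly_Mapping.keys_add[of a b] m(1) by blast
      qed
      then show ?thesis by (auto simp: supported_on_def)
    qed
  qed (simp add: supported_on_def)
  moreover have "?G \<subseteq> supported_on ?M"
  proof (rule image_subsetI)
    fix j assume j: "j \<in> X"
    have "e j \<le> Poly_Mapping.lookup (Poly_Mapping.single j (e j)) j" by simp
    then show "poly_var j ^ e j \<in> supported_on ?M"
      using j X by (auto simp: poly_var_power supported_on_def simp del: lookup_single_eq split: if_splits)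
  qed
  ultimately have "Idl\<^bsub>?R\<^esub> ?G \<subseteq> supported_on ?M" by (rule genideal_minimal)
  moreover have "supported_on ?M \<subseteq> Idl\<^bsub>?R\<^esub> ?G"
  proof
    fix f :: "'k polynomial" assume f: "f \<in> supported_on ?M"
    have I: "ideal (Idl\<^bsub>?R\<^esub> ?G) ?R" by (rule genideal_ideal[OF G])
    have "(\<Sum>m\<in>Poly_Mapping.keys f. Poly_Mapping.single m (Poly_Mapping.lookup f m)) \<in> Idl\<^bsub>?R\<^esub> ?G"
    proof (rule poly_vs.subspace_sum[OF subspace_poly_ideal[OF I]])
      fix m assume "m \<in> Poly_Mapping.keys f"
      then obtain j where m: "Poly_Mapping.keys m \<subseteq> {..<n}" "j \<in> X" "e j \<le> Poly_Mapping.lookup m j"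
        using f by (auto simp: supported_on_def)
      let ?b = "m - Poly_Mapping.single j (e j)"
      have b: "m = ?b + Poly_Mapping.single j (e j)"
        by (rule poly_mapping_eqI) (use m(3) in \<open>auto simp: lookup_add lookup_minus lookup_single when_def\<close>)
      have "Poly_Mapping.keys ?b \<subseteq> {..<n}"
        using m(1) by (auto simp: in_keys_iff lookup_minus subset_iff)
      then have "Poly_Mapping.single ?b (Poly_Mapping.lookup f m) \<in> carrier ?R"
        by (auto simp: poly_carrier_iff split: if_splits)
      moreover have "poly_var j ^ e j \<in> Idl\<^bsub>?R\<^esub> ?G" using genideal_self[OF G] m(2) by blast
      ultimately have "Poly_Mapping.single ?b (Poly_Mapping.lookup f m) * poly_var j ^ e j \<in> Idl\<^bsub>?R\<^esub> ?G"
        by (rule poly_idealD(4)[OF I])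
      then show "Poly_Mapping.single m (Poly_Mapping.lookup f m) \<in> Idl\<^bsub>?R\<^esub> ?G"
        using b by (simp add: poly_var_power mult_single)
    qed
    then show "f \<in> Idl\<^bsub>?R\<^esub> ?G" by (simp only: sum_single_lookup)
  qed
  ultimately show ?thesis by (rule subset_antisym)
qed

text \<open>The monomials that form a basis of the quotient by the powers of the variables.\<close>

definition box :: "nat list \<Rightarrow> (nat \<Rightarrow>\<^sub>0 nat) set" where
  "box ds = {m. Poly_Mapping.keys m \<subseteq> {..<length ds} \<and> (\<forall>i<length ds. Poly_Mapping.lookup m i < ds ! i)}"

lemma finite_box: "finite (box ds)"
proof (rule finite_subset[OF _ finite_bounded_monomials])
  show "box ds \<subseteq> {m. Poly_Mapping.keys m \<subseteq> {..<length ds} \<and>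
      (\<forall>i<length ds. Poly_Mapping.lookup m i \<le> sum_list ds)}"
    by (auto simp: box_def intro: less_imp_le less_le_trans elem_le_sum_list)
qed

lemma monomial_ideal_eq:
  "monomial_ideal ds = (supported_on {m. Poly_Mapping.keys m \<subseteq> {..<length ds} \<and> m \<notin> box ds}
    :: 'k::field polynomial set)"
proof -
  have "{poly_var i ^ (ds ! i) :: 'k polynomial | i. i < length ds} =
      (\<lambda>i. poly_var i ^ (ds ! i)) ` {..<length ds}" by auto
  moreover have "{m. Poly_Mapping.keys m \<subseteq> {..<length ds} \<and>
      (\<exists>j\<in>{..<length ds}. ds ! j \<le> Poly_Mapping.lookup m j)} =
      {m. Poly_Mapping.keys m \<subseteq> {..<length ds} \<and> m \<notin> box ds}"
    by (auto simp: box_def not_less)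
  ultimately show ?thesis
    unfolding monomial_ideal_def using Idl_poly_var_powers[of "{..<length ds}" "length ds" "(!) ds"]
    by simp
qed

lemma zero_in_box: "\<forall>d\<in>set ds. 1 \<le> d \<Longrightarrow> 0 \<in> box ds"
  by (force simp: box_def set_conv_nth)

lemma poly_quotient_monomial_ideal:
  assumes "\<forall>d\<in>set ds. 1 \<le> d"
  shows "poly_quotient (length ds) (monomial_ideal ds :: 'k::field polynomial set)"
proof (rule poly_quotient.intro)
  let ?R = "poly_ring (length ds) :: 'k polynomial ring"
  interpret cring ?R by (rule cring_poly_ring)
  have "{poly_var i ^ (ds ! i) :: 'k polynomial | i. i < length ds} \<subseteq> carrier ?R"
    by (auto simp: poly_var_power poly_carrier_iff split: if_splits)
  then show "ideal (monomial_ideal ds) ?R" unfolding monomial_ideal_def by (rule genideal_ideal)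
  show "(1 :: 'k polynomial) \<notin> monomial_ideal ds"
    unfolding monomial_ideal_eq using zero_in_box[OF assms] by (simp add: supported_on_def)
qed

text \<open>Regularity holds monomial by monomial: if a power of \<open>x\<^sub>j\<close> with
\<open>j < i\<close> divides the product of a monomial with a power of \<open>x\<^sub>i\<close>,
then it divides the monomial already.\<close>

lemma complete_intersection_poly_var_powers:
  assumes ds: "\<forall>d\<in>set ds. 1 \<le> d"
  defines "fs \<equiv> map (\<lambda>i. poly_var i ^ (ds ! i)) [0..<length ds] :: 'k::field polynomial list"
  shows "complete_intersection ds fs" "Idl\<^bsub>poly_ring (length ds)\<^esub> (set fs) = monomial_ideal ds"
proof -
  let ?n = "length ds"
  let ?R = "poly_ring ?n :: 'k polynomial ring"
  interpret cring ?R by (rule cring_poly_ring)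
  let ?x = "\<lambda>i. poly_var i ^ (ds ! i) :: 'k polynomial"
  have set_take: "set (take i fs) = ?x ` {..<i}" if "i \<le> ?n" for i
    using that unfolding fs_def take_map by auto
  have set_fs: "set fs = ?x ` {..<?n}" using set_take[of ?n] by (simp add: fs_def)
  have "{?x i | i. i < ?n} = set fs" unfolding set_fs by auto
  then show Idl: "Idl\<^bsub>?R\<^esub> (set fs) = monomial_ideal ds" unfolding monomial_ideal_def by simp
  have one: "(1 :: 'k polynomial) \<notin> monomial_ideal ds"
    by (rule poly_quotient.one_notin[OF poly_quotient_monomial_ideal[OF ds]])
  moreover have "1 \<in> carrier ?R" by (rule poly_ring_closed(2))
  ultimately have proper: "Idl\<^bsub>?R\<^esub> (set fs) \<noteq> carrier ?R" using Idl by auto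
  have sub: "set fs \<subseteq> carrier ?R"
    unfolding set_fs by (auto simp: poly_var_power poly_carrier_iff split: if_splits)
  have hom: "homogeneous (ds ! i) (fs ! i)" if "i < ?n" for i
    using that by (simp add: fs_def poly_var_power homogeneous_iff mdeg_def)
  have reg: "a = \<zero>\<^bsub>?R Quot I\<^esub>"
    if i: "i < ?n" and I_def: "I = Idl\<^bsub>?R\<^esub> (set (take i fs))" and a: "a \<in> carrier (?R Quot I)"
      and 0: "(I +>\<^bsub>?R\<^esub> (fs ! i)) \<otimes>\<^bsub>?R Quot I\<^esub> a = \<zero>\<^bsub>?R Quot I\<^esub>" for i I a
  proof -
    have I: "I = supported_on {m. Poly_Mapping.keys m \<subseteq> {..<?n} \<and> (\<exists>j\<in>{..<i}. ds ! j \<le> Poly_Mapping.lookup m j)}"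
      unfolding I_def set_take[OF less_imp_le[OF i]] by (rule Idl_poly_var_powers) (use i in auto)
    have takeS: "set (take i fs) \<subseteq> carrier ?R" using sub set_take_subset by fast
    have "I \<subseteq> monomial_ideal ds"
      unfolding I_def Idl[symmetric] by (rule subset_Idl_subset[OF sub set_take_subset])
    then interpret poly_quotient ?n I
      using one genideal_ideal[OF takeS] I_def by (intro poly_quotient.intro) auto
    obtain h where h: "h \<in> carrier ?R" "a = proj h" using a carrier_Q by auto
    have "fs ! i \<in> set fs" using i by (intro nth_mem) (simp add: fs_def)
    then have fi: "fs ! i \<in> carrier ?R" using sub by blast
    have "fs ! i * h \<in> I"
      using 0 proj_simps(2)[OF fi h(1)] proj_eq_0_iff[OF poly_ring_closed(4)[OF fi h(1)]] h(2) by simp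
    have "Poly_Mapping.keys h \<subseteq> {m. Poly_Mapping.keys m \<subseteq> {..<?n} \<and> (\<exists>j\<in>{..<i}. ds ! j \<le> Poly_Mapping.lookup m j)}"
    proof
      fix m assume m: "m \<in> Poly_Mapping.keys h"
      let ?e = "Poly_Mapping.single i (ds ! i)"
      have "Poly_Mapping.lookup (fs ! i * h) (?e + m) = Poly_Mapping.lookup h m"
        using i lookup_single_mult[of ?e 1 h m] by (simp add: fs_def poly_var_power)
      then have "?e + m \<in> Poly_Mapping.keys (fs ! i * h)" using m by (simp add: in_keys_iff)
      then obtain j where "j < i" "ds ! j \<le> Poly_Mapping.lookup (?e + m) j"
        using \<open>fs ! i * h \<in> I\<close> unfolding I by (auto simp: supported_on_def)
      then have "j < i" "ds ! j \<le> Poly_Mapping.lookup m j"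
        by (auto simp: lookup_add lookup_single when_def)
      moreover have "Poly_Mapping.keys m \<subseteq> {..<?n}" using h(1) m by (simp add: poly_carrier_iff)
      ultimately show "m \<in> {m. Poly_Mapping.keys m \<subseteq> {..<?n} \<and> (\<exists>j\<in>{..<i}. ds ! j \<le> Poly_Mapping.lookup m j)}"
        by auto
    qed
    then have "h \<in> I" unfolding I by (simp add: supported_on_def)
    then show ?thesis using proj_eq_0_iff[OF h(1)] h(2) by simp
  qed
  show "complete_intersection ds fs"
    unfolding complete_intersection_def regular_sequence_def Let_def
  proof (intro conjI allI impI ballI)
    show "length fs = ?n" by (simp add: fs_def)
    show "homogeneous (ds ! i) (fs ! i)" if "i < ?n" for i using hom[OF that] .
    show "set fs \<subseteq> carrier ?R" by (rule sub)
    show "Idl\<^bsub>?R\<^esub> (set fs) \<noteq> carrier ?R" by (rule proper)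
  next
    fix i a assume "i < length fs" "a \<in> carrier (?R Quot Idl\<^bsub>?R\<^esub> (set (take i fs)))"
      "(Idl\<^bsub>?R\<^esub> (set (take i fs)) +>\<^bsub>?R\<^esub> fs ! i) \<otimes>\<^bsub>?R Quot Idl\<^bsub>?R\<^esub> (set (take i fs))\<^esub> a =
        \<zero>\<^bsub>?R Quot Idl\<^bsub>?R\<^esub> (set (take i fs))\<^esub>"
    then show "a = \<zero>\<^bsub>?R Quot Idl\<^bsub>?R\<^esub> (set (take i fs))\<^esub>"
      using reg[OF _ refl] by (simp add: fs_def)
  qed
qed

lemma hilbert_function_monomial_ideal:
  assumes "\<forall>d\<in>set ds. 1 \<le> d"
  shows "hilbert_function (length ds) (monomial_ideal ds :: 'k::field polynomial set) d =
    card {m \<in> box ds. mdeg m = d}"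
proof -
  let ?n = "length ds"
  let ?X = "{m \<in> monomials ?n d. m \<notin> box ds}"
  have "(monomial_ideal ds :: 'k polynomial set) \<inter> supported_on (monomials ?n d) = supported_on ?X"
    unfolding monomial_ideal_eq by (auto simp: supported_on_def monomials_def)
  then have "graded_dim ?n (monomial_ideal ds :: 'k polynomial set) d = card ?X"
    unfolding graded_dim_def using dim_supported_on[of ?X, where 'k = 'k] finite_monomials by simp
  moreover have "card (monomials ?n d) - card ?X = card (monomials ?n d - ?X)"
    by (rule card_Diff_subset[symmetric]) (use finite_monomials in auto)
  moreover have "monomials ?n d - ?X = {m \<in> box ds. mdeg m = d}"
    by (auto simp: monomials_def box_def)
  ultimately show ?thesis
    using poly_quotient.hilbert_function_eq[OF poly_quotient_monomial_ideal[OF assms, where 'k = 'k]]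
    by simp
qed

theorem hilbert_function_complete_intersection:
  fixes fs :: "'k::field polynomial list"
  assumes "\<forall>d\<in>set ds. 1 \<le> d" "complete_intersection ds fs"
  shows "hilbert_function (length ds) (Idl\<^bsub>poly_ring (length ds)\<^esub> (set fs)) d =
    card {m \<in> box ds. mdeg m = d}"
  using hilbert_function_complete_intersection_unique[OF assms(2)
      complete_intersection_poly_var_powers(1)[OF assms(1)]]
    complete_intersection_poly_var_powers(2)[OF assms(1), where 'k = 'k]
    hilbert_function_monomial_ideal[OF assms(1), where 'k = 'k] by simp

section \<open>Conjugate partitions\<close>

text \<open>As a function of the exponent, \<open>min k p\<close> grows with slope one up to
\<open>k = p\<close> and is constant from there on, so its second difference detects the parts
of a given size. This is why the kernel dimensions of the powers of a nilpotent map determine its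
Jordan type.\<close>

lemma sum_mset_min_second_difference:
  fixes P :: "nat multiset"
  shows "2 * (\<Sum>p\<in>#P. min (Suc k) p) =
    (\<Sum>p\<in>#P. min k p) + (\<Sum>p\<in>#P. min (Suc (Suc k)) p) + count P (Suc k)"
  by (induction P) (auto simp: min_def)

lemma multiset_eq_if_sum_min_eq:
  fixes P Q :: "nat multiset"
  assumes "0 \<notin># P" "0 \<notin># Q" and eq: "\<And>k. (\<Sum>p\<in>#P. min k p) = (\<Sum>p\<in>#Q. min k p)"
  shows "P = Q"
proof (rule multiset_eqI)
  fix p
  show "count P p = count Q p"
  proof (cases p)
    case 0
    then show ?thesis using assms(1,2) by (simp add: not_in_iff)
  next
    case (Suc k)
    then show ?thesis
      using sum_mset_min_second_difference[of k P] sum_mset_min_second_difference[of k Q]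
      by (simp add: eq)
  qed
qed

lemma nat_convex_eq_atLeastAtMost:
  fixes L :: "nat set"
  assumes "finite L" "L \<noteq> {}" and convex: "\<And>i j k. i \<in> L \<Longrightarrow> k \<in> L \<Longrightarrow> i \<le> j \<Longrightarrow> j \<le> k \<Longrightarrow> j \<in> L"
  shows "L = {Min L..Max L}"
proof
  show "L \<subseteq> {Min L..Max L}" using assms(1) by auto
  show "{Min L..Max L} \<subseteq> L"
    using convex[OF Min_in[OF assms(1,2)] Max_in[OF assms(1,2)]] by auto
qed

text \<open>A convex set of natural numbers is an interval, and the elements that leave it under the shift by
\<open>k\<close> are its last \<open>k\<close> elements, or all of them if there are fewer.\<close>

lemma card_convex_leaving_shift:
  fixes L :: "nat set"
  assumes "finite L" "L \<noteq> {}" and convex: "\<And>i j k. i \<in> L \<Longrightarrow> k \<in> L \<Longrightarrow> i \<le> j \<Longrightarrow> j \<le> k \<Longrightarrow> j \<in> L"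
  shows "card {j \<in> L. j + k \<notin> L} = min k (card L)"
proof -
  define a b where "a = Min L" and "b = Max L"
  have L: "L = {a..b}" unfolding a_def b_def
    by (rule nat_convex_eq_atLeastAtMost[OF assms(1,2)]) (rule convex)
  have "a \<le> b" using assms(2) L by auto
  then have "{j \<in> L. j + k \<notin> L} = {max a (Suc b - k)..b}" unfolding L by auto
  then show ?thesis unfolding L using \<open>a \<le> b\<close> by auto
qed

text \<open>The difference \<open>h j - h (j + k)\<close> counts the thresholds \<open>t\<close> with
\<open>h (j + k) < t \<le> h j\<close>. Exchanging the sums, a threshold \<open>t\<close>
is counted once for every \<open>j\<close> that leaves the level set
\<open>{j. t \<le> h j}\<close> under the shift by \<open>k\<close>. By unimodality the level
set is an interval, and its length is the \<open>t\<close>-th part of the conjugate partition.\<close>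

lemma sum_min_conjugate_partition:
  fixes h :: "nat \<Rightarrow> nat"
  assumes fin: "finite {d. h d \<noteq> 0}"
    and unimodal: "\<And>i j k. i \<le> j \<Longrightarrow> j \<le> k \<Longrightarrow> min (h i) (h k) \<le> h j"
  shows "(\<Sum>p\<in>#conjugate_partition (image_mset h (mset_set {d. h d \<noteq> 0})). min k p) =
    (\<Sum>j | h j \<noteq> 0. h j - h (j + k))"
proof -
  let ?D = "{d. h d \<noteq> 0}"
  let ?Q = "image_mset h (mset_set ?D)"
  define T where "T = {t. 1 \<le> t \<and> (\<exists>p\<in>#?Q. t \<le> p)}"
  define L where "L t = {d. t \<le> h d}" for t
  have T: "T = {t. 1 \<le> t \<and> L t \<noteq> {}}" 
  proof -
    have "(\<exists>p\<in>#?Q. t \<le> p) \<longleftrightarrow> (\<exists>d. h d \<noteq> 0 \<and> t \<le> h d)" for t using fin by simp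
    then show ?thesis unfolding T_def L_def by force
  qed
  have finT: "finite T"
  proof (rule finite_subset)
    show "T \<subseteq> (\<Union>d\<in>?D. {..h d})" using fin by (auto simp: T_def)
  qed (use fin in simp)
  have LD: "L t \<subseteq> ?D" if "t \<in> T" for t using that by (auto simp: T L_def)
  have size: "size {#p \<in># ?Q. t \<le> p#} = card (L t)" if "t \<in> T" for t
  proof -
    have "{d \<in> ?D. t \<le> h d} = L t" using LD[OF that] by (auto simp: L_def)
    then show ?thesis by (simp add: filter_mset_image_mset filter_mset_mset_set fin del: neq0_conv)
  qed
  have "(\<Sum>p\<in>#conjugate_partition ?Q. min k p) = (\<Sum>t\<in>T. min k (size {#p \<in># ?Q. t \<le> p#}))"
    by (simp only: conjugate_partition_def T_def[symmetric] image_mset.compositionality o_def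
        sum_unfold_sum_mset)
  also have "\<dots> = (\<Sum>t\<in>T. min k (card (L t)))"
    by (rule sum.cong[OF refl]) (simp only: size)
  also have "\<dots> = (\<Sum>t\<in>T. card {j \<in> ?D. t \<le> h j \<and> h (j + k) < t})"
  proof (rule sum.cong[OF refl])
    fix t assume t: "t \<in> T"
    have "{j \<in> ?D. t \<le> h j \<and> h (j + k) < t} = {j \<in> L t. j + k \<notin> L t}"
      using LD[OF t] by (auto simp: L_def)
    moreover have "card {j \<in> L t. j + k \<notin> L t} = min k (card (L t))"
    proof (rule card_convex_leaving_shift)
      show "finite (L t)" using finite_subset[OF LD[OF t] fin] .
      show "L t \<noteq> {}" using t T by auto
      show "j \<in> L t" if "i \<in> L t" "k \<in> L t" "i \<le> j" "j \<le> k" for i j k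
        using unimodal[of i j k] that by (auto simp: L_def)
    qed
    ultimately show "min k (card (L t)) = card {j \<in> ?D. t \<le> h j \<and> h (j + k) < t}" by simp
  qed
  also have "\<dots> = (\<Sum>j\<in>?D. card {t \<in> T. t \<le> h j \<and> h (j + k) < t})"
  proof -
    have card: "card {x \<in> A. R x} = (\<Sum>x\<in>A. if R x then 1 else 0)" if "finite A" for A :: "nat set" and R
      using that by (simp add: sum.If_cases Collect_conj_eq)
    show ?thesis using fin finT by (subst (1 2) card) (auto intro: sum.swap)
  qed
  also have "\<dots> = (\<Sum>j\<in>?D. h j - h (j + k))"
  proof (rule sum.cong[OF refl])
    fix j assume "j \<in> ?D"
    have "{t \<in> T. t \<le> h j \<and> h (j + k) < t} = {h (j + k)<..h j}"
      by (auto simp: T L_def)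
    then show "card {t \<in> T. t \<le> h j \<and> h (j + k) < t} = h j - h (j + k)" by simp
  qed
  finally show ?thesis .
qed

lemma zero_notin_conjugate_partition: "0 \<notin># conjugate_partition P"
proof
  let ?J = "{j. 1 \<le> j \<and> (\<exists>p\<in>#P. j \<le> p)}"
  assume "0 \<in># conjugate_partition P"
  then obtain j where j: "j \<in># mset_set ?J" "size {#p \<in># P. j \<le> p#} = 0"
    unfolding conjugate_partition_def by auto
  have "j \<in> ?J" using j(1) by (cases "finite ?J") simp_all
  then obtain p where "p \<in># P" "j \<le> p" by auto
  then have "p \<in># {#p \<in># P. j \<le> p#}" by simp
  then show False using j(2) by (metis empty_iff set_mset_empty size_eq_0_iff_empty)
qed

section \<open>Jordan types and kernel dimensions\<close>

context vector_space
begin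

lemma span_image_inj:
  assumes "finite A" "inj_on f A"
  shows "span (f ` A) = {\<Sum>x\<in>A. c x *s f x | c. True}"
proof -
  have "span (f ` A) = range (\<lambda>u. \<Sum>x\<in>A. u (f x) *s f x)"
    using span_finite[OF finite_imageI[OF assms(1)], of f] by (simp add: sum.reindex[OF assms(2)])
  also have "\<dots> = {\<Sum>x\<in>A. c x *s f x | c. True}"
  proof safe
    fix u show "\<exists>c. (\<Sum>x\<in>A. u (f x) *s f x) = (\<Sum>x\<in>A. c x *s f x) \<and> True"
      by (rule exI[of _ "u \<circ> f"]) simp
  next
    fix c
    have "(\<Sum>x\<in>A. c x *s f x) = (\<Sum>x\<in>A. (c \<circ> inv_into A f) (f x) *s f x)"
      using assms(2) by simp
    then show "(\<Sum>x\<in>A. c x *s f x) \<in> range (\<lambda>u. \<Sum>x\<in>A. u (f x) *s f x)" 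
      by (rule range_eqI[where x = "c \<circ> inv_into A f"])
  qed
  finally show ?thesis .
qed

lemma independent_image:
  assumes fin: "finite A" and zero: "\<And>c x. (\<Sum>x\<in>A. c x *s f x) = 0 \<Longrightarrow> x \<in> A \<Longrightarrow> c x = 0"
  shows "inj_on f A" "independent (f ` A)"
proof -
  show inj: "inj_on f A"
  proof (rule inj_onI, rule ccontr)
    fix x y assume xy: "x \<in> A" "y \<in> A" "f x = f y" "x \<noteq> y"
    let ?c = "\<lambda>z. if z = x then 1 else if z = y then - 1 else 0 :: 'a"
    have "(\<Sum>z\<in>A. ?c z *s f z) = (\<Sum>z\<in>{x, y}. ?c z *s f z)"
      using fin xy by (intro sum.mono_neutral_right) auto
    also have "\<dots> = 0" using xy by simp
    finally show False using zero[OF _ xy(1), of ?c] by simp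
  qed
  show "independent (f ` A)"
  proof (rule independent_if_scalars_zero)
    fix c y assume "(\<Sum>y\<in>f ` A. c y *s y) = 0" "y \<in> f ` A"
    then show "c y = 0" using zero[of "c \<circ> f"] by (auto simp: sum.reindex[OF inj])
  qed (use fin in simp)
qed

end

locale basis_family = vector_space scale
  for scale :: "'a::field \<Rightarrow> 'b::ab_group_add \<Rightarrow> 'b" (infixr \<open>*s\<close> 75) +
  fixes b :: "nat \<Rightarrow> 'b" and N :: nat
  assumes independent_family: "(\<Sum>i<N. c i *s b i) = 0 \<Longrightarrow> i < N \<Longrightarrow> c i = 0"
begin

definition of_coords :: "'a vec \<Rightarrow> 'b" where
  "of_coords v = (\<Sum>i<N. v $ i *s b i)"

lemma of_coords_eq_0:
  assumes "v \<in> carrier_vec N" "of_coords v = 0"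
  shows "v = 0\<^sub>v N"
proof (rule eq_vecI)
  show "dim_vec v = dim_vec (0\<^sub>v N)" using assms(1) by simp
  show "v $ i = 0\<^sub>v N $ i" if "i < dim_vec (0\<^sub>v N)" for i
    using independent_family[of "\<lambda>i. v $ i" i] assms(2) that by (simp add: of_coords_def)
qed

lemma of_coords_0: "of_coords (0\<^sub>v N) = 0"
  by (simp add: of_coords_def)

text \<open>The kernel of a matrix is a subspace of coordinate vectors with its own notion of dimension; the
map \<open>of_coords\<close> carries a basis of it to a basis of the image.\<close>

lemma dim_of_coords_mat_kernel:
  assumes A: "A \<in> carrier_mat N N"
  shows "dim (of_coords ` mat_kernel A) = kernel_dim A"
proof -
  interpret K: kernel N N A by unfold_locales (rule A)
  obtain X where X: "finite X" "K.basis X" using kernel_basis_exists[OF A] by blast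
  have sub: "X \<subseteq> mat_kernel A" and li: "K.lin_indpt X" and gen: "K.span X = mat_kernel A"
    using X(2) unfolding K.Ker.basis_def by auto
  have XN: "X \<subseteq> carrier_vec N" using sub mat_kernel_carrier[OF A] by blast
  have lincomb_closed: "K.lincomb c X \<in> carrier_vec N" for c
    using K.lincomb_same[OF sub] K.NC.lincomb_closed[OF XN] by simp
  have of_coords_lincomb: "of_coords (K.lincomb c X) = (\<Sum>x\<in>X. c x *s of_coords x)" for c
  proof -
    have "of_coords (K.lincomb c X) = (\<Sum>i<N. (\<Sum>x\<in>X. c x * x $ i) *s b i)"
      unfolding of_coords_def using K.lincomb_index[OF _ sub] by simp
    also have "\<dots> = (\<Sum>i<N. \<Sum>x\<in>X. (c x * x $ i) *s b i)"
      by (simp add: scale_sum_left)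
    also have "\<dots> = (\<Sum>x\<in>X. \<Sum>i<N. (c x * x $ i) *s b i)" by (rule sum.swap)
    also have "\<dots> = (\<Sum>x\<in>X. c x *s of_coords x)"
      unfolding of_coords_def scale_sum_right by simp
    finally show ?thesis .
  qed
  have zero_comb: "c x = 0" if c: "(\<Sum>x\<in>X. c x *s of_coords x) = 0" and x: "x \<in> X" for c x
  proof -
    have "K.lincomb c X = 0\<^sub>v N"
      using of_coords_eq_0[OF lincomb_closed] of_coords_lincomb c by simp
    then show ?thesis
      using li X(1) x unfolding K.Ker.lin_dep_def by (auto simp: Pi_def)
  qed
  have inj: "inj_on of_coords X"
    by (rule independent_image(1)[OF X(1)]) (rule zero_comb)
  have ind: "independent (of_coords ` X)"
    by (rule independent_image(2)[OF X(1)]) (rule zero_comb)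
  have "K.span X = {K.lincomb c X | c. True}"
    using K.Ker.finite_span[OF X(1)] sub by (auto simp: Pi_def)
  with gen have "mat_kernel A = {K.lincomb c X | c. True}" by (rule subst)
  then have "of_coords ` mat_kernel A = of_coords ` {K.lincomb c X | c. True}" by (rule arg_cong)
  also have "\<dots> = {of_coords (K.lincomb c X) | c. True}" by auto
  also have "\<dots> = span (of_coords ` X)"
    unfolding of_coords_lincomb span_image_inj[OF X(1) inj] ..
  finally have "dim (of_coords ` mat_kernel A) = dim (span (of_coords ` X))" by simp
  then have "dim (of_coords ` mat_kernel A) = card X"
    using dim_span_eq_card_independent[OF ind] card_image[OF inj] by simp
  then show ?thesis using K.Ker.dim_basis[OF X] by simp
qed

text \<open>The coordinates with respect to the family \<open>b\<close> carry the matrix \<open>M\<close> over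
into the operator \<open>E\<close>, and thus the kernels of the powers of \<open>M\<close> into
those of \<open>E\<close>.\<close>

lemma kernel_dim_pow:
  assumes E: "Vector_Spaces.linear scale scale E" and M: "M \<in> carrier_mat N N"
    and EM: "\<And>j. j < N \<Longrightarrow> E (b j) = (\<Sum>i<N. M $$ (i, j) *s b i)"
  shows "kernel_dim (M ^\<^sub>m k) = dim {v \<in> {\<Sum>i<N. c i *s b i | c. True}. (E ^^ k) v = 0}"
proof -
  interpret E: Vector_Spaces.linear scale scale E by (rule E)
  have step: "of_coords (M *\<^sub>v v) = E (of_coords v)" if v: "v \<in> carrier_vec N" for v
  proof -
    have "of_coords (M *\<^sub>v v) = (\<Sum>i<N. (\<Sum>j<N. M $$ (i, j) * v $ j) *s b i)"
      unfolding of_coords_def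
    proof (rule sum.cong[OF refl])
      fix i assume "i \<in> {..<N}"
      then have "(M *\<^sub>v v) $ i = (\<Sum>j<N. M $$ (i, j) * v $ j)"
        using M v by (simp add: scalar_prod_def lessThan_atLeast0)
      then show "(M *\<^sub>v v) $ i *s b i = (\<Sum>j<N. M $$ (i, j) * v $ j) *s b i" by simp
    qed
    also have "\<dots> = (\<Sum>i<N. \<Sum>j<N. (M $$ (i, j) * v $ j) *s b i)"
      by (simp add: scale_sum_left)
    also have "\<dots> = (\<Sum>j<N. \<Sum>i<N. (M $$ (i, j) * v $ j) *s b i)" by (rule sum.swap)
    also have "\<dots> = (\<Sum>j<N. v $ j *s E (b j))"
    proof (rule sum.cong[OF refl])
      fix j assume "j \<in> {..<N}"
      then have "E (b j) = (\<Sum>i<N. M $$ (i, j) *s b i)" using EM by simp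
      then show "(\<Sum>i<N. (M $$ (i, j) * v $ j) *s b i) = v $ j *s E (b j)"
        by (simp add: scale_sum_right mult.commute)
    qed
    also have "\<dots> = E (of_coords v)" unfolding of_coords_def by (simp add: E.sum E.scale)
    finally show ?thesis .
  qed
  have Mk: "M ^\<^sub>m k \<in> carrier_mat N N" for k using M by simp
  have pow: "of_coords ((M ^\<^sub>m k) *\<^sub>v v) = (E ^^ k) (of_coords v)" if "v \<in> carrier_vec N" for v k
    using that
  proof (induction k arbitrary: v)
    case 0
    then show ?case using M by simp
  next
    case (Suc k)
    have Mv: "M *\<^sub>v v \<in> carrier_vec N" using M Suc.prems by simp
    have "(M ^\<^sub>m Suc k) *\<^sub>v v = (M ^\<^sub>m k) *\<^sub>v (M *\<^sub>v v)"
      using assoc_mult_mat_vec[OF Mk M Suc.prems] by simp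
    then show ?case using Suc.IH[OF Mv] step[OF Suc.prems] by (simp add: funpow_swap1)
  qed
  have coords: "{\<Sum>i<N. c i *s b i | c. True} = of_coords ` carrier_vec N"
  proof safe
    fix c
    have "(\<Sum>i<N. c i *s b i) = of_coords (vec N c)" by (simp add: of_coords_def)
    then show "(\<Sum>i<N. c i *s b i) \<in> of_coords ` carrier_vec N" by (metis imageI vec_carrier)
  qed (auto simp: of_coords_def)
  have "of_coords ` mat_kernel (M ^\<^sub>m k) = {v \<in> of_coords ` carrier_vec N. (E ^^ k) v = 0}"
  proof -
    have "v \<in> mat_kernel (M ^\<^sub>m k) \<longleftrightarrow> (E ^^ k) (of_coords v) = 0" if v: "v \<in> carrier_vec N" for v
    proof -
      have w: "(M ^\<^sub>m k) *\<^sub>v v \<in> carrier_vec N" by (rule mult_mat_vec_carrier[OF Mk v])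
      have "v \<in> mat_kernel (M ^\<^sub>m k) \<longleftrightarrow> (M ^\<^sub>m k) *\<^sub>v v = 0\<^sub>v N"
        using v mat_kernel[OF Mk] by simp
      also have "\<dots> \<longleftrightarrow> of_coords ((M ^\<^sub>m k) *\<^sub>v v) = 0"
        using of_coords_eq_0[OF w] of_coords_0 by auto
      finally show ?thesis using pow[OF v] by simp
    qed
    then show ?thesis using mat_kernel_carrier[OF Mk, of k] by auto
  qed
  then show ?thesis using dim_of_coords_mat_kernel[OF Mk, of k] coords by simp
qed

lemma dim_all: "dim {\<Sum>i<N. c i *s b i | c. True} = N"
proof -
  have zero: "c i = 0" if "(\<Sum>i<N. c i *s b i) = 0" "i \<in> {..<N}" for c i
    using independent_family[of c i] that by simp
  have inj: "inj_on b {..<N}"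
    by (rule independent_image(1)[OF finite_lessThan]) (rule zero)
  have ind: "independent (b ` {..<N})"
    by (rule independent_image(2)[OF finite_lessThan]) (rule zero)
  show ?thesis
    unfolding span_image_inj[OF finite_lessThan inj, symmetric]
    using dim_span_eq_card_independent[OF ind] card_image[OF inj] by simp
qed

end

text \<open>Blocks with the eigenvalue \<open>0\<close> account for the kernels of all powers of
\<open>M\<close>. As some power of \<open>M\<close> vanishes, their sizes add up to the size of
\<open>M\<close>, so there are no other blocks, and the sizes are determined by
\<open>multiset_eq_if_sum_min_eq\<close>.\<close>

lemma jordan_blocks_unique:
  fixes M :: "'a::field mat"
  assumes M: "M \<in> carrier_mat N N" and jnf: "jordan_nf M blocks"
    and P: "0 \<notin># P" "\<And>k. kernel_dim (M ^\<^sub>m k) = (\<Sum>p\<in>#P. min k p)"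
    and nilpotent: "kernel_dim (M ^\<^sub>m K) = N"
  shows "mset (map fst blocks) = P"
proof -
  have sim: "similar_mat M (jordan_matrix blocks)" and pos: "0 \<notin> fst ` set blocks"
    using jnf unfolding jordan_nf_def by auto
  have N: "sum_list (map fst blocks) = N"
  proof -
    obtain d where "M \<in> carrier_mat d d" "jordan_matrix blocks \<in> carrier_mat d d"
      using similar_matD[OF sim] by auto
    then show ?thesis using M unfolding carrier_mat_def by auto
  qed
  have "char_matrix M 0 = M" using M by (auto simp: char_matrix_def)
  \<comment> \<open>the generalized eigenspaces for the eigenvalue \<open>0\<close> are the kernels of the powers\<close>
  then have ker: "(\<Sum>n\<leftarrow>map fst [(n, e)\<leftarrow>blocks. e = 0]. min k n) = (\<Sum>p\<in>#P. min k p)" for k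
    using dim_gen_eigenspace[OF jnf, of 0 k] P(2)[of k] by (simp add: dim_gen_eigenspace_def)
  have "N \<le> sum_list (map fst [(n, e)\<leftarrow>blocks. e = 0])"
  proof -
    have "N = (\<Sum>n\<leftarrow>map fst [(n, e)\<leftarrow>blocks. e = 0]. min K n)"
      using ker[of K] P(2)[of K] nilpotent by simp
    also have "\<dots> \<le> (\<Sum>n\<leftarrow>map fst [(n, e)\<leftarrow>blocks. e = 0]. n)" by (rule sum_list_mono) simp
    finally show ?thesis by simp
  qed
  then have le: "sum_list (map fst blocks) \<le> sum_list (map fst [(n, e)\<leftarrow>blocks. e = 0])"
    using N by simp
  have filter_le: "sum_list (map fst [(n, e)\<leftarrow>bs. e = 0]) \<le> sum_list (map fst bs)"
    for bs :: "(nat \<times> 'a) list" by (induction bs) auto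
  have "[(n, e)\<leftarrow>bs. e = 0] = bs"
    if "0 \<notin> fst ` set bs" "sum_list (map fst bs) \<le> sum_list (map fst [(n, e)\<leftarrow>bs. e = 0])"
    for bs :: "(nat \<times> 'a) list"
    using that
  proof (induction bs)
    case (Cons x bs)
    obtain n e where x: "x = (n, e)" by (cases x)
    show ?case
    proof (cases "e = 0")
      case True
      then show ?thesis using Cons x by auto
    next
      case False
      then have "n + sum_list (map fst bs) \<le> sum_list (map fst [(n, e)\<leftarrow>bs. e = 0])"
        using Cons.prems(2) x by simp
      then have "n = 0" using filter_le[of bs] by simp
      then show ?thesis using Cons.prems(1) x by simp
    qed
  qed simp
  then have "[(n, e)\<leftarrow>blocks. e = 0] = blocks" using pos le by blast
  then have "(\<Sum>p\<in>#mset (map fst blocks). min k p) = (\<Sum>p\<in>#P. min k p)" for k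
    using ker[of k] by (simp add: sum_mset_sum_list[symmetric] mset_map[symmetric] del: mset_map)
  moreover have "0 \<notin># mset (map fst blocks)" using pos by simp
  ultimately show ?thesis using P(1) by (intro multiset_eq_if_sum_min_eq) auto
qed

text \<open>The map \<open>nf\<close> identifies the quotient by \<open>I\<close> with a subspace of an honest
vector space, in which \<open>E\<close> is multiplication by \<open>l\<close>.\<close>

locale poly_quotient_model = poly_quotient n I + vs: vector_space scale
  for n :: nat and I :: "'k::field polynomial set" and scale :: "'k \<Rightarrow> 'b::ab_group_add \<Rightarrow> 'b" +
  fixes nf :: "'k polynomial \<Rightarrow> 'b" and E :: "'b \<Rightarrow> 'b" and l :: "'k polynomial"
  assumes linear_nf: "Vector_Spaces.linear (\<lambda>c f. poly_const c * f) scale nf"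
    and linear_E: "Vector_Spaces.linear scale scale E"
    and nf_eq_0_iff: "f \<in> S \<Longrightarrow> nf f = 0 \<longleftrightarrow> f \<in> I"
    and l: "l \<in> S"
    and nf_mult: "f \<in> S \<Longrightarrow> nf (l * f) = E (nf f)"
begin

interpretation nf: Vector_Spaces.linear "\<lambda>c f. poly_const c * f" scale nf by (rule linear_nf)

lemma nf_eq_iff:
  assumes "f \<in> S" "g \<in> S"
  shows "nf f = nf g \<longleftrightarrow> f - g \<in> I"
proof -
  have "f - g \<in> S" using poly_ring_closed(3)[OF assms(1) poly_ring_closed(5)[OF assms(2)]] by simp
  then show ?thesis using nf_eq_0_iff[of "f - g"] nf.diff[of f g] by simp
qed

lemma kernel_dim_represents:
  assumes rep: "represents Q const us (\<lambda>x. proj l \<otimes>\<^bsub>Q\<^esub> x) M"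
  shows "M \<in> carrier_mat (length us) (length us)"
    "kernel_dim (M ^\<^sub>m k) = vs.dim {v \<in> nf ` S. (E ^^ k) v = 0}" "vs.dim (nf ` S) = length us"
proof -
  let ?N = "length us"
  have ind: "Q.independent (range const) us" and span: "Q.Span (range const) us = carrier Q"
    and M: "M \<in> carrier_mat ?N ?N"
    and T: "\<And>j. j < ?N \<Longrightarrow> proj l \<otimes>\<^bsub>Q\<^esub> (us ! j) =
        Q.combine (map (\<lambda>i. const (M $$ (i, j))) [0..<?N]) us"
    using rep unfolding represents_def by auto
  show "M \<in> carrier_mat ?N ?N" by (rule M)
  have "set us \<subseteq> proj ` S" using Q.independent_in_carrier[OF ind] carrier_Q by simp
  then have "us \<in> map proj ` lists S" unfolding lists_image[symmetric] by (simp add: lists_eq_set)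
  then obtain ps where ps: "us = map proj ps" "set ps \<subseteq> S" by (auto simp: lists_eq_set)
  have len: "length ps = ?N" using ps(1) by simp
  have psS: "ps ! i \<in> S" if "i < ?N" for i using ps(2) len that by (metis nth_mem subsetD)
  define b where "b i = nf (ps ! i)" for i
  have nf_comb: "nf (\<Sum>i<?N. poly_const (c i) * ps ! i) = (\<Sum>i<?N. scale (c i) (b i))" for c
    unfolding nf.sum nf.scale b_def ..
  have combS: "(\<Sum>i<?N. poly_const (c i) * ps ! i) \<in> S" for c
    using lincomb_in_S[OF ps(2), of c] len by simp
  interpret bf: basis_family scale b ?N
  proof
    fix c i assume "(\<Sum>i<?N. scale (c i) (b i)) = 0" and i: "i < ?N"
    then have "(\<Sum>i<?N. poly_const (c i) * ps ! i) \<in> I"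
      using nf_eq_0_iff[OF combS, of c] nf_comb[of c] by simp
    then show "c i = 0"
      using independent_proj_iff[OF ps(2), THEN iffD1, OF ind[unfolded ps(1)], unfolded len,
          THEN spec, THEN mp, THEN spec, THEN mp, OF _ i] by simp
  qed
  have V: "nf ` S = {\<Sum>i<?N. scale (c i) (b i) | c. True}"
  proof safe
    fix f assume f: "f \<in> S"
    have "proj f \<in> Q.Span (range const) us" using span proj_closed[OF f] by simp
    then obtain c where "proj f = proj (\<Sum>i<?N. poly_const (c i) * ps ! i)"
      unfolding ps(1) Span_proj[OF ps(2)] by auto
    then have "nf f = (\<Sum>i<?N. scale (c i) (b i))"
      using proj_eq_iff[OF f combS] nf_eq_iff[OF f combS] nf_comb by simp
    then show "\<exists>c. nf f = (\<Sum>i<?N. scale (c i) (b i)) \<and> True" by blast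
  next
    fix c show "(\<Sum>i<?N. scale (c i) (b i)) \<in> nf ` S"
      unfolding nf_comb[symmetric] by (rule imageI[OF combS])
  qed
  have EM: "E (b j) = (\<Sum>i<?N. scale (M $$ (i, j)) (b i))" if j: "j < ?N" for j
  proof -
    have lS: "l * ps ! j \<in> S" using poly_ring_closed(4)[OF l psS[OF j]] .
    have "proj (l * ps ! j) = proj l \<otimes>\<^bsub>Q\<^esub> (us ! j)"
      using proj_simps(2)[OF l psS[OF j]] ps(1) j by simp
    also have "\<dots> = proj (\<Sum>i<?N. poly_const (M $$ (i, j)) * ps ! i)"
      unfolding T[OF j] using combine_proj[OF ps(2), of "\<lambda>i. M $$ (i, j)"] unfolding len ps(1)[symmetric] .
    finally have "nf (l * ps ! j) = nf (\<Sum>i<?N. poly_const (M $$ (i, j)) * ps ! i)"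
      using proj_eq_iff[OF lS combS] nf_eq_iff[OF lS combS] by simp
    then show ?thesis unfolding nf_mult[OF psS[OF j]] nf_comb b_def[symmetric] .
  qed
  show "kernel_dim (M ^\<^sub>m k) = vs.dim {v \<in> nf ` S. (E ^^ k) v = 0}"
    unfolding V by (rule bf.kernel_dim_pow[OF linear_E M EM])
  show "vs.dim (nf ` S) = ?N" unfolding V by (rule bf.dim_all)
qed

text \<open>Any matrix that represents multiplication by \<open>l\<close> has the same kernel dimensions,
which gives uniqueness. For existence some representing matrix must have a Jordan normal form; a
triangular one has it over any field.\<close>

theorem has_jordan_type_iff:
  assumes P: "0 \<notin># P" "\<And>k. vs.dim {v \<in> nf ` S. (E ^^ k) v = 0} = (\<Sum>p\<in>#P. min k p)"
    and nilpotent: "\<And>v. v \<in> nf ` S \<Longrightarrow> (E ^^ K) v = 0"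
    and triangular: "represents Q const us (\<lambda>x. proj l \<otimes>\<^bsub>Q\<^esub> x) M" "upper_triangular M"
  shows "has_jordan_type Q const (\<lambda>x. proj l \<otimes>\<^bsub>Q\<^esub> x) P' \<longleftrightarrow> P' = P"
proof -
  have unique: "mset (map fst blocks) = P"
    if rep: "represents Q const us (\<lambda>x. proj l \<otimes>\<^bsub>Q\<^esub> x) M" and jnf: "jordan_nf M blocks"
    for us M blocks
  proof (rule jordan_blocks_unique[OF kernel_dim_represents(1)[OF rep] jnf P(1)])
    show "kernel_dim (M ^\<^sub>m k) = (\<Sum>p\<in>#P. min k p)" for k
      using kernel_dim_represents(2)[OF rep] P(2) by simp
    have "{v \<in> nf ` S. (E ^^ K) v = 0} = nf ` S" using nilpotent by blast
    then show "kernel_dim (M ^\<^sub>m K) = length us"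
      using kernel_dim_represents(2,3)[OF rep] by simp
  qed
  have "jordan_nf M (triangular_to_jnf_vector M)"
    by (rule triangular_to_jnf_vector[OF kernel_dim_represents(1)[OF triangular(1)] triangular(2)])
  then show ?thesis
    unfolding has_jordan_type_def using unique triangular(1) by metis
qed

end

section \<open>Multiplication by a linear form on a monomial complete intersection\<close>

lemma sum_fun_at: "(\<Sum>x\<in>A. f x) y = (\<Sum>x\<in>A. f x y)"
  for f :: "'i \<Rightarrow> 'j \<Rightarrow> 'k::comm_monoid_add"
  by (induction A rule: infinite_finite_induct) simp_all

interpretation fun_vs: vector_space "\<lambda>c (f :: 'i \<Rightarrow> 'k::field) x. c * f x"
  by unfold_locales (auto simp: algebra_simps)

definition funs_on :: "'i set \<Rightarrow> ('i \<Rightarrow> 'k::field) set" where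
  "funs_on X = {f. \<forall>x. x \<notin> X \<longrightarrow> f x = 0}"

lemma subspace_funs_on: "fun_vs.subspace (funs_on X :: ('i \<Rightarrow> 'k::field) set)"
  by (rule fun_vs.subspaceI) (auto simp: funs_on_def)

lemma funs_on_basis:
  fixes X :: "'i set"
  assumes fin: "finite X"
  defines "\<delta> \<equiv> \<lambda>x y. if y = x then 1 else 0 :: 'k::field"
  shows "inj_on \<delta> X" "fun_vs.independent (\<delta> ` X)" "fun_vs.span (\<delta> ` X) = funs_on X"
proof -
  have comb: "(\<Sum>x\<in>X. (\<lambda>y. c x * \<delta> x y)) = (\<lambda>y. if y \<in> X then c y else 0)" for c :: "'i \<Rightarrow> 'k"
  proof
    fix y show "(\<Sum>x\<in>X. (\<lambda>y. c x * \<delta> x y)) y = (if y \<in> X then c y else 0)"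
      using fin by (simp add: \<delta>_def sum_fun_at if_distrib[of "\<lambda>z. _ * z"] cong: if_cong)
  qed
  have zero: "c x = 0" if "(\<Sum>x\<in>X. (\<lambda>y. c x * \<delta> x y)) = 0" "x \<in> X" for c :: "'i \<Rightarrow> 'k" and x
    using fun_cong[OF that(1)[unfolded comb], of x] that(2) by simp
  show inj: "inj_on \<delta> X"
    by (rule fun_vs.independent_image(1)[OF fin]) (rule zero)
  show "fun_vs.independent (\<delta> ` X)"
    by (rule fun_vs.independent_image(2)[OF fin]) (rule zero)
  show "fun_vs.span (\<delta> ` X) = funs_on X"
    unfolding fun_vs.span_image_inj[OF fin inj] comb
  proof safe
    fix f :: "'i \<Rightarrow> 'k" assume "f \<in> funs_on X"
    then have "f = (\<lambda>y. if y \<in> X then f y else 0)" by (auto simp: funs_on_def)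
    then show "\<exists>c. f = (\<lambda>y. if y \<in> X then c y else 0) \<and> True" by blast
  qed (auto simp: funs_on_def)
qed

lemma finite_dim_funs_on: "finite X \<Longrightarrow> fun_vs.finite_dim (funs_on X :: ('i \<Rightarrow> 'k::field) set)"
  unfolding fun_vs.finite_dim_def using funs_on_basis(3)[of X, where 'k = 'k] by (metis finite_imageI order_refl)

lemma dim_funs_on: "finite X \<Longrightarrow> fun_vs.dim (funs_on X :: ('i \<Rightarrow> 'k::field) set) = card X"
  using fun_vs.dim_span_eq_card_independent[OF funs_on_basis(2)[of X, where 'k = 'k]]
    funs_on_basis(3)[of X, where 'k = 'k] card_image[OF funs_on_basis(1)[of X, where 'k = 'k]] by simp

abbreviation unit_monomial :: "nat \<Rightarrow> (nat \<Rightarrow>\<^sub>0 nat)" where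
  "unit_monomial i \<equiv> Poly_Mapping.single i 1"

lemma lookup_poly_var_mult:
  fixes f :: "'k::comm_ring_1 polynomial"
  shows "Poly_Mapping.lookup (poly_var i * f) m =
    (if 1 \<le> Poly_Mapping.lookup m i then Poly_Mapping.lookup f (m - unit_monomial i) else 0)"
proof (cases "1 \<le> Poly_Mapping.lookup m i")
  case True
  have "m = unit_monomial i + (m - unit_monomial i)"
    by (rule poly_mapping_eqI) (use True in \<open>auto simp: lookup_add lookup_minus lookup_single when_def\<close>)
  then show ?thesis
    using True lookup_single_mult[of "unit_monomial i" 1 f "m - unit_monomial i"]
    by (simp add: poly_var_def)
next
  case False
  have "m \<noteq> unit_monomial i + b" for b
    using False by (auto simp: lookup_add)
  then have "Poly_Mapping.lookup (poly_var i * f) m = 0"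
    unfolding poly_var_def by (rule lookup_single_mult_eq_0)
  then show ?thesis using False by simp
qed

locale monomial_box =
  fixes ds :: "nat list" and a :: "nat \<Rightarrow> 'k::field_char_0"
  assumes ds_pos: "\<forall>d\<in>set ds. 1 \<le> d"
begin

definition supp :: "nat set" where "supp = {i. i < length ds \<and> a i \<noteq> 0}"

text \<open>The grading of the Lefschetz property: the variables outside the support have degree
\<open>0\<close>, so that multiplication by the linear form is homogeneous of degree one and the
top degree involves the support only.\<close>

definition wdeg :: "(nat \<Rightarrow>\<^sub>0 nat) \<Rightarrow> nat" where
  "wdeg m = (\<Sum>i\<in>supp. Poly_Mapping.lookup m i)"

definition socle_degree :: nat where "socle_degree = (\<Sum>i\<in>supp. ds ! i - 1)"

text \<open>Multiplication by \<open>x\<^sub>i\<close>, written on coefficient functions: the coefficient of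
\<open>m\<close> in the product is the coefficient of \<open>m / x\<^sub>i\<close>.\<close>

definition raise :: "nat \<Rightarrow> ((nat \<Rightarrow>\<^sub>0 nat) \<Rightarrow> 'k) \<Rightarrow> (nat \<Rightarrow>\<^sub>0 nat) \<Rightarrow> 'k" where
  "raise i f m = (if m \<in> box ds \<and> 1 \<le> Poly_Mapping.lookup m i then f (m - unit_monomial i) else 0)"

text \<open>The map that sends the exponent \<open>e\<close> of \<open>x\<^sub>i\<close> to
\<open>e - 1\<close> with the coefficient \<open>e (d - e)\<close>, where \<open>d\<close> is
the \<open>i\<close>-th entry of the list: it makes the polynomials in one variable modulo the
\<open>d\<close>-th power the irreducible representation of dimension \<open>d\<close>. On
coefficient functions \<open>e\<close> is one more than the exponent at the argument.\<close>

definition lower :: "nat \<Rightarrow> ((nat \<Rightarrow>\<^sub>0 nat) \<Rightarrow> 'k) \<Rightarrow> (nat \<Rightarrow>\<^sub>0 nat) \<Rightarrow> 'k" where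
  "lower i f m = (if m \<in> box ds then
      of_nat ((Poly_Mapping.lookup m i + 1) * (ds ! i - 1 - Poly_Mapping.lookup m i)) *
        f (m + unit_monomial i) else 0)"

definition E :: "((nat \<Rightarrow>\<^sub>0 nat) \<Rightarrow> 'k) \<Rightarrow> (nat \<Rightarrow>\<^sub>0 nat) \<Rightarrow> 'k" where
  "E f m = (\<Sum>i\<in>supp. a i * raise i f m)"

text \<open>The weights are the inverses of the coefficients of the linear form, so that the coefficients
cancel in the commutator.\<close>

definition F :: "((nat \<Rightarrow>\<^sub>0 nat) \<Rightarrow> 'k) \<Rightarrow> (nat \<Rightarrow>\<^sub>0 nat) \<Rightarrow> 'k" where
  "F f m = (\<Sum>i\<in>supp. inverse (a i) * lower i f m)"

definition layer :: "nat \<Rightarrow> (nat \<Rightarrow>\<^sub>0 nat) set" where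
  "layer j = {m \<in> box ds. wdeg m = j}"

lemma finite_supp: "finite supp"
  by (simp add: supp_def)

lemma supp_lt: "i \<in> supp \<Longrightarrow> i < length ds"
  by (simp add: supp_def)

lemma finite_layer: "finite (layer j)"
  using finite_box by (simp add: layer_def)

lemma box_lookup_lt: "m \<in> box ds \<Longrightarrow> i < length ds \<Longrightarrow> Poly_Mapping.lookup m i < ds ! i"
  by (simp add: box_def)

lemma wdeg_add_unit: "i \<in> supp \<Longrightarrow> wdeg (m + unit_monomial i) = Suc (wdeg m)"
  using finite_supp by (simp add: wdeg_def lookup_add sum.distrib lookup_single when_def)

lemma minus_unit_add:
  "1 \<le> Poly_Mapping.lookup m i \<Longrightarrow> m - unit_monomial i + unit_monomial i = m"
  by (rule poly_mapping_eqI) (auto simp: lookup_add lookup_minus lookup_single when_def)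

lemma wdeg_minus_unit:
  assumes "i \<in> supp" "1 \<le> Poly_Mapping.lookup m i"
  shows "wdeg m = Suc (wdeg (m - unit_monomial i))"
  using wdeg_add_unit[OF assms(1), of "m - unit_monomial i"] minus_unit_add[OF assms(2)] by simp

lemma minus_unit_in_box: "m \<in> box ds \<Longrightarrow> m - unit_monomial i \<in> box ds"
  by (auto simp: box_def lookup_minus in_keys_iff subset_iff less_imp_diff_less)

lemma add_unit_in_box_iff:
  assumes "m \<in> box ds" "i < length ds"
  shows "m + unit_monomial i \<in> box ds \<longleftrightarrow> Suc (Poly_Mapping.lookup m i) < ds ! i"
  using assms by (auto simp: box_def lookup_add lookup_single when_def in_keys_iff subset_iff split: if_splits)

lemma wdeg_le: "m \<in> box ds \<Longrightarrow> wdeg m \<le> socle_degree"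
  unfolding wdeg_def socle_degree_def
  by (rule sum_mono) (use box_lookup_lt supp_lt in fastforce)

lemma lower_raise_commute:
  assumes ik: "i \<noteq> k" "k < length ds"
  shows "lower k (raise i f) = raise i (lower k f)"
proof
  fix m
  show "lower k (raise i f) m = raise i (lower k f) m"
  proof (cases "m \<in> box ds \<and> 1 \<le> Poly_Mapping.lookup m i")
    case True
    have eq: "m - unit_monomial i + unit_monomial k = m + unit_monomial k - unit_monomial i"
      by (rule poly_mapping_eqI)
        (use True ik in \<open>auto simp: lookup_add lookup_minus lookup_single when_def\<close>)
    \<comment> \<open>where raising by \<open>x\<^sub>k\<close> leads out of the box, the coefficient of \<open>lower\<close> vanishes\<close>
    have "m + unit_monomial k \<notin> box ds \<Longrightarrow> ds ! k - 1 - Poly_Mapping.lookup m k = 0"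
      using add_unit_in_box_iff[of m k] True ik(2) by simp
    then show ?thesis
      using True minus_unit_in_box[of m i] ik
      by (auto simp: lower_def raise_def lookup_add lookup_minus lookup_single when_def eq
          simp del: One_nat_def)
  next
    case False
    then show ?thesis
      using ik by (auto simp: lower_def raise_def lookup_add lookup_single when_def)
  qed
qed

text \<open>With \<open>x\<close> the exponent of \<open>x\<^sub>k\<close> and \<open>d + 1\<close> the
\<open>k\<close>-th entry of the list, this is the identity
\<open>(x + 1) (d - x) - x (d + 1 - x) = d - 2 x\<close>.\<close>

lemma lower_raise_same:
  assumes m: "m \<in> box ds" and k: "k < length ds"
  shows "lower k (raise k f) m - raise k (lower k f) m =
    of_int (int (ds ! k - 1) - 2 * int (Poly_Mapping.lookup m k)) * f m"
proof -
  define x where "x = Poly_Mapping.lookup m k"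
  define d where "d = ds ! k - 1"
  have x: "x \<le> d" using box_lookup_lt[OF m k] by (simp add: x_def d_def)
  have 1: "lower k (raise k f) m = of_nat ((x + 1) * (d - x)) * f m"
  proof (cases "m + unit_monomial k \<in> box ds")
    case True
    then show ?thesis using m by (simp add: lower_def raise_def lookup_add x_def d_def)
  next
    case False
    then have "d - x = 0" using add_unit_in_box_iff[OF m k] by (simp add: x_def d_def)
    then show ?thesis using m by (simp add: lower_def x_def d_def)
  qed
  have 2: "raise k (lower k f) m = of_nat (x * (d + 1 - x)) * f m"
  proof (cases "1 \<le> x")
    case True
    then have "d - (x - 1) = d + 1 - x" using x by simp
    then show ?thesis
      using m True minus_unit_add[of m k] minus_unit_in_box[OF m, of k]
      by (simp add: lower_def raise_def lookup_minus x_def d_def)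
  next
    case False
    then show ?thesis by (simp add: raise_def x_def)
  qed
  obtain e where "d = x + e" using x le_Suc_ex by blast
  then have "int ((x + 1) * (d - x)) - int (x * (d + 1 - x)) = int d - 2 * int x"
    by (simp add: algebra_simps)
  then have "(of_nat ((x + 1) * (d - x)) - of_nat (x * (d + 1 - x)) :: 'k) = of_int (int d - 2 * int x)"
    by (metis of_int_diff of_int_of_nat_eq)
  then show ?thesis unfolding 1 2 left_diff_distrib[symmetric] x_def d_def by simp
qed

lemma lower_sum: "lower k (\<lambda>m. \<Sum>i\<in>A. c i * g i m) m = (\<Sum>i\<in>A. c i * lower k (g i) m)"
  by (simp add: lower_def sum_distrib_left mult.left_commute)

lemma raise_sum: "raise k (\<lambda>m. \<Sum>i\<in>A. c i * g i m) m = (\<Sum>i\<in>A. c i * raise k (g i) m)"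
  by (cases "m \<in> box ds \<and> 1 \<le> Poly_Mapping.lookup m k") (auto simp: raise_def)

lemma commutator_EF:
  assumes m: "m \<in> box ds"
  shows "F (E f) m - E (F f) m = of_int (int socle_degree - 2 * int (wdeg m)) * f m"
proof -
  have FE: "F (E f) m = (\<Sum>k\<in>supp. \<Sum>i\<in>supp. inverse (a k) * a i * lower k (raise i f) m)"
  proof -
    have "E f = (\<lambda>m. \<Sum>i\<in>supp. a i * raise i f m)" by (rule ext) (rule E_def)
    then show ?thesis unfolding F_def by (simp add: lower_sum sum_distrib_left mult.assoc)
  qed
  have "E (F f) m = (\<Sum>i\<in>supp. \<Sum>k\<in>supp. inverse (a k) * a i * raise i (lower k f) m)"
  proof -
    have "F f = (\<lambda>m. \<Sum>k\<in>supp. inverse (a k) * lower k f m)" by (rule ext) (rule F_def)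
    then show ?thesis unfolding E_def by (simp add: raise_sum sum_distrib_left mult.left_commute mult.assoc)
  qed
  also have "\<dots> = (\<Sum>k\<in>supp. \<Sum>i\<in>supp. inverse (a k) * a i * raise i (lower k f) m)"
    by (rule sum.swap)
  finally have "F (E f) m - E (F f) m = (\<Sum>k\<in>supp. \<Sum>i\<in>supp.
      inverse (a k) * a i * (lower k (raise i f) m - raise i (lower k f) m))"
    unfolding FE by (simp add: sum_subtractf right_diff_distrib)
  also have "\<dots> = (\<Sum>k\<in>supp. of_int (int (ds ! k - 1) - 2 * int (Poly_Mapping.lookup m k)) * f m)"
  proof (rule sum.cong[OF refl])
    fix k assume k: "k \<in> supp"
    have "(\<Sum>i\<in>supp. inverse (a k) * a i * (lower k (raise i f) m - raise i (lower k f) m)) =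
        (\<Sum>i\<in>supp. if i = k then lower k (raise k f) m - raise k (lower k f) m else 0)"
      using k lower_raise_commute[OF _ supp_lt[OF k]] by (intro sum.cong) (auto simp: supp_def)
    also have "\<dots> = lower k (raise k f) m - raise k (lower k f) m"
      using k finite_supp by simp
    also have "\<dots> = of_int (int (ds ! k - 1) - 2 * int (Poly_Mapping.lookup m k)) * f m"
      by (rule lower_raise_same[OF m supp_lt[OF k]])
    finally show "(\<Sum>i\<in>supp. inverse (a k) * a i * (lower k (raise i f) m - raise i (lower k f) m)) =
      of_int (int (ds ! k - 1) - 2 * int (Poly_Mapping.lookup m k)) * f m" .
  qed
  also have "\<dots> = of_int (\<Sum>k\<in>supp. int (ds ! k - 1) - 2 * int (Poly_Mapping.lookup m k)) * f m"
    by (simp add: sum_distrib_right)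
  also have "(\<Sum>k\<in>supp. int (ds ! k - 1) - 2 * int (Poly_Mapping.lookup m k)) =
      int socle_degree - 2 * int (wdeg m)"
    by (simp add: socle_degree_def wdeg_def sum_subtractf sum_distrib_left)
  finally show ?thesis .
qed

lemma raise_linear: "raise i (f + g) m = raise i f m + raise i g m" "raise i (\<lambda>x. c * f x) m = c * raise i f m"
  by (simp_all add: raise_def)

lemma lower_linear: "lower i (f + g) m = lower i f m + lower i g m" "lower i (\<lambda>x. c * f x) m = c * lower i f m"
  by (simp_all add: lower_def distrib_left mult.left_commute)

lemma E_linear: "E (f + g) = E f + E g" "E (\<lambda>x. c * f x) = (\<lambda>x. c * E f x)"
  by (rule ext, simp add: E_def raise_linear distrib_left sum.distrib sum_distrib_left mult.left_commute)+

lemma F_linear: "F (f + g) = F f + F g" "F (\<lambda>x. c * f x) = (\<lambda>x. c * F f x)"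
  by (rule ext, simp add: F_def lower_linear distrib_left sum.distrib sum_distrib_left mult.left_commute)+

lemma linear_E: "Vector_Spaces.linear (\<lambda>c f x. c * f x) (\<lambda>c f x. c * f x) E"
  unfolding Vector_Spaces.linear_iff using E_linear fun_vs.vector_space_axioms by blast

lemma E_nonzero:
  assumes "E f m \<noteq> 0"
  obtains i where "i \<in> supp" "m \<in> box ds" "1 \<le> Poly_Mapping.lookup m i" "f (m - unit_monomial i) \<noteq> 0"
proof -
  obtain i where "i \<in> supp" "a i * raise i f m \<noteq> 0"
    using assms unfolding E_def by (rule sum.not_neutral_contains_not_neutral)
  then show thesis using that by (auto simp: raise_def split: if_splits)
qed

lemma F_nonzero:
  assumes "F f m \<noteq> 0"
  obtains i where "i \<in> supp" "m \<in> box ds" "f (m + unit_monomial i) \<noteq> 0"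
proof -
  obtain i where "i \<in> supp" "inverse (a i) * lower i f m \<noteq> 0"
    using assms unfolding F_def by (rule sum.not_neutral_contains_not_neutral)
  then show thesis using that by (auto simp: lower_def split: if_splits)
qed

text \<open>The bijection behind the symmetry of the dimensions: complementing the exponents in the support
exchanges the degree \<open>j\<close> with its complement in the top degree.\<close>

definition reflect :: "(nat \<Rightarrow>\<^sub>0 nat) \<Rightarrow> (nat \<Rightarrow>\<^sub>0 nat)" where
  "reflect m = (\<Sum>i<length ds. Poly_Mapping.single i
     (if i \<in> supp then ds ! i - 1 - Poly_Mapping.lookup m i else Poly_Mapping.lookup m i))"

lemma lookup_reflect: "Poly_Mapping.lookup (reflect m) i = (if i < length ds then
    (if i \<in> supp then ds ! i - 1 - Poly_Mapping.lookup m i else Poly_Mapping.lookup m i) else 0)"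
  by (simp add: reflect_def lookup_sum lookup_single when_def)

lemma reflect_in_box: "m \<in> box ds \<Longrightarrow> reflect m \<in> box ds"
  using ds_pos by (force simp: box_def lookup_reflect in_keys_iff set_conv_nth split: if_splits)

lemma reflect_reflect: "m \<in> box ds \<Longrightarrow> reflect (reflect m) = m"
proof (rule poly_mapping_eqI)
  fix i assume m: "m \<in> box ds"
  have "Poly_Mapping.lookup m i = 0" if "\<not> i < length ds"
    using m that by (auto simp: box_def in_keys_iff subset_iff)
  then show "Poly_Mapping.lookup (reflect (reflect m)) i = Poly_Mapping.lookup m i"
    using box_lookup_lt[OF m, of i] by (auto simp: lookup_reflect)
qed

lemma wdeg_reflect:
  assumes m: "m \<in> box ds"
  shows "wdeg (reflect m) + wdeg m = socle_degree"
  unfolding wdeg_def socle_degree_def sum.distrib[symmetric]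
proof (rule sum.cong[OF refl])
  fix i assume i: "i \<in> supp"
  then show "Poly_Mapping.lookup (reflect m) i + Poly_Mapping.lookup m i = ds ! i - 1"
    using box_lookup_lt[OF m supp_lt[OF i]] supp_lt[OF i] by (simp add: lookup_reflect)
qed

lemma card_layer_symmetric:
  assumes "j \<le> socle_degree"
  shows "card (layer (socle_degree - j)) = card (layer j)"
proof (rule bij_betw_same_card, rule bij_betw_byWitness[where f' = reflect and f = reflect])
  show "\<forall>m\<in>layer (socle_degree - j). reflect (reflect m) = m" "\<forall>m\<in>layer j. reflect (reflect m) = m"
    by (auto simp: layer_def reflect_reflect)
  have "reflect m \<in> layer (socle_degree - wdeg m)" if "m \<in> box ds" for m
    using wdeg_reflect[OF that] reflect_in_box[OF that] by (simp add: layer_def)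
  then show "reflect ` layer (socle_degree - j) \<subseteq> layer j" "reflect ` layer j \<subseteq> layer (socle_degree - j)"
    using assms by (force simp: layer_def)+
qed

lemma layer_empty: "socle_degree < j \<Longrightarrow> layer j = {}"
  using wdeg_le by (fastforce simp: layer_def)

sublocale lef: lefschetz "\<lambda>c f x. c * f x" E F "\<lambda>j. funs_on (layer j)" socle_degree
proof
  show "E (f + g) = E f + E g" "E (\<lambda>x. c * f x) = (\<lambda>x. c * E f x)"
    "F (f + g) = F f + F g" "F (\<lambda>x. c * f x) = (\<lambda>x. c * F f x)" for f g c
    by (rule E_linear F_linear)+
  show "fun_vs.subspace (funs_on (layer j))" for j by (rule subspace_funs_on)
  show "fun_vs.finite_dim (funs_on (layer j))" for j by (rule finite_dim_funs_on[OF finite_layer])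
  show "fun_vs.dim (funs_on (layer (socle_degree - j))) = fun_vs.dim (funs_on (layer j))"
    if "j \<le> socle_degree" for j
    using card_layer_symmetric[OF that] by (simp add: dim_funs_on[OF finite_layer])
  show "funs_on (layer j) = {0}" if "socle_degree < j" for j
    using layer_empty[OF that] by (auto simp: funs_on_def)
  show "E v \<in> funs_on (layer (Suc j))" if v: "v \<in> funs_on (layer j)" for v j
  proof -
    have "m \<in> layer (Suc j)" if nz: "E v m \<noteq> 0" for m
    proof -
      obtain i where i: "i \<in> supp" "m \<in> box ds" "1 \<le> Poly_Mapping.lookup m i" "v (m - unit_monomial i) \<noteq> 0"
        by (rule E_nonzero[OF nz])
      then have "m - unit_monomial i \<in> layer j" using v by (auto simp: funs_on_def)
      then show ?thesis using wdeg_minus_unit[OF i(1,3)] i(2) by (simp add: layer_def)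
    qed
    then show ?thesis by (auto simp: funs_on_def)
  qed
  have F_layer: "\<exists>i\<in>supp. m + unit_monomial i \<in> layer j" "m \<in> box ds"
    if "v \<in> funs_on (layer j)" "F v m \<noteq> 0" for v j m
    using F_nonzero[OF that(2)] that(1) by (auto simp: funs_on_def)
  show "F v \<in> funs_on (layer j)" if v: "v \<in> funs_on (layer (Suc j))" for v j
  proof -
    have "m \<in> layer j" if nz: "F v m \<noteq> 0" for m
      using F_layer[OF v nz] wdeg_add_unit by (auto simp: layer_def)
    then show ?thesis by (auto simp: funs_on_def)
  qed
  show "F v = 0" if v: "v \<in> funs_on (layer 0)" for v
  proof
    fix m
    have False if nz: "F v m \<noteq> 0"
      using F_layer[OF v nz] wdeg_add_unit by (auto simp: layer_def)
    then show "F v m = 0 m" by auto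
  qed
  show "F (E v) - E (F v) = (\<lambda>x. of_int (int socle_degree - 2 * int j) * v x)"
    if v: "v \<in> funs_on (layer j)" for v j
  proof
    fix m
    show "(F (E v) - E (F v)) m = of_int (int socle_degree - 2 * int j) * v m"
    proof (cases "m \<in> box ds")
      case True
      then have "v m = 0 \<or> wdeg m = j" using v by (auto simp: funs_on_def layer_def)
      then show ?thesis using commutator_EF[OF True, of v] by auto
    next
      case False
      then have "F (E v) m = 0" "E (F v) m = 0" "v m = 0"
        using E_nonzero[of "F v" m] F_nonzero[of "E v" m] v by (blast, blast, auto simp: funs_on_def layer_def)
      then show ?thesis by simp
    qed
  qed
qed

end

context monomial_box
begin

definition layer_part :: "nat \<Rightarrow> ((nat \<Rightarrow>\<^sub>0 nat) \<Rightarrow> 'k) \<Rightarrow> (nat \<Rightarrow>\<^sub>0 nat) \<Rightarrow> 'k" where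
  "layer_part t f m = (if wdeg m = t then f m else 0)"

lemma linear_layer_part: "Vector_Spaces.linear (\<lambda>c f x. c * f x) (\<lambda>c f x. c * f x) (layer_part t)"
proof -
  have "layer_part t (f + g) = layer_part t f + layer_part t g"
    "layer_part t (\<lambda>x. c * f x) = (\<lambda>x. c * layer_part t f x)" for f g c
    by (rule ext, simp add: layer_part_def)+
  then show ?thesis unfolding Vector_Spaces.linear_iff using fun_vs.vector_space_axioms by blast
qed

lemma E_layer_part: "E (layer_part t f) = layer_part (Suc t) (E f)"
proof
  fix m
  have "raise i (layer_part t f) m = (if wdeg m = Suc t then raise i f m else 0)" if "i \<in> supp" for i
    using wdeg_minus_unit[OF that, of m] by (auto simp: raise_def layer_part_def)
  then have "E (layer_part t f) m = (\<Sum>i\<in>supp. a i * (if wdeg m = Suc t then raise i f m else 0))"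
    unfolding E_def by simp
  then show "E (layer_part t f) m = layer_part (Suc t) (E f) m"
    by (simp add: layer_part_def E_def)
qed

lemma E_pow_layer_part: "(E ^^ k) (layer_part t f) = layer_part (t + k) ((E ^^ k) f)"
  by (induction k) (simp_all add: E_layer_part)

lemma E_pow_0: "(E ^^ k) 0 = 0"
  by (rule lef.pair.linear_0[OF lef.linear_E_pow])

text \<open>The operator \<open>E\<close> is homogeneous, so the kernel of its power is the direct sum of its
graded pieces. The dimensions are added up along the filtration by degree, where each step is
split by the projection to the component of top degree.\<close>

theorem dim_kernel_E_pow_box:
  "fun_vs.dim {v \<in> funs_on (box ds). (E ^^ k) v = 0} =
    (\<Sum>j\<le>socle_degree. card (layer j) - card (layer (j + k)))"
proof -
  define W where "W t = {v \<in> funs_on {m \<in> box ds. wdeg m < t}. (E ^^ k) v = 0}" for t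
  have W_sub: "fun_vs.subspace (W t)" for t
  proof -
    have "W t = funs_on {m \<in> box ds. wdeg m < t} \<inter> {v. (E ^^ k) v = 0}" by (auto simp: W_def)
    then show ?thesis
      using fun_vs.subspace_inter[OF subspace_funs_on lef.pair.linear_subspace_kernel[OF lef.linear_E_pow]]
      by simp
  qed
  have W_fin: "fun_vs.finite_dim (W t)" for t
  proof (rule fun_vs.finite_dim_subset[OF finite_dim_funs_on])
    show "finite {m \<in> box ds. wdeg m < t}" using finite_box by simp
  qed (auto simp: W_def)
  have dim_W: "fun_vs.dim (W t) = (\<Sum>j<t. card (layer j) - card (layer (j + k)))" for t
  proof (induction t)
    case 0
    have "W 0 = {0}" using E_pow_0 by (auto simp: W_def funs_on_def)
    then show ?case using fun_vs.dim_zero_space by simp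
  next
    case (Suc t)
    have ker: "{w \<in> W (Suc t). layer_part t w = 0} = W t"
    proof safe
      fix w assume w: "w \<in> W (Suc t)" "layer_part t w = 0"
      have t: "w m = 0" if "wdeg m = t" for m
        using fun_cong[OF w(2), of m] that by (simp add: layer_part_def)
      have "w m = 0" if "\<not> (m \<in> box ds \<and> wdeg m < t)" for m
      proof (cases "wdeg m = t")
        case False
        then show ?thesis using w(1) that by (auto simp: W_def funs_on_def)
      qed (rule t)
      then show "w \<in> W t" using w(1) by (auto simp: W_def funs_on_def)
    next
      fix w assume w: "w \<in> W t"
      then show "w \<in> W (Suc t)" by (auto simp: W_def funs_on_def)
      show "layer_part t w = 0"
        using w by (intro ext) (auto simp: W_def funs_on_def layer_part_def)
    qed
    have im: "layer_part t ` W (Suc t) = {v \<in> funs_on (layer t). (E ^^ k) v = 0}"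
    proof
      show "layer_part t ` W (Suc t) \<subseteq> {v \<in> funs_on (layer t). (E ^^ k) v = 0}"
      proof (rule image_subsetI)
        fix w assume w: "w \<in> W (Suc t)"
        have "(E ^^ k) (layer_part t w) = layer_part (t + k) 0"
          using w by (simp add: E_pow_layer_part W_def)
        also have "\<dots> = 0" by (rule ext) (simp add: layer_part_def)
        finally have "(E ^^ k) (layer_part t w) = 0" .
        moreover have "layer_part t w \<in> funs_on (layer t)"
          using w by (auto simp: W_def funs_on_def layer_part_def layer_def)
        ultimately show "layer_part t w \<in> {v \<in> funs_on (layer t). (E ^^ k) v = 0}" by blast
      qed
      show "{v \<in> funs_on (layer t). (E ^^ k) v = 0} \<subseteq> layer_part t ` W (Suc t)"
      proof
        fix v assume v: "v \<in> {v \<in> funs_on (layer t). (E ^^ k) v = 0}"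
        have "v = layer_part t v"
          using v by (intro ext) (auto simp: funs_on_def layer_def layer_part_def)
        moreover have "v \<in> W (Suc t)" using v by (auto simp: W_def funs_on_def layer_def)
        ultimately show "v \<in> layer_part t ` W (Suc t)" by blast
      qed
    qed
    have "fun_vs.dim (W (Suc t)) = fun_vs.dim {v \<in> funs_on (layer t). (E ^^ k) v = 0} + fun_vs.dim (W t)"
      using lef.pair.dim_image_plus_dim_kernel[OF linear_layer_part W_sub W_fin, of t "Suc t"]
      unfolding ker im by simp
    also have "fun_vs.dim {v \<in> funs_on (layer t). (E ^^ k) v = 0} = card (layer t) - card (layer (t + k))"
      unfolding lef.dim_kernel_E_pow dim_funs_on[OF finite_layer] ..
    finally show ?case using Suc by simp
  qed
  have "W (Suc socle_degree) = {v \<in> funs_on (box ds). (E ^^ k) v = 0}"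
  proof -
    have "{m \<in> box ds. wdeg m < Suc socle_degree} = box ds"
      using wdeg_le by (auto simp: less_Suc_eq_le)
    then show ?thesis by (simp add: W_def)
  qed
  then show ?thesis using dim_W[of "Suc socle_degree"] unfolding lessThan_Suc_atMost by simp
qed

lemma E_pow_nonzero: "(E ^^ k) f m \<noteq> 0 \<Longrightarrow> f \<in> funs_on (box ds) \<Longrightarrow> m \<in> box ds \<and> k \<le> wdeg m"
proof (induction k arbitrary: m)
  case 0
  then show ?case by (auto simp: funs_on_def)
next
  case (Suc k)
  have "E ((E ^^ k) f) m \<noteq> 0" using Suc.prems(1) by simp
  then obtain i where i: "i \<in> supp" "m \<in> box ds" "1 \<le> Poly_Mapping.lookup m i"
    "(E ^^ k) f (m - unit_monomial i) \<noteq> 0"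
    by (rule E_nonzero)
  then show ?case using Suc.IH[OF i(4) Suc.prems(2)] wdeg_minus_unit[OF i(1,3)] by simp
qed

lemma E_nilpotent: "f \<in> funs_on (box ds) \<Longrightarrow> (E ^^ Suc socle_degree) f = 0"
proof (rule ext)
  fix m assume f: "f \<in> funs_on (box ds)"
  show "(E ^^ Suc socle_degree) f m = 0 m"
    using E_pow_nonzero[OF _ f, of "Suc socle_degree" m] wdeg_le[of m]
    by (cases "(E ^^ Suc socle_degree) f m = 0") (auto simp del: funpow.simps)
qed

definition normal_form :: "'k polynomial \<Rightarrow> (nat \<Rightarrow>\<^sub>0 nat) \<Rightarrow> 'k" where
  "normal_form p m = (if m \<in> box ds then Poly_Mapping.lookup p m else 0)"

abbreviation form :: "'k polynomial" where "form \<equiv> linear_form (length ds) a"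

lemma linear_normal_form:
  "Vector_Spaces.linear (\<lambda>c f. poly_const c * f) (\<lambda>c f x. c * f x) normal_form"
proof -
  have "normal_form (f + g) = normal_form f + normal_form g"
    "normal_form (poly_const c * f) = (\<lambda>x. c * normal_form f x)" for f g c
    by (rule ext, simp add: normal_form_def lookup_add)+
  then show ?thesis
    unfolding Vector_Spaces.linear_iff
    using fun_vs.vector_space_axioms poly_vs.vector_space_axioms by blast
qed

lemma normal_form_eq_0_iff:
  assumes "f \<in> carrier (poly_ring (length ds))"
  shows "normal_form f = 0 \<longleftrightarrow> f \<in> monomial_ideal ds"
proof -
  have "normal_form f = 0 \<longleftrightarrow> (\<forall>m\<in>box ds. Poly_Mapping.lookup f m = 0)"
    by (auto simp: fun_eq_iff normal_form_def)
  also have "\<dots> \<longleftrightarrow> f \<in> monomial_ideal ds"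
    using assms unfolding monomial_ideal_eq supported_on_def poly_carrier_iff by (auto simp: in_keys_iff)
  finally show ?thesis .
qed

lemma normal_form_image: "normal_form ` carrier (poly_ring (length ds)) = funs_on (box ds)"
proof
  show "normal_form ` carrier (poly_ring (length ds)) \<subseteq> funs_on (box ds)"
    by (auto simp: normal_form_def funs_on_def)
  show "funs_on (box ds) \<subseteq> normal_form ` carrier (poly_ring (length ds))"
  proof
    fix f :: "(nat \<Rightarrow>\<^sub>0 nat) \<Rightarrow> 'k" assume f: "f \<in> funs_on (box ds)"
    define p where "p = (\<Sum>m\<in>box ds. Poly_Mapping.single m (f m))"
    have lookup: "Poly_Mapping.lookup p m = (if m \<in> box ds then f m else 0)" for m
      using finite_box by (simp add: p_def lookup_sum lookup_single when_def)
    have p: "p \<in> carrier (poly_ring (length ds))"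
      by (auto simp: poly_carrier_iff in_keys_iff lookup box_def subset_iff split: if_splits)
    have "f = normal_form p"
      using f by (intro ext) (auto simp: normal_form_def lookup funs_on_def)
    then show "f \<in> normal_form ` carrier (poly_ring (length ds))" using p by (rule image_eqI)
  qed
qed

lemma form_closed: "form \<in> carrier (poly_ring (length ds))"
proof -
  have "poly_var i \<in> carrier (poly_ring (length ds) :: 'k polynomial ring)" if "i < length ds" for i
    using that by (auto simp: poly_var_def poly_carrier_iff split: if_splits)
  then have "poly_vs.subspace (carrier (poly_ring (length ds)) :: 'k polynomial set)"
    "\<And>i. i < length ds \<Longrightarrow> poly_const (a i) * poly_var i \<in> carrier (poly_ring (length ds))"
    unfolding carrier_poly_ring using subspace_supported_on poly_vs.subspace_scale by blast+
  then show ?thesis unfolding linear_form_def by (intro poly_vs.subspace_sum) auto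
qed

lemma normal_form_mult:
  "normal_form (form * f) = E (normal_form f)"
proof
  fix m
  show "normal_form (form * f) m = E (normal_form f) m"
  proof (cases "m \<in> box ds")
    case True
    have "Poly_Mapping.lookup (form * f) m = (\<Sum>i<length ds. a i * Poly_Mapping.lookup (poly_var i * f) m)"
      by (simp add: linear_form_def sum_distrib_right lookup_sum mult.assoc)
    also have "\<dots> = (\<Sum>i\<in>supp. a i * Poly_Mapping.lookup (poly_var i * f) m)"
      by (rule sum.mono_neutral_right) (auto simp: supp_def)
    also have "\<dots> = (\<Sum>i\<in>supp. a i * raise i (normal_form f) m)"
      using True minus_unit_in_box[OF True]
      by (intro sum.cong refl) (simp add: lookup_poly_var_mult raise_def normal_form_def)
    finally show ?thesis using True by (simp add: normal_form_def E_def)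
  next
    case False
    then show ?thesis using E_nonzero[of "normal_form f" m] by (auto simp: normal_form_def)
  qed
qed

lemma form_homogeneous: "homogeneous 1 form"
proof -
  have "mdeg m = 1" if "m \<in> Poly_Mapping.keys form" for m
  proof -
    have "Poly_Mapping.lookup form m = (\<Sum>i<length ds. a i * Poly_Mapping.lookup (poly_var i) m)"
      by (simp add: linear_form_def lookup_sum)
    then have "(\<Sum>i<length ds. a i * Poly_Mapping.lookup (poly_var i) m) \<noteq> 0"
      using that by (simp add: in_keys_iff)
    then obtain i where "a i * Poly_Mapping.lookup (poly_var i) m \<noteq> 0"
      by (rule sum.not_neutral_contains_not_neutral)
    then have "m = unit_monomial i" by (auto simp: poly_var_def lookup_single when_def split: if_splits)
    then show ?thesis by (simp add: mdeg_def)
  qed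
  then show ?thesis by (simp add: homogeneous_iff)
qed

sublocale pq: poly_quotient "length ds" "monomial_ideal ds :: 'k polynomial set"
  by (rule poly_quotient_monomial_ideal[OF ds_pos])

sublocale pm: poly_quotient_model "length ds" "monomial_ideal ds :: 'k polynomial set"
  "\<lambda>c f x. c * f x" normal_form E form
proof (rule poly_quotient_model.intro, rule pq.poly_quotient_axioms, rule fun_vs.vector_space_axioms,
    rule poly_quotient_model_axioms.intro)
  show "Vector_Spaces.linear (\<lambda>c f. poly_const c * f) (\<lambda>c f x. c * f x) normal_form"
    by (rule linear_normal_form)
  show "Vector_Spaces.linear (\<lambda>c f x. c * f x) (\<lambda>c f x. c * f x) E" by (rule linear_E)
qed (simp_all add: normal_form_eq_0_iff form_closed normal_form_mult)

text \<open>Multiplication by a linear form raises the degree. With respect to the monomials in the order of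
descending degree its matrix is therefore upper triangular.\<close>

lemma triangular_representation:
  obtains us M where
    "represents pq.Q pq.const us (\<lambda>x. pq.proj form \<otimes>\<^bsub>pq.Q\<^esub> x) M" "upper_triangular M"
proof -
  obtain xs where xs: "set xs = box ds" "distinct xs" using finite_distinct_list[OF finite_box] by blast
  \<comment> \<open>sorting is ascending, hence the reversal\<close>
  define ms where "ms = rev (sort_key mdeg xs)"
  have ms: "set ms = box ds" "distinct ms" using xs by (simp_all add: ms_def)
  have sorted: "mdeg (ms ! j) \<le> mdeg (ms ! i)" if "i \<le> j" "j < length ms" for i j
  proof -
    have "sorted (map mdeg (sort_key mdeg xs))" by simp
    then show ?thesis
      using that sorted_nth_mono[of "map mdeg (sort_key mdeg xs)" "length xs - Suc j" "length xs - Suc i"]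
      by (simp add: ms_def rev_nth)
  qed
  define ps where "ps = map (\<lambda>m. Poly_Mapping.single m (1 :: 'k)) ms"
  define N where "N = length ms"
  define M where "M = mat N N (\<lambda>(i, j). Poly_Mapping.lookup (form * ps ! j) (ms ! i))"
  have len: "length ps = N" by (simp add: ps_def N_def)
  have psS: "set ps \<subseteq> pq.S"
    using ms(1) by (auto simp: ps_def poly_carrier_iff box_def split: if_splits)
  have psS': "ps ! j \<in> pq.S" if "j < N" for j using psS len that nth_mem by blast
  have lookup_comb: "Poly_Mapping.lookup (\<Sum>i<N. poly_const (c i) * ps ! i) (ms ! j) = c j"
    if j: "j < N" for c j
  proof -
    have "Poly_Mapping.lookup (\<Sum>i<N. poly_const (c i) * ps ! i) (ms ! j) =
        (\<Sum>i<N. if i = j then c i else 0)"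
      unfolding lookup_sum
    proof (rule sum.cong[OF refl])
      fix i assume "i \<in> {..<N}"
      then show "Poly_Mapping.lookup (poly_const (c i) * ps ! i) (ms ! j) = (if i = j then c i else 0)"
        using j ms(2) by (simp add: ps_def N_def lookup_single when_def nth_eq_iff_index_eq)
    qed
    also have "\<dots> = c j" using j by simp
    finally show ?thesis .
  qed
  have combS: "(\<Sum>i<N. poly_const (c i) * ps ! i) \<in> pq.S" for c
    using pq.lincomb_in_S[OF psS, of c] len by simp
  have reduce: "pq.proj f = pq.proj (\<Sum>i<N. poly_const (Poly_Mapping.lookup f (ms ! i)) * ps ! i)"
    if f: "f \<in> pq.S" for f
  proof -
    let ?g = "\<Sum>i<N. poly_const (Poly_Mapping.lookup f (ms ! i)) * ps ! i"
    have "normal_form f = normal_form ?g"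
    proof
      fix m show "normal_form f m = normal_form ?g m"
      proof (cases "m \<in> box ds")
        case True
        then obtain j where "j < N" "m = ms ! j" using ms(1) by (metis N_def in_set_conv_nth)
        then show ?thesis using lookup_comb[of j "\<lambda>i. Poly_Mapping.lookup f (ms ! i)"]
          by (simp add: normal_form_def)
      qed (simp add: normal_form_def)
    qed
    then show ?thesis using pm.nf_eq_iff[OF f combS] pq.proj_eq_iff[OF f combS] by simp
  qed
  have "represents pq.Q pq.const (map pq.proj ps) (\<lambda>x. pq.proj form \<otimes>\<^bsub>pq.Q\<^esub> x) M"
    unfolding represents_def
  proof (intro conjI allI impI)
    show "pq.Q.independent (range pq.const) (map pq.proj ps)"
      unfolding pq.independent_proj_iff[OF psS] len
    proof (intro allI impI)
      fix c i assume "(\<Sum>i<N. poly_const (c i) * ps ! i) \<in> monomial_ideal ds" and i: "i < N"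
      then have "normal_form (\<Sum>i<N. poly_const (c i) * ps ! i) = 0"
        using normal_form_eq_0_iff[OF combS, of c] by simp
      then have "normal_form (\<Sum>i<N. poly_const (c i) * ps ! i) (ms ! i) = 0" by simp
      moreover have "ms ! i \<in> box ds" using i ms(1) nth_mem N_def by blast
      ultimately show "c i = 0" using lookup_comb[OF i] by (simp add: normal_form_def)
    qed
    show "pq.Q.Span (range pq.const) (map pq.proj ps) = carrier pq.Q"
      unfolding pq.Span_proj[OF psS] pq.carrier_Q len
    proof (intro subset_antisym subsetI)
      fix y assume "y \<in> {pq.proj (\<Sum>i<N. poly_const (c i) * ps ! i) | c. True}"
      then obtain c where "y = pq.proj (\<Sum>i<N. poly_const (c i) * ps ! i)" by auto
      then show "y \<in> pq.proj ` pq.S" by (rule image_eqI[OF _ combS])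
    next
      fix y assume "y \<in> pq.proj ` pq.S"
      then obtain f where "f \<in> pq.S" "y = pq.proj f" by auto
      then show "y \<in> {pq.proj (\<Sum>i<N. poly_const (c i) * ps ! i) | c. True}" using reduce by auto
    qed
    show "M \<in> carrier_mat (length (map pq.proj ps)) (length (map pq.proj ps))"
      by (simp add: M_def len)
    fix j assume "j < length (map pq.proj ps)"
    then have j: "j < N" using len by simp
    have "pq.proj form \<otimes>\<^bsub>pq.Q\<^esub> (map pq.proj ps ! j) = pq.proj (form * ps ! j)"
      using pq.proj_simps(2)[OF form_closed psS'[OF j]] j len by simp
    also have "\<dots> = pq.proj (\<Sum>i<N. poly_const (Poly_Mapping.lookup (form * ps ! j) (ms ! i)) * ps ! i)"
      by (rule reduce[OF poly_ring_closed(4)[OF form_closed psS'[OF j]]])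
    also have "(\<Sum>i<N. poly_const (Poly_Mapping.lookup (form * ps ! j) (ms ! i)) * ps ! i) =
        (\<Sum>i<N. poly_const (M $$ (i, j)) * ps ! i)"
      using j by (intro sum.cong refl) (simp add: M_def)
    also have "pq.proj \<dots> = pq.Q.combine (map (\<lambda>i. pq.const (M $$ (i, j))) [0..<length ps]) (map pq.proj ps)"
      using pq.combine_proj[OF psS, of "\<lambda>i. M $$ (i, j)"] len by simp
    finally show "pq.proj form \<otimes>\<^bsub>pq.Q\<^esub> (map pq.proj ps ! j) =
        pq.Q.combine (map (\<lambda>i. pq.const (M $$ (i, j))) [0..<length (map pq.proj ps)]) (map pq.proj ps)"
      by simp
  qed
  moreover have "upper_triangular M"
    unfolding upper_triangular_def
  proof (intro allI impI)
    fix i j assume "i < dim_row M" and ji: "j < i"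
    then have i: "i < N" by (simp add: M_def)
    have "homogeneous (mdeg (ms ! j)) (ps ! j)"
      using i ji by (simp add: ps_def N_def homogeneous_iff)
    then have "homogeneous (1 + mdeg (ms ! j)) (form * ps ! j)"
      by (rule homogeneous_mult[OF form_homogeneous])
    moreover have "mdeg (ms ! i) \<noteq> 1 + mdeg (ms ! j)"
      using sorted[of j i] i ji by (simp add: N_def)
    ultimately have "ms ! i \<notin> Poly_Mapping.keys (form * ps ! j)" by (auto simp: homogeneous_iff)
    then show "M $$ (i, j) = 0" using i ji by (simp add: M_def in_keys_iff)
  qed
  ultimately show thesis by (rule that)
qed

end

section \<open>Counting monomials\<close>

lemma sum_box_eq_sum_PiE:
  "(\<Sum>m\<in>box ds. f (restrict (Poly_Mapping.lookup m) {..<length ds})) =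
    (\<Sum>g\<in>PiE {..<length ds} (\<lambda>i. {..<ds ! i}). f g)"
proof (rule sum.reindex_bij_betw)
  let ?r = "\<lambda>m. restrict (Poly_Mapping.lookup m) {..<length ds}"
  show "bij_betw ?r (box ds) (PiE {..<length ds} (\<lambda>i. {..<ds ! i}))"
  proof (rule bij_betw_imageI)
    show "inj_on ?r (box ds)"
    proof (rule inj_onI, rule poly_mapping_eqI)
      fix x y i assume x: "x \<in> box ds" and y: "y \<in> box ds" and eq: "?r x = ?r y"
      show "Poly_Mapping.lookup x i = Poly_Mapping.lookup y i"
      proof (cases "i < length ds")
        case True
        then show ?thesis using fun_cong[OF eq, of i] by simp
      next
        case False
        then have "i \<notin> Poly_Mapping.keys x" "i \<notin> Poly_Mapping.keys y" using x y by (auto simp: box_def)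
        then show ?thesis by (simp add: in_keys_iff)
      qed
    qed
    show "?r ` box ds = PiE {..<length ds} (\<lambda>i. {..<ds ! i})"
    proof
      show "?r ` box ds \<subseteq> PiE {..<length ds} (\<lambda>i. {..<ds ! i})"
        by (intro image_subsetI PiE_I) (auto simp: box_def)
      show "PiE {..<length ds} (\<lambda>i. {..<ds ! i}) \<subseteq> ?r ` box ds"
      proof
        fix g assume g: "g \<in> PiE {..<length ds} (\<lambda>i. {..<ds ! i})"
        define m where "m = (\<Sum>i<length ds. Poly_Mapping.single i (g i))"
        have lookup: "Poly_Mapping.lookup m i = (if i < length ds then g i else 0)" for i
          by (simp add: m_def lookup_sum lookup_single when_def)
        have "m \<in> box ds"
          using g by (auto simp: box_def lookup in_keys_iff PiE_iff split: if_splits)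
        moreover have "g = ?r m"
          using g by (intro ext) (auto simp: lookup PiE_iff extensional_def)
        ultimately show "g \<in> ?r ` box ds" by blast
      qed
    qed
  qed
qed

definition truncated_geometric :: "nat \<Rightarrow> nat poly" where
  "truncated_geometric d = (\<Sum>e<d. monom 1 e)"

text \<open>Expanding the product picks one exponent for every variable; a variable outside \<open>A\<close>
contributes only the number of its exponents, since it has degree \<open>0\<close>.\<close>

lemma box_generating_function:
  assumes A: "A \<subseteq> {..<length ds}"
  shows "(\<Sum>m\<in>box ds. monom (1 :: nat) (\<Sum>i\<in>A. Poly_Mapping.lookup m i)) =
    (\<Prod>i<length ds. if i \<in> A then truncated_geometric (ds ! i) else of_nat (ds ! i))"
proof -
  let ?f = "\<lambda>i e. if i \<in> A then monom (1 :: nat) e else 1"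
  have prod_f: "(\<Prod>i<length ds. ?f i (g i)) = monom 1 (\<Sum>i\<in>A. g i)" for g
  proof -
    have "(\<Prod>i<length ds. ?f i (g i)) = (\<Prod>i\<in>A. monom 1 (g i))"
      using A by (intro prod.mono_neutral_cong_right) auto
    also have "\<dots> = monom 1 (\<Sum>i\<in>A. g i)"
      using finite_subset[OF A finite_lessThan]
      by (induction A rule: finite_induct) (simp_all add: mult_monom monom_eq_1 del: One_nat_def)
    finally show ?thesis .
  qed
  have "(\<Sum>m\<in>box ds. monom (1 :: nat) (\<Sum>i\<in>A. Poly_Mapping.lookup m i)) =
      (\<Sum>m\<in>box ds. \<Prod>i<length ds. ?f i (restrict (Poly_Mapping.lookup m) {..<length ds} i))"
  proof (rule sum.cong[OF refl])
    fix m :: "nat \<Rightarrow>\<^sub>0 nat"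
    have "(\<Prod>i<length ds. ?f i (restrict (Poly_Mapping.lookup m) {..<length ds} i)) =
        (\<Prod>i<length ds. ?f i (Poly_Mapping.lookup m i))"
      by (intro prod.cong) auto
    then show "monom 1 (\<Sum>i\<in>A. Poly_Mapping.lookup m i) =
        (\<Prod>i<length ds. ?f i (restrict (Poly_Mapping.lookup m) {..<length ds} i))"
      by (simp only: prod_f)
  qed
  also have "\<dots> = (\<Sum>g\<in>PiE {..<length ds} (\<lambda>i. {..<ds ! i}). \<Prod>i<length ds. ?f i (g i))"
    by (rule sum_box_eq_sum_PiE)
  also have "\<dots> = (\<Prod>i<length ds. \<Sum>e<ds ! i. ?f i e)"
    by (rule prod_sum_PiE[symmetric]) simp_all
  also have "\<dots> = (\<Prod>i<length ds. if i \<in> A then truncated_geometric (ds ! i) else of_nat (ds ! i))"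
    by (intro prod.cong refl) (simp add: truncated_geometric_def)
  finally show ?thesis .
qed

lemma prod_nths_split:
  fixes f g :: "'a \<Rightarrow> 'b::comm_monoid_mult"
  shows "(\<Prod>i<length xs. if i \<in> A then f (xs ! i) else g (xs ! i)) =
    prod_list (map f (nths xs A)) * prod_list (map g (nths xs (- A)))"
proof (induction xs rule: rev_induct)
  case (snoc x xs)
  have "(\<Prod>i<length xs. if i \<in> A then f ((xs @ [x]) ! i) else g ((xs @ [x]) ! i)) =
      (\<Prod>i<length xs. if i \<in> A then f (xs ! i) else g (xs ! i))"
    by (intro prod.cong) (auto simp: nth_append)
  then show ?case using snoc by (simp add: nths_append mult_ac)
qed simp

lemma coeff_sum_monom:
  assumes "finite X"
  shows "coeff (\<Sum>x\<in>X. monom (1 :: nat) (w x)) j = card {x \<in> X. w x = j}"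
  using assms by (simp add: coeff_sum sum.If_cases Collect_conj_eq)

lemma nths_Int_lessThan: "nths xs (A \<inter> {..<length xs}) = nths xs A"
  unfolding nths_def
proof (rule arg_cong[where f = "map fst"], rule filter_cong[OF refl])
  fix x assume "x \<in> set (zip xs [0..<length xs])"
  then have "snd x < length xs" by (auto simp: in_set_zip)
  then show "snd x \<in> A \<inter> {..<length xs} \<longleftrightarrow> snd x \<in> A" by simp
qed

lemma prod_list_map_of_nat: "prod_list (map of_nat xs) = (of_nat (prod_list xs) :: 'a::comm_semiring_1)"
  by (induction xs) simp_all

text \<open>The variables outside \<open>A\<close> contribute the constant factor of the generating function,
the variables in \<open>A\<close> the generating function of the shorter list.\<close>

lemma card_box_nths:
  assumes A: "A \<subseteq> {..<length ds}"
  shows "card {m \<in> box ds. (\<Sum>i\<in>A. Poly_Mapping.lookup m i) = j} =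
    prod_list (nths ds (- A)) * card {m \<in> box (nths ds A). mdeg m = j}"
proof -
  let ?es = "nths ds A"
  have "card {m \<in> box ds. (\<Sum>i\<in>A. Poly_Mapping.lookup m i) = j} =
      coeff (\<Prod>i<length ds. if i \<in> A then truncated_geometric (ds ! i) else of_nat (ds ! i)) j"
    unfolding box_generating_function[OF A, symmetric] by (rule coeff_sum_monom[OF finite_box, symmetric])
  also have "(\<Prod>i<length ds. if i \<in> A then truncated_geometric (ds ! i) else of_nat (ds ! i)) =
      prod_list (map truncated_geometric ?es) * prod_list (map of_nat (nths ds (- A)))"
    by (rule prod_nths_split)
  also have "prod_list (map of_nat (nths ds (- A))) = (of_nat (prod_list (nths ds (- A))) :: nat poly)"
    by (rule prod_list_map_of_nat)
  also have "coeff (prod_list (map truncated_geometric ?es) * of_nat (prod_list (nths ds (- A)))) j =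
      prod_list (nths ds (- A)) * coeff (prod_list (map truncated_geometric ?es)) j"
    by (simp add: of_nat_poly)
  also have "prod_list (map truncated_geometric ?es) = (\<Sum>m\<in>box ?es. monom 1 (mdeg m))"
  proof -
    have "prod_list (map truncated_geometric ?es) = (\<Prod>i<length ?es. truncated_geometric (?es ! i))"
      using prod_nths_split[where xs = ?es and A = UNIV and f = truncated_geometric and g = truncated_geometric]
      by (simp add: nths_all)
    also have "\<dots> = (\<Sum>m\<in>box ?es. monom 1 (\<Sum>i<length ?es. Poly_Mapping.lookup m i))"
      using box_generating_function[of "{..<length ?es}" ?es] by simp
    also have "\<dots> = (\<Sum>m\<in>box ?es. monom 1 (mdeg m))"
    proof (rule sum.cong[OF refl])
      fix m assume "m \<in> box ?es"
      then have "mdeg m = (\<Sum>i<length ?es. Poly_Mapping.lookup m i)"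
        by (intro mdeg_superset) (auto simp: box_def)
      then show "monom 1 (\<Sum>i<length ?es. Poly_Mapping.lookup m i) = monom 1 (mdeg m)" by simp
    qed
    finally show ?thesis .
  qed
  also have "coeff (\<Sum>m\<in>box ?es. monom 1 (mdeg m)) j = card {m \<in> box ?es. mdeg m = j}"
    by (rule coeff_sum_monom[OF finite_box])
  finally show ?thesis .
qed

section \<open>Jordan types of linear forms\<close>

text \<open>The partition denoted by \<open>P\<close> with a subscript in the literature, computed from the
powers of the variables.\<close>

definition CI_partition :: "nat list \<Rightarrow> nat multiset" where
  "CI_partition es =
    (let h = \<lambda>d. card {m \<in> box es. mdeg m = d}
     in conjugate_partition (image_mset h (mset_set {d. h d \<noteq> 0})))"

lemma is_CI_partition_iff:
  assumes "\<forall>d\<in>set es. 1 \<le> d"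
  shows "is_CI_partition TYPE('k::field) es P \<longleftrightarrow> P = CI_partition es"
proof -
  have "conjugate_partition (hilbert_partition (length es) (Idl\<^bsub>poly_ring (length es)\<^esub> (set fs))) =
      CI_partition es" if "complete_intersection es fs" for fs :: "'k polynomial list"
    using hilbert_function_complete_intersection[OF assms that]
    unfolding hilbert_partition_def CI_partition_def Let_def by presburger
  moreover have "\<exists>fs :: 'k polynomial list. complete_intersection es fs"
    using complete_intersection_poly_var_powers(1)[OF assms] by blast
  ultimately show ?thesis unfolding is_CI_partition_def by auto
qed

lemma sum_repeat_mset: "(\<Sum>p\<in>#repeat_mset m P. f p) = m * (\<Sum>p\<in>#P. f p :: nat)"
proof (induction m)
  case (Suc m)
  show ?case by (simp only: repeat_mset_Suc image_mset_union sum_mset.union Suc.IH mult_Suc)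
qed simp

context monomial_box
begin

lemma supp_subset: "supp \<subseteq> {..<length ds}"
  by (auto simp: supp_def)

lemma multiplicity_pos: "0 < prod_list (nths ds (- supp))"
proof -
  have "set (nths ds (- supp)) \<subseteq> set ds" by (rule set_nths_subset)
  then have "0 \<notin> set (nths ds (- supp))" using ds_pos by force
  then show ?thesis by (induction "nths ds (- supp)") (auto simp: prod_list_zero_iff intro!: Nat.gr0I)
qed

lemma card_layer: "card (layer j) =
    prod_list (nths ds (- supp)) * card {m \<in> box (nths ds supp). mdeg m = j}"
  unfolding layer_def wdeg_def by (rule card_box_nths[OF supp_subset])

text \<open>Unimodality of the number of monomials of given degree is inherited from the Lefschetz property of
the graded space, by cancelling the common factor.\<close>

theorem dim_kernel_E_pow_eq_sum_min:
  "fun_vs.dim {v \<in> funs_on (box ds). (E ^^ k) v = 0} =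
    (\<Sum>p\<in>#repeat_mset (prod_list (nths ds (- supp))) (CI_partition (nths ds supp)). min k p)"
proof -
  define c where "c = prod_list (nths ds (- supp))"
  define h where "h d = card {m \<in> box (nths ds supp). mdeg m = d}" for d
  have layer: "card (layer j) = c * h j" for j unfolding card_layer c_def h_def ..
  have c: "0 < c" unfolding c_def by (rule multiplicity_pos)
  have support: "{j. h j \<noteq> 0} \<subseteq> {..socle_degree}"
  proof
    fix j assume "j \<in> {j. h j \<noteq> 0}"
    then have "card (layer j) \<noteq> 0" using layer c by simp
    then show "j \<in> {..socle_degree}" using layer_empty[of j] by (cases "j \<le> socle_degree") auto
  qed
  have unimodal: "min (h i) (h l) \<le> h j" if "i \<le> j" "j \<le> l" for i j l
  proof -
    have "min (c * h i) (c * h l) \<le> c * h j"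
      using lef.dim_V_unimodal[OF that] unfolding dim_funs_on[OF finite_layer] layer .
    then show ?thesis using c by (auto simp: min_le_iff_disj)
  qed
  have "fun_vs.dim {v \<in> funs_on (box ds). (E ^^ k) v = 0} = (\<Sum>j\<le>socle_degree. c * (h j - h (j + k)))"
    unfolding dim_kernel_E_pow_box layer by (simp add: diff_mult_distrib2)
  also have "\<dots> = c * (\<Sum>j\<le>socle_degree. h j - h (j + k))" by (simp add: sum_distrib_left)
  also have "(\<Sum>j\<le>socle_degree. h j - h (j + k)) = (\<Sum>j | h j \<noteq> 0. h j - h (j + k))"
    by (rule sum.mono_neutral_right) (use support in auto)
  also have "\<dots> = (\<Sum>p\<in>#CI_partition (nths ds supp). min k p)"
    unfolding CI_partition_def Let_def h_def[symmetric]
    by (rule sum_min_conjugate_partition[symmetric, OF finite_subset[OF support finite_atMost] unimodal])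
  finally show ?thesis unfolding sum_repeat_mset c_def .
qed

theorem form_has_jordan_type_iff:
  "form_has_jordan_type ds form P \<longleftrightarrow>
    P = repeat_mset (prod_list (nths ds (- supp))) (CI_partition (nths ds supp))"
proof -
  let ?P = "repeat_mset (prod_list (nths ds (- supp))) (CI_partition (nths ds supp))"
  obtain us M where "represents pq.Q pq.const us (\<lambda>x. pq.proj form \<otimes>\<^bsub>pq.Q\<^esub> x) M" "upper_triangular M"
    by (rule triangular_representation)
  moreover have "0 \<notin># ?P"
  proof -
    have "count (CI_partition (nths ds supp)) 0 = 0"
      using zero_notin_conjugate_partition unfolding CI_partition_def Let_def by (simp only: not_in_iff)
    then show ?thesis by (simp add: not_in_iff)
  qed
  ultimately have "has_jordan_type pq.Q pq.const (\<lambda>x. pq.proj form \<otimes>\<^bsub>pq.Q\<^esub> x) P \<longleftrightarrow> P = ?P"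
    by (intro pm.has_jordan_type_iff[where K = "Suc socle_degree"])
      (simp_all only: normal_form_image dim_kernel_E_pow_eq_sum_min E_nilpotent not_False_eq_True)
  then show ?thesis unfolding form_has_jordan_type_def monomial_CI_def .
qed

lemma form_eq_0_iff: "form = 0 \<longleftrightarrow> supp = {}"
proof -
  have "Poly_Mapping.lookup form m = (\<Sum>i<length ds. if m = unit_monomial i then a i else 0)" for m
    unfolding linear_form_def lookup_sum
    by (intro sum.cong refl) (auto simp: poly_var_def lookup_single when_def)
  moreover have "(\<Sum>i<length ds. if unit_monomial j = unit_monomial i then a i else 0) =
      (if j < length ds then a j else 0)" for j
  proof -
    have "unit_monomial j = unit_monomial i \<longleftrightarrow> i = j" for i
      by (metis One_nat_def lookup_single_eq lookup_single_not_eq zero_neq_one)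
    then show ?thesis by simp
  qed
  ultimately have lookup: "Poly_Mapping.lookup form m = (\<Sum>i<length ds. if m = unit_monomial i then a i else 0)"
    "Poly_Mapping.lookup form (unit_monomial j) = (if j < length ds then a j else 0)" for m j
    by simp_all
  show ?thesis
  proof
    assume "form = 0"
    then have "(if j < length ds then a j else 0) = 0" for j using lookup(2)[of j] by simp
    then show "supp = {}" unfolding supp_def by (metis (mono_tags, lifting) Collect_empty_eq)
  next
    assume "supp = {}"
    then have "a i = 0" if "i < length ds" for i using that by (auto simp: supp_def)
    then show "form = 0" by (simp add: linear_form_def poly_const_def)
  qed
qed

lemma prod_list_div: "prod_list ds div prod_list (nths ds supp) = prod_list (nths ds (- supp))"
proof -
  have "prod_list ds = prod_list (nths ds supp) * prod_list (nths ds (- supp))"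
    using prod_nths_split[where xs = ds and A = supp and f = "\<lambda>x. x" and g = "\<lambda>x. x"]
    by (simp add: prod.list_conv_set_nth lessThan_atLeast0)
  moreover have "0 \<notin> set ds" using ds_pos by force
  then have "prod_list (nths ds supp) \<noteq> 0"
    using set_nths_subset[of ds supp] by (auto simp: prod_list_zero_iff)
  ultimately show ?thesis by simp
qed

end

theorem proposition3p7:
  fixes ds :: "nat list"
  assumes "\<forall>d\<in>set ds. 1 \<le> d"
  shows "{P. \<exists>a :: nat \<Rightarrow> 'k::{alg_closed_field, field_char_0}.
             linear_form (length ds) a \<noteq> 0 \<and>
             form_has_jordan_type ds (linear_form (length ds) a) P} =
         {repeat_mset (prod_list ds div prod_list es) P | es P.
             es \<noteq> [] \<and> subseq es ds \<and> is_CI_partition TYPE('k) es P}"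
    (is "?L = ?R")
proof -
  have box: "monomial_box ds" using assms by (rule monomial_box.intro)
  have pos: "\<forall>d\<in>set (nths ds A). 1 \<le> d" for A using assms set_nths_subset[of ds A] by blast
  show ?thesis
  proof
    show "?L \<subseteq> ?R"
    proof
      fix P assume "P \<in> ?L"
      then obtain a :: "nat \<Rightarrow> 'k" where a: "linear_form (length ds) a \<noteq> 0"
        "form_has_jordan_type ds (linear_form (length ds) a) P" by blast
      interpret monomial_box ds a by (rule box)
      let ?es = "nths ds supp"
      have "P = repeat_mset (prod_list ds div prod_list ?es) (CI_partition ?es)"
        using form_has_jordan_type_iff a(2) prod_list_div by simp
      moreover have "?es \<noteq> []"
      proof
        assume "?es = []"
        then have "{ds ! i | i. i < length ds \<and> i \<in> supp} = {}" using set_nths[of ds supp] by simp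
        then have "supp = {}" using supp_subset by auto
        then show False using form_eq_0_iff a(1) by simp
      qed
      moreover have "subseq ?es ds" using subseq_conv_nths by blast
      moreover have "is_CI_partition TYPE('k) ?es (CI_partition ?es)"
        using is_CI_partition_iff[OF pos] by blast
      ultimately show "P \<in> ?R" by blast
    qed
    show "?R \<subseteq> ?L"
    proof
      fix Q assume "Q \<in> ?R"
      then obtain es P where Q: "Q = repeat_mset (prod_list ds div prod_list es) P" "es \<noteq> []"
        "subseq es ds" "is_CI_partition TYPE('k) es P" by blast
      obtain A where A: "es = nths ds A" using Q(3) by (auto simp: subseq_conv_nths)
      \<comment> \<open>the sum of the variables in \<open>A\<close> has the prescribed support\<close>
      let ?a = "\<lambda>i. if i \<in> A then 1 else 0 :: 'k"
      interpret monomial_box ds ?a by (rule box)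
      have "supp = A \<inter> {..<length ds}" by (auto simp: supp_def)
      then have es: "es = nths ds supp" using A by (simp only: nths_Int_lessThan)
      have "P = CI_partition es" using Q(4) is_CI_partition_iff[OF pos] A by blast
      then have "form_has_jordan_type ds form Q"
        using form_has_jordan_type_iff Q(1) prod_list_div es by simp
      moreover have "form \<noteq> 0" using form_eq_0_iff Q(2) es by auto
      ultimately show "Q \<in> ?L" by blast
    qed
  qed
qed

end
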